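(* Let $G$ be a (discrete) locally nilpotent group that is not locally finite. Then $G$ is strongly not (FS). In particular, $C^*(G)$ does not have real rank zero.
   Context: All groups are discrete. $C^*(G)$ denotes the full group $C^*$-algebra of $G$. A $C^*$-algebra $A$ has real rank zero if for every $a=a^*\in A$ and every $\varepsilon>0$ there exists $v=v^*\in A$ with finite spectrum such that $\|a-v\|<\varepsilon$. For $a\in C^*(G)$ set $d(a):=\inf\{\|a-v\| : v=v^*\in C^*(G),\ v \text{ has finite spectrum}\}$. A group $G$ is periodic if every element has finite order. A group $G$ is called strongly not (FS) if it is not periodic and, for every $g\in G$ of infinite order, $d\left(\frac{g+g^{-1}}{2}\right)=1$. A group is locally finite if it is an increasing (directed) union of finite subgroups, i.e. every finitely generated subgroup is finite. A group is locally nilpotent if every finitely generated subgroup is nilpotent. *)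

theory Defs
  imports
    "HOL-Analysis.Analysis"
    "HOL-Library.Function_Algebras"
    "HOL-Algebra.QuotRing"
    "HOL-Algebra.Module"
    "HOL-Algebra.Generated_Groups"
    "HOL-Algebra.Multiplicative_Group"
begin

section \<open>Periodic, locally finite and locally nilpotent groups\<close>

(* group.ord is 0 exactly at the elements of infinite order. *)
definition periodic_group :: "('a, 'b) monoid_scheme \<Rightarrow> bool" where
  "periodic_group G \<longleftrightarrow> (\<forall>g\<in>carrier G. group.ord G g \<noteq> 0)"

primrec lower_central :: "('a, 'b) monoid_scheme \<Rightarrow> nat \<Rightarrow> 'a set" where
  "lower_central G 0 = carrier G"
| "lower_central G (Suc n) = generate G
     (\<Union>x\<in>lower_central G n. \<Union>y\<in>carrier G.
        {x \<otimes>\<^bsub>G\<^esub> y \<otimes>\<^bsub>G\<^esub> inv\<^bsub>G\<^esub> x \<otimes>\<^bsub>G\<^esub> inv\<^bsub>G\<^esub> y})"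

definition nilpotent_group :: "('a, 'b) monoid_scheme \<Rightarrow> bool" where
  "nilpotent_group G \<longleftrightarrow> (\<exists>n. lower_central G n = {\<one>\<^bsub>G\<^esub>})"

definition locally_finite :: "('a, 'b) monoid_scheme \<Rightarrow> bool" where
  "locally_finite G \<longleftrightarrow> (\<forall>S\<subseteq>carrier G. finite S \<longrightarrow> finite (generate G S))"

definition locally_nilpotent :: "('a, 'b) monoid_scheme \<Rightarrow> bool" where
  "locally_nilpotent G \<longleftrightarrow>
     (\<forall>S\<subseteq>carrier G. finite S \<longrightarrow> nilpotent_group (G\<lparr>carrier := generate G S\<rparr>))"


section \<open>Unitary representations\<close>

(* The Hilbert space is the subset H of an ambient complex vector space that carries no topology
   of its own; ip is conjugate-linear in its first argument. *)
locale complex_hilbert_space = vector_space scale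
  for scale :: "complex \<Rightarrow> 'h::ab_group_add \<Rightarrow> 'h" (infixr "*s" 75) +
  fixes H :: "'h set" and ip :: "'h \<Rightarrow> 'h \<Rightarrow> complex"
  assumes subspace_H: "subspace H"
    and ip_add: "\<lbrakk>x \<in> H; y \<in> H; z \<in> H\<rbrakk> \<Longrightarrow> ip x (y + z) = ip x y + ip x z"
    and ip_scale: "\<lbrakk>x \<in> H; y \<in> H\<rbrakk> \<Longrightarrow> ip x (c *s y) = c * ip x y"
    and ip_cnj: "\<lbrakk>x \<in> H; y \<in> H\<rbrakk> \<Longrightarrow> ip y x = cnj (ip x y)"
    and ip_nonneg: "x \<in> H \<Longrightarrow> 0 \<le> Re (ip x x)"
    and ip_definite: "\<lbrakk>x \<in> H; ip x x = 0\<rbrakk> \<Longrightarrow> x = 0"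
    and complete_H: "\<lbrakk>\<And>n. X n \<in> H;
        \<And>e. e > 0 \<Longrightarrow> \<exists>M. \<forall>m\<ge>M. \<forall>n\<ge>M. sqrt (Re (ip (X m - X n) (X m - X n))) < e\<rbrakk>
      \<Longrightarrow> \<exists>x\<in>H. (\<lambda>n. sqrt (Re (ip (X n - x) (X n - x)))) \<longlonglongrightarrow> 0"

(* Each U g maps H onto H, because U (inv g) is a two-sided inverse. *)
locale unitary_rep = complex_hilbert_space scale H ip + group G
  for scale :: "complex \<Rightarrow> 'h::ab_group_add \<Rightarrow> 'h" (infixr "*s" 75) and H ip
    and G :: "('a, 'b) monoid_scheme" (structure) +
  fixes U :: "'a \<Rightarrow> 'h \<Rightarrow> 'h"
  assumes U_closed: "\<lbrakk>g \<in> carrier G; x \<in> H\<rbrakk> \<Longrightarrow> U g x \<in> H"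
    and U_add: "\<lbrakk>g \<in> carrier G; x \<in> H; y \<in> H\<rbrakk> \<Longrightarrow> U g (x + y) = U g x + U g y"
    and U_scale: "\<lbrakk>g \<in> carrier G; x \<in> H\<rbrakk> \<Longrightarrow> U g (c *s x) = c *s U g x"
    and U_ip: "\<lbrakk>g \<in> carrier G; x \<in> H; y \<in> H\<rbrakk> \<Longrightarrow> ip (U g x) (U g y) = ip x y"
    and U_one: "x \<in> H \<Longrightarrow> U \<one> x = x"
    and U_mult: "\<lbrakk>g \<in> carrier G; h \<in> carrier G; x \<in> H\<rbrakk> \<Longrightarrow> U (g \<otimes> h) x = U g (U h x)"

definition rep_apply ::
    "(complex \<Rightarrow> 'h::ab_group_add \<Rightarrow> 'h) \<Rightarrow> ('a \<Rightarrow> 'h \<Rightarrow> 'h) \<Rightarrow> ('a \<Rightarrow> complex) \<Rightarrow> 'h \<Rightarrow> 'h" where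
  "rep_apply scl U f \<xi> = (\<Sum>g | f g \<noteq> 0. scl (f g) (U g \<xi>))"


section \<open>The complex group algebra and its full norm\<close>

definition group_algebra :: "('a, 'b) monoid_scheme \<Rightarrow> ('a \<Rightarrow> complex) ring" where
  "group_algebra G =
    \<lparr>carrier = {f. finite {g. f g \<noteq> 0} \<and> {g. f g \<noteq> 0} \<subseteq> carrier G},
     mult = (\<lambda>f h x. if x \<in> carrier G
                then \<Sum>y | f y \<noteq> 0. f y * h (inv\<^bsub>G\<^esub> y \<otimes>\<^bsub>G\<^esub> x) else 0),
     one = (\<lambda>x. if x = \<one>\<^bsub>G\<^esub> then 1 else 0),
     zero = (\<lambda>x. 0),
     add = (\<lambda>f h x. f x + h x)\<rparr>"

definition group_algebra_adj :: "('a, 'b) monoid_scheme \<Rightarrow> ('a \<Rightarrow> complex) \<Rightarrow> 'a \<Rightarrow> complex" where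
  "group_algebra_adj G f = (\<lambda>x. if x \<in> carrier G then cnj (f (inv\<^bsub>G\<^esub> x)) else 0)"

abbreviation (input) fun_scale :: "complex \<Rightarrow> ('a \<Rightarrow> complex) \<Rightarrow> 'a \<Rightarrow> complex" where
  "fun_scale c f \<equiv> (\<lambda>x. c * f x)"

(* The supremum of the operator norms of pi(f) over all unitary representations pi of G.
   HOL cannot quantify over all Hilbert spaces, so H ranges over the Hilbert spaces that are
   pointwise linear subspaces of the functions on the group, with arbitrary inner products.
   Nothing is lost: up to unitary equivalence every cyclic representation has this form, through
   its matrix coefficients. Lemma rep_norm_le_full_norm below proves that no unitary
   representation, on a Hilbert space of any type, gives a larger value. *)
definition full_norm :: "('a, 'b) monoid_scheme \<Rightarrow> ('a \<Rightarrow> complex) \<Rightarrow> real" where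
  "full_norm G f = Sup {sqrt (Re (ip (rep_apply fun_scale U f \<xi>) (rep_apply fun_scale U f \<xi>))) |
      (H :: ('a \<Rightarrow> complex) set) ip U \<xi>.
      unitary_rep fun_scale H ip G U \<and> \<xi> \<in> H \<and> sqrt (Re (ip \<xi> \<xi>)) \<le> 1}"


section \<open>The full group C*-algebra\<close>

record 'c cstar_struct = "(complex, 'c) module" +
  adj :: "'c \<Rightarrow> 'c"
  cnorm :: "'c \<Rightarrow> real"

(* The completion of the group algebra: Cauchy sequences modulo null sequences. *)
definition cauchy_ring :: "('a, 'b) monoid_scheme \<Rightarrow> (nat \<Rightarrow> 'a \<Rightarrow> complex) ring" where
  "cauchy_ring G =
    \<lparr>carrier = {s. (\<forall>n. s n \<in> carrier (group_algebra G)) \<and>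
        (\<forall>e>0. \<exists>M. \<forall>m\<ge>M. \<forall>n\<ge>M. full_norm G (\<lambda>x. s m x - s n x) < e)},
     mult = (\<lambda>s t n. s n \<otimes>\<^bsub>group_algebra G\<^esub> t n),
     one = (\<lambda>n. \<one>\<^bsub>group_algebra G\<^esub>),
     zero = (\<lambda>n. \<zero>\<^bsub>group_algebra G\<^esub>),
     add = (\<lambda>s t n. s n \<oplus>\<^bsub>group_algebra G\<^esub> t n)\<rparr>"

definition null_ideal :: "('a, 'b) monoid_scheme \<Rightarrow> (nat \<Rightarrow> 'a \<Rightarrow> complex) set" where
  "null_ideal G = {s \<in> carrier (cauchy_ring G). (\<lambda>n. full_norm G (s n)) \<longlonglongrightarrow> 0}"

definition full_group_cstar ::
    "('a, 'b) monoid_scheme \<Rightarrow> (nat \<Rightarrow> 'a \<Rightarrow> complex) set cstar_struct" where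
  "full_group_cstar G = (let R = cauchy_ring G; I = null_ideal G; Q = R Quot I in
    \<lparr>carrier = carrier Q, mult = mult Q, one = one Q, zero = zero Q, add = add Q,
     smult = (\<lambda>c X. \<Union>s\<in>X. I +>\<^bsub>R\<^esub> (\<lambda>n. fun_scale c (s n))),
     adj = (\<lambda>X. \<Union>s\<in>X. I +>\<^bsub>R\<^esub> (\<lambda>n. group_algebra_adj G (s n))),
     cnorm = (\<lambda>X. THE r. \<forall>s\<in>X. (\<lambda>n. full_norm G (s n)) \<longlonglongrightarrow> r)\<rparr>)"

definition group_unitary :: "('a, 'b) monoid_scheme \<Rightarrow> 'a \<Rightarrow> (nat \<Rightarrow> 'a \<Rightarrow> complex) set" where
  "group_unitary G g = null_ideal G +>\<^bsub>cauchy_ring G\<^esub> (\<lambda>n x. if x = g then 1 else 0)"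


section \<open>Real rank zero and strongly not (FS) groups\<close>

definition spectrum :: "('c, 'e) cstar_struct_scheme \<Rightarrow> 'c \<Rightarrow> complex set" where
  "spectrum A a = {z. a \<ominus>\<^bsub>A\<^esub> (z \<odot>\<^bsub>A\<^esub> \<one>\<^bsub>A\<^esub>) \<notin> Units A}"

definition fin_spec_sa :: "('c, 'e) cstar_struct_scheme \<Rightarrow> 'c set" where
  "fin_spec_sa A = {v \<in> carrier A. adj A v = v \<and> finite (spectrum A v)}"

definition real_rank_zero :: "('c, 'e) cstar_struct_scheme \<Rightarrow> bool" where
  "real_rank_zero A \<longleftrightarrow> (\<forall>a\<in>carrier A. adj A a = a \<longrightarrow>
     (\<forall>\<epsilon>>0. \<exists>v\<in>fin_spec_sa A. cnorm A (a \<ominus>\<^bsub>A\<^esub> v) < \<epsilon>))"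

definition dist_fin_spec :: "('c, 'e) cstar_struct_scheme \<Rightarrow> 'c \<Rightarrow> real" where
  "dist_fin_spec A a = Inf {cnorm A (a \<ominus>\<^bsub>A\<^esub> v) | v. v \<in> fin_spec_sa A}"

definition strongly_not_FS :: "('a, 'b) monoid_scheme \<Rightarrow> bool" where
  "strongly_not_FS G \<longleftrightarrow> \<not> periodic_group G \<and>
     (\<forall>g\<in>carrier G. group.ord G g = 0 \<longrightarrow>
        dist_fin_spec (full_group_cstar G)
          ((1/2) \<odot>\<^bsub>full_group_cstar G\<^esub>
             (group_unitary G g \<oplus>\<^bsub>full_group_cstar G\<^esub> group_unitary G (inv\<^bsub>G\<^esub> g))) = 1)"


section \<open>The full norm dominates every unitary representation\<close>

context complex_hilbert_space
begin

definition hnorm :: "'h \<Rightarrow> real" where "hnorm x = sqrt (Re (ip x x))"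

lemma H_closed:
  shows "0 \<in> H" "\<And>x y. x \<in> H \<Longrightarrow> y \<in> H \<Longrightarrow> x + y \<in> H" "\<And>x c. x \<in> H \<Longrightarrow> c *s x \<in> H"
    "\<And>x y. x \<in> H \<Longrightarrow> y \<in> H \<Longrightarrow> x - y \<in> H"
  using subspace_H subspace_0 subspace_add subspace_scale subspace_diff by blast+

lemma ip_zero: assumes "x \<in> H" shows "ip x 0 = 0" "ip 0 x = 0"
proof -
  show "ip x 0 = 0" using ip_scale[OF assms H_closed(1), of 0] by simp
  then show "ip 0 x = 0" using ip_cnj[OF assms H_closed(1)] by simp
qed

lemma ip_diff: assumes "x \<in> H" "y \<in> H" "z \<in> H" shows "ip x (y - z) = ip x y - ip x z"
  using ip_add[of x "y - z" z] assms H_closed by (simp add: algebra_simps)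

lemma ip_add_left: assumes "x \<in> H" "y \<in> H" "z \<in> H" shows "ip (y + z) x = ip y x + ip z x"
  using ip_cnj[of x "y + z"] ip_cnj[of x y] ip_cnj[of x z] ip_add[of x y z] assms H_closed
  by simp

lemma ip_diff_left: assumes "x \<in> H" "y \<in> H" "z \<in> H" shows "ip (y - z) x = ip y x - ip z x"
  using ip_add_left[of x "y - z" z] assms H_closed by (simp add: algebra_simps)

lemma ip_scale_left: assumes "x \<in> H" "y \<in> H" shows "ip (c *s y) x = cnj c * ip y x"
  using ip_cnj[of x "c *s y"] ip_cnj[of x y] ip_scale[of x y c] assms H_closed by simp

lemma ip_self: assumes "x \<in> H" shows "ip x x = of_real (hnorm x ^ 2)"
proof -
  have "Im (ip x x) = 0" using ip_cnj[OF assms assms] by (metis cnj.sel(2) neg_equal_zero)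
  then show ?thesis using ip_nonneg[OF assms] by (simp add: hnorm_def complex_eq_iff)
qed

lemma hnorm_ge0: "x \<in> H \<Longrightarrow> hnorm x \<ge> 0"
  using ip_nonneg by (simp add: hnorm_def)

lemma Cauchy_Schwarz: assumes x: "x \<in> H" and y: "y \<in> H" shows "norm (ip x y) \<le> hnorm x * hnorm y"
proof (cases "x = 0")
  case True
  then show ?thesis using y x by (simp add: ip_zero hnorm_def)
next
  case False
  define a where "a = hnorm x ^ 2"
  have ax: "ip x x = of_real a" by (simp add: a_def ip_self x)
  have a0: "a > 0" using ip_definite[OF x] False ax by (auto simp: a_def)
  define c where "c = ip x y / of_real a"
  define z where "z = y - c *s x"
  have zH: "z \<in> H" using x y H_closed z_def by auto
  have xz: "ip x z = 0" using x y a0 H_closed ax by (simp add: z_def ip_diff ip_scale c_def)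
  have "ip z z = ip y z - cnj c * ip x z"
    using x y zH H_closed by (simp add: z_def ip_diff_left ip_scale_left)
  also have "\<dots> = ip y y - c * ip y x" using x y H_closed by (simp add: xz) (simp add: z_def ip_diff ip_scale)
  also have "\<dots> = ip y y - c * cnj (ip x y)" using ip_cnj[OF x y] by simp
  also have "\<dots> = of_real (hnorm y ^ 2) - of_real (norm (ip x y) ^ 2 / a)"
    using ip_self[OF y] by (simp add: c_def complex_norm_square del: of_real_power)
  finally have "Re (ip z z) = hnorm y ^ 2 - norm (ip x y) ^ 2 / a"
    by (simp flip: of_real_power of_real_divide of_real_diff)
  then have "norm (ip x y) ^ 2 \<le> (hnorm x * hnorm y) ^ 2"
    using ip_nonneg[OF zH] a0 by (simp add: divide_simps a_def power_mult_distrib mult.commute)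
  then show ?thesis using hnorm_ge0 x y by (meson mult_nonneg_nonneg power2_le_imp_le)
qed

lemma hnorm_triangle: assumes "x \<in> H" "y \<in> H" shows "hnorm (x + y) \<le> hnorm x + hnorm y"
proof -
  have "of_real (hnorm (x + y) ^ 2) = ip x x + ip y y + (ip x y + cnj (ip x y))"
    using assms H_closed ip_cnj[of x y] by (simp add: ip_self[symmetric] ip_add ip_add_left del: of_real_power)
  then have "hnorm (x + y) ^ 2 = hnorm x ^ 2 + hnorm y ^ 2 + 2 * Re (ip x y)"
    using assms by (simp add: ip_self complex_eq_iff)
  also have "\<dots> \<le> hnorm x ^ 2 + hnorm y ^ 2 + 2 * (hnorm x * hnorm y)"
    using Cauchy_Schwarz[OF assms] complex_Re_le_cmod[of "ip x y"] by linarith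
  also have "\<dots> = (hnorm x + hnorm y) ^ 2" by (simp add: power2_eq_square algebra_simps)
  finally show ?thesis using hnorm_ge0 assms by (meson add_nonneg_nonneg power2_le_imp_le)
qed

lemma hnorm_scale: assumes "x \<in> H" shows "hnorm (c *s x) = norm c * hnorm x"
proof -
  have "of_real (hnorm (c *s x) ^ 2) = (c * cnj c) * of_real (hnorm x ^ 2)"
    using assms H_closed by (simp add: ip_self[symmetric] ip_scale ip_scale_left del: of_real_power)
  also have "\<dots> = of_real ((norm c * hnorm x) ^ 2)"
    by (simp add: complex_norm_square[symmetric] power_mult_distrib)
  finally have "hnorm (c *s x) ^ 2 = (norm c * hnorm x) ^ 2" using of_real_eq_iff by blast
  then show ?thesis using hnorm_ge0 assms H_closed
    by (metis mult_nonneg_nonneg norm_ge_zero power2_eq_imp_eq)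
qed

lemma sum_H: "(\<And>i. i \<in> I \<Longrightarrow> x i \<in> H) \<Longrightarrow> sum x I \<in> H"
  using subspace_H subspace_sum by blast

lemma hnorm_sum: assumes "\<And>i. i \<in> I \<Longrightarrow> x i \<in> H" shows "hnorm (sum x I) \<le> (\<Sum>i\<in>I. hnorm (x i))"
  using assms
proof (induction I rule: infinite_finite_induct)
  case (insert i I)
  then show ?case using hnorm_triangle[of "x i" "sum x I"] sum_H[of I x] by force
qed (auto simp: hnorm_def ip_zero H_closed)

end

context unitary_rep
begin

lemma hnorm_U: "\<lbrakk>g \<in> carrier G; x \<in> H\<rbrakk> \<Longrightarrow> hnorm (U g x) = hnorm x"
  by (simp add: hnorm_def U_ip)

lemma rep_apply_H:
  assumes "f \<in> carrier (group_algebra G)" "\<xi> \<in> H" shows "rep_apply scale U f \<xi> \<in> H"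
  unfolding rep_apply_def
  using assms U_closed H_closed by (intro sum_H) (auto simp: group_algebra_def)

lemma hnorm_rep_apply_le:
  assumes f: "f \<in> carrier (group_algebra G)" and x: "\<xi> \<in> H" "hnorm \<xi> \<le> 1"
  shows "hnorm (rep_apply scale U f \<xi>) \<le> (\<Sum>g | f g \<noteq> 0. norm (f g))"
proof -
  have *: "g \<in> carrier G" if "f g \<noteq> 0" for g using f that by (auto simp: group_algebra_def)
  have "hnorm (rep_apply scale U f \<xi>) \<le> (\<Sum>g | f g \<noteq> 0. hnorm (f g *s U g \<xi>))"
    unfolding rep_apply_def using * U_closed H_closed x by (intro hnorm_sum) auto
  also have "\<dots> \<le> (\<Sum>g | f g \<noteq> 0. norm (f g))"
    using * x by (intro sum_mono) (auto simp: hnorm_scale U_closed hnorm_U mult_left_le)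
  finally show ?thesis .
qed

end

lemma full_norm_bdd:
  assumes "f \<in> carrier (group_algebra G)"
  shows "bdd_above {sqrt (Re (ip (rep_apply fun_scale U f \<xi>) (rep_apply fun_scale U f \<xi>))) |
      (H :: ('a \<Rightarrow> complex) set) ip U \<xi>.
      unitary_rep fun_scale H ip G U \<and> \<xi> \<in> H \<and> sqrt (Re (ip \<xi> \<xi>)) \<le> 1}"
proof (rule bdd_aboveI[of _ "\<Sum>g | f g \<noteq> 0. norm (f g)"], clarify)
  fix H :: "('a \<Rightarrow> complex) set" and ip U \<xi>
  assume "unitary_rep fun_scale H ip G U" and x: "\<xi> \<in> H" "sqrt (Re (ip \<xi> \<xi>)) \<le> 1"
  then interpret unitary_rep fun_scale H ip G U by simp
  show "sqrt (Re (ip (rep_apply fun_scale U f \<xi>) (rep_apply fun_scale U f \<xi>)))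
      \<le> (\<Sum>g | f g \<noteq> 0. norm (f g))"
    using hnorm_rep_apply_le[OF assms x(1)] x(2) by (simp add: hnorm_def)
qed

lemma (in unitary_rep) rep_norm_le_full_norm:
  assumes f: "f \<in> carrier (group_algebra G)" and \<xi>: "\<xi> \<in> H" and \<xi>1: "sqrt (Re (ip \<xi> \<xi>)) \<le> 1"
  shows "sqrt (Re (ip (rep_apply scale U f \<xi>) (rep_apply scale U f \<xi>))) \<le> full_norm G f"
proof -
  define P where "P = {\<zeta> \<in> H. \<forall>g\<in>carrier G. ip (U g \<xi>) \<zeta> = 0}"
  define K where "K = {\<eta> \<in> H. \<forall>\<zeta>\<in>P. ip \<zeta> \<eta> = 0}"
  define W where "W \<eta> = (\<lambda>g. if g \<in> carrier G then ip (U g \<xi>) \<eta> else 0)" for \<eta>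
  have KH: "K \<subseteq> H" and PH: "P \<subseteq> H" by (auto simp: K_def P_def)
  have K0: "0 \<in> K" using H_closed(1) PH by (auto simp: K_def ip_zero)
  have Kadd: "x + y \<in> K" if "x \<in> K" "y \<in> K" for x y
    using that H_closed PH by (auto simp: K_def ip_add)
  have Kscale: "c *s x \<in> K" if "x \<in> K" for c x
    using that H_closed PH by (auto simp: K_def ip_scale subset_iff)
  have Kdiff: "x - y \<in> K" if "x \<in> K" "y \<in> K" for x y
    using that H_closed PH by (auto simp: K_def ip_diff subset_iff)
  have \<xi>K: "\<xi> \<in> K"
  proof -
    have "ip \<zeta> \<xi> = 0" if "\<zeta> \<in> P" for \<zeta>
    proof -
      have "ip (U \<one> \<xi>) \<zeta> = 0" using that one_closed unfolding P_def by blast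
      then show ?thesis using that ip_cnj[of \<xi> \<zeta>] U_one[OF \<xi>] \<xi> PH by auto
    qed
    then show ?thesis using \<xi> by (simp add: K_def)
  qed
  have PU: "U g \<zeta> \<in> P" if "\<zeta> \<in> P" "g \<in> carrier G" for \<zeta> g
  proof -
    have z: "\<zeta> \<in> H" using that PH by auto
    have "ip (U h \<xi>) (U g \<zeta>) = 0" if h: "h \<in> carrier G" for h
    proof -
      have "h = g \<otimes> (inv g \<otimes> h)" using h \<open>g \<in> carrier G\<close> by (simp flip: m_assoc)
      then have "U h \<xi> = U g (U (inv g \<otimes> h) \<xi>)"
        using U_mult[of g "inv g \<otimes> h" \<xi>] h \<open>g \<in> carrier G\<close> \<xi> by (metis inv_closed m_closed)
      then have "ip (U h \<xi>) (U g \<zeta>) = ip (U (inv g \<otimes> h) \<xi>) \<zeta>"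
        using U_ip z \<xi> U_closed h \<open>g \<in> carrier G\<close> by simp
      then show ?thesis using \<open>\<zeta> \<in> P\<close> h \<open>g \<in> carrier G\<close> by (simp add: P_def)
    qed
    then show ?thesis using that z U_closed by (simp add: P_def)
  qed
  have KU: "U g \<eta> \<in> K" if "\<eta> \<in> K" "g \<in> carrier G" for \<eta> g
  proof -
    have e: "\<eta> \<in> H" using that KH by auto
    have "ip \<zeta> (U g \<eta>) = 0" if "\<zeta> \<in> P" for \<zeta>
    proof -
      have z: "\<zeta> \<in> H" using that PH by auto
      have "U g (U (inv g) \<zeta>) = \<zeta>"
        using U_mult[of g "inv g" \<zeta>] \<open>g \<in> carrier G\<close> z U_one by simp
      then have "ip \<zeta> (U g \<eta>) = ip (U (inv g) \<zeta>) \<eta>"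
        using U_ip[of g "U (inv g) \<zeta>" \<eta>] U_closed e z \<open>g \<in> carrier G\<close> by simp
      then show ?thesis using PU[OF that, of "inv g"] \<open>g \<in> carrier G\<close> \<open>\<eta> \<in> K\<close> by (simp add: K_def)
    qed
    then show ?thesis using e U_closed that by (simp add: K_def)
  qed
  have Wadd: "W (x + y) = W x + W y" if "x \<in> K" "y \<in> K" for x y
    using that KH by (auto simp: W_def ip_add U_closed \<xi> fun_eq_iff subset_iff)
  have Wscale: "W (c *s x) = fun_scale c (W x)" if "x \<in> K" for c x
    using that KH by (auto simp: W_def ip_scale U_closed \<xi> fun_eq_iff subset_iff)
  have Wdiff: "W (x - y) = W x - W y" if "x \<in> K" "y \<in> K" for x y
    using that KH by (auto simp: W_def ip_diff U_closed \<xi> fun_eq_iff subset_iff)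
  have Winj: "inj_on W K"
  proof (rule inj_onI)
    fix x y assume xy: "x \<in> K" "y \<in> K" "W x = W y"
    have d: "x - y \<in> K" using Kdiff xy by auto
    have "ip (U g \<xi>) (x - y) = 0" if "g \<in> carrier G" for g
      using fun_cong[OF Wdiff[OF xy(1,2)], of g] fun_cong[OF xy(3), of g] that by (simp add: W_def)
    then have "x - y \<in> P" using d KH by (auto simp: P_def)
    then have "ip (x - y) (x - y) = 0" using d by (simp add: K_def)
    then show "x = y" using ip_definite[of "x - y"] d KH by auto
  qed
  define B where "B = inv_into K W"
  have BW: "B (W x) = x" if "x \<in> K" for x using that Winj by (simp add: B_def)
  define ip' where "ip' a b = ip (B a) (B b)" for a b
  define U' where "U' g a = W (U g (B a))" for g a
  have vs: "vector_space fun_scale"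
    by unfold_locales (auto simp: fun_eq_iff algebra_simps)
  interpret F: vector_space fun_scale by (rule vs)
  have sub: "F.subspace (W ` K)"
  proof (rule F.subspaceI)
    show "0 \<in> W ` K"
      using K0 by (auto simp: image_iff W_def fun_eq_iff ip_zero U_closed \<xi> intro!: bexI[of _ 0])
    show "x + y \<in> W ` K" if "x \<in> W ` K" "y \<in> W ` K" for x y
      using that Kadd by (auto simp flip: Wadd)
    show "fun_scale c x \<in> W ` K" if "x \<in> W ` K" for c x
      using that Kscale by (auto simp flip: Wscale)
  qed
  have ur: "unitary_rep fun_scale (W ` K) ip' G U'"
  proof (intro unitary_rep.intro complex_hilbert_space.intro vs is_group
      complex_hilbert_space_axioms.intro unitary_rep_axioms.intro sub)
    fix x y z c assume "x \<in> W ` K" "y \<in> W ` K" "z \<in> W ` K"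
    then show "ip' x (y + z) = ip' x y + ip' x z"
      using KH by (auto simp: ip'_def BW Kadd simp flip: Wadd intro!: ip_add)
  next
    fix x y c assume "x \<in> W ` K" "y \<in> W ` K"
    then show "ip' x (fun_scale c y) = c * ip' x y"
      using KH by (auto simp: ip'_def BW Kscale simp flip: Wscale intro!: ip_scale)
  next
    fix x y assume "x \<in> W ` K" "y \<in> W ` K"
    then show "ip' y x = cnj (ip' x y)"
      using KH by (auto simp: ip'_def BW intro!: ip_cnj)
  next
    fix x assume "x \<in> W ` K"
    then show "0 \<le> Re (ip' x x)" using KH by (auto simp: ip'_def BW intro!: ip_nonneg)
  next
    fix x assume "x \<in> W ` K" "ip' x x = 0"
    then obtain u where u: "u \<in> K" "x = W u" "ip u u = 0" by (auto simp: ip'_def BW)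
    then have "u = 0" using ip_definite KH by auto
    then show "x = 0" using u by (auto simp: W_def fun_eq_iff ip_zero U_closed \<xi>)
  next
    fix X :: "nat \<Rightarrow> 'a \<Rightarrow> complex"
    assume XW: "\<And>n. X n \<in> W ` K"
      and Cau: "\<And>e. e > 0 \<Longrightarrow> \<exists>M. \<forall>m\<ge>M. \<forall>n\<ge>M. sqrt (Re (ip' (X m - X n) (X m - X n))) < e"
    define Y where "Y n = B (X n)" for n :: nat
    have YK: "Y n \<in> K" and XY: "X n = W (Y n)" for n
      using XW[of n] by (auto simp: Y_def BW)
    have dist: "ip' (X m - W y) (X m - W y) = ip (Y m - y) (Y m - y)" if "y \<in> K" for m y
      using YK that by (simp add: XY ip'_def BW Kdiff flip: Wdiff)
    have "\<exists>x\<in>H. (\<lambda>n. sqrt (Re (ip (Y n - x) (Y n - x)))) \<longlonglongrightarrow> 0"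
    proof (rule complete_H)
      show "Y n \<in> H" for n using YK KH by auto
      show "\<exists>M. \<forall>m\<ge>M. \<forall>n\<ge>M. sqrt (Re (ip (Y m - Y n) (Y m - Y n))) < e" if "e > 0" for e
        using Cau[OF that] dist[OF YK] by (simp add: XY)
    qed
    then obtain y where y: "y \<in> H" and lim: "(\<lambda>n. hnorm (Y n - y)) \<longlonglongrightarrow> 0"
      by (auto simp: hnorm_def)
    have "ip \<zeta> y = 0" if "\<zeta> \<in> P" for \<zeta>
    proof -
      have z: "\<zeta> \<in> H" using that PH by auto
      have "norm (ip \<zeta> y) \<le> hnorm \<zeta> * hnorm (Y n - y)" for n
      proof -
        have YH: "Y n \<in> H" using YK KH by auto
        have "ip \<zeta> (Y n) = 0" using YK that by (auto simp: K_def)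
        then have "ip \<zeta> (Y n - y) = - ip \<zeta> y" using z y YH by (simp add: ip_diff)
        then show ?thesis using Cauchy_Schwarz[OF z H_closed(4)[OF YH y]] by simp
      qed
      moreover have "(\<lambda>n. hnorm \<zeta> * hnorm (Y n - y)) \<longlonglongrightarrow> 0"
        using tendsto_mult_right_zero[OF lim] by simp
      ultimately have "norm (ip \<zeta> y) \<le> 0" by (intro LIMSEQ_le_const) auto
      then show ?thesis by simp
    qed
    then have yK: "y \<in> K" using y by (simp add: K_def)
    show "\<exists>x\<in>W ` K. (\<lambda>n. sqrt (Re (ip' (X n - x) (X n - x)))) \<longlonglongrightarrow> 0"
      using lim yK by (intro bexI[of _ "W y"]) (auto simp: dist hnorm_def)
  next
    fix g x assume "g \<in> carrier G" "x \<in> W ` K"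
    then show "U' g x \<in> W ` K" by (auto simp: U'_def BW KU)
  next
    fix g x y assume *: "g \<in> carrier G" "x \<in> W ` K" "y \<in> W ` K"
    then obtain u v where uv: "u \<in> K" "v \<in> K" "x = W u" "y = W v" by auto
    have "U' g (x + y) = W (U g (u + v))" using uv by (simp add: U'_def BW Kadd flip: Wadd)
    also have "\<dots> = W (U g u + U g v)" using * uv KH by (auto simp: U_add subset_iff)
    also have "\<dots> = U' g x + U' g y" using uv * by (simp add: Wadd KU U'_def BW)
    finally show "U' g (x + y) = U' g x + U' g y" .
    show "ip' (U' g x) (U' g y) = ip' x y"
      using uv * KH by (auto simp: ip'_def U'_def BW KU U_ip subset_iff)
  next
    fix g x c assume *: "g \<in> carrier G" "x \<in> W ` K"
    then obtain u where u: "u \<in> K" "x = W u" by auto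
    have "U' g (fun_scale c x) = W (U g (c *s u))" using u by (simp add: U'_def BW Kscale flip: Wscale)
    also have "\<dots> = W (c *s U g u)" using * u KH by (auto simp: U_scale subset_iff)
    also have "\<dots> = fun_scale c (U' g x)" using u * by (simp add: Wscale KU U'_def BW)
    finally show "U' g (fun_scale c x) = fun_scale c (U' g x)" .
  next
    fix x assume "x \<in> W ` K"
    then show "U' \<one> x = x" using KH by (auto simp: U'_def BW U_one subset_iff)
  next
    fix g h x assume "g \<in> carrier G" "h \<in> carrier G" "x \<in> W ` K"
    then show "U' (g \<otimes> h) x = U' g (U' h x)"
      using KH by (auto simp: U'_def BW U_mult KU subset_iff)
  qed
  have supp: "g \<in> carrier G" if "f g \<noteq> 0" for g using f that by (auto simp: group_algebra_def)
  have Ksum: "sum x I \<in> K \<and> W (sum x I) = (\<Sum>i\<in>I. W (x i))" if "\<And>i. i \<in> I \<Longrightarrow> x i \<in> K"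
    for I :: "'a set" and x
    using that
  proof (induction I rule: infinite_finite_induct)
    case (insert i I)
    then show ?case by (simp add: Kadd Wadd)
  qed (use K0 in \<open>auto simp: W_def fun_eq_iff ip_zero U_closed \<xi>\<close>)
  have "f g *s U g \<xi> \<in> K" if "f g \<noteq> 0" for g using that supp KU Kscale \<xi>K by auto
  then have RK: "rep_apply scale U f \<xi> \<in> K"
    and "W (rep_apply scale U f \<xi>) = (\<Sum>g | f g \<noteq> 0. W (f g *s U g \<xi>))"
    unfolding rep_apply_def using Ksum[of "{g. f g \<noteq> 0}" "\<lambda>g. f g *s U g \<xi>"] by auto
  then have RW: "W (rep_apply scale U f \<xi>) = rep_apply fun_scale U' f (W \<xi>)"
    by (simp add: rep_apply_def U'_def BW \<xi>K)
       (intro sum.cong refl, use supp KU \<xi>K Wscale in auto)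
  have "sqrt (Re (ip (rep_apply scale U f \<xi>) (rep_apply scale U f \<xi>))) =
      sqrt (Re (ip' (rep_apply fun_scale U' f (W \<xi>)) (rep_apply fun_scale U' f (W \<xi>))))"
    using RK by (simp flip: RW add: ip'_def BW)
  also have "\<dots> \<le> full_norm G f"
    unfolding full_norm_def
  proof (rule cSup_upper[OF _ full_norm_bdd[OF f]], intro CollectI exI conjI)
    show "unitary_rep fun_scale (W ` K) ip' G U'" by (rule ur)
    show "W \<xi> \<in> W ` K" using \<xi>K by simp
    show "sqrt (Re (ip' (W \<xi>) (W \<xi>))) \<le> 1" using \<xi>K \<xi>1 by (simp add: ip'_def BW)
  qed (rule refl)
  finally show ?thesis .
qed

end

theory Submission
  imports Defs "HOL-Algebra.Zassenhaus"
begin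

text \<open>Suppose $v$ is self-adjoint with finite spectrum and $a = (g + g^{-1})/2$ satisfies
  $\<parallel>a - v\<parallel> < 1$. Some real number near $0$ avoids the spectrum, so after a shift and
  an approximation we obtain a self-adjoint $u$ in the group algebra that is invertible up to a small
  error and still satisfies $\<parallel>a - u\<parallel> < 1$. By the spectral gap, whenever the quadratic
  form of $u$ takes a positive value in a representation, its supremum over unit vectors is bounded below
  by a constant that does not depend on the representation.

  The element $g$ and the support of $u$ generate a nilpotent subgroup $K$, which has a normal
  subgroup modulo which $g$ is central of infinite order. Since $K$ is amenable, inducing the character
  $g \<mapsto> e^{i\<pi>/n}$ gives, for large $n$, a representation with a vector that is almost fixed
  by the support of $u$, and tensoring with it preserves positivity of the form. In the trivial
  representation $a = 1$, so the form of $u$ is positive; hence it takes a positive value in the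
  $n$-fold tensor power, on a subspace where $g$ acts as $-1$. There $a = -1$, a contradiction.

  Amenability enters through Folner sets, built along a central series. In a periodic group the same
  construction gives exactly invariant finite sets, so finitely generated periodic nilpotent groups are
  finite, and a locally nilpotent group that is not locally finite is not periodic.\<close>

section \<open>Central series and Folner sets\<close>

text \<open>Inducing a character with g \<mapsto> -1 in a single step is no help: its phases on a
  Folner set are not small, so positivity of the form may be lost at once. A character near the
  trivial one loses little, but its parameter n is known only after the error \<delta> is fixed, so
  n losses of size \<delta> need not stay small together. The spectral gap repairs this: before each
  new tensor factor a merely positive value is replaced by one above a constant that depends only on
  the approximate inverse \<open>b\<close>, and \<delta> is chosen against that constant alone. This
  is a discrete path of characters from 1 to -1 along which the positive part of \<open>u\<close>
  cannot vanish.

  The other obstacle is that g need not be central in K, while the norm refers to representations of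
  G rather than K. So the character lives on a subgroup of K containing all K-conjugates of g, each
  with exponent 1; it is induced up to G, but vectors are kept on the cosets that meet K, where g
  acts by a scalar. All these vectors are finitely supported, so inner products of tensors are
  finite sums.\<close>

context group
begin

lemma mult_inv_cancel:
  assumes "x \<in> carrier G" "z \<in> carrier G"
  shows "x \<otimes> (inv x \<otimes> z) = z" "inv x \<otimes> (x \<otimes> z) = z"
  using assms by (simp_all flip: m_assoc)

section \<open>Commutator calculus and the upper central series over a normal subgroup\<close>

definition commutator :: "'a \<Rightarrow> 'a \<Rightarrow> 'a" where
  "commutator x y = x \<otimes> y \<otimes> inv x \<otimes> inv y"

lemma commutator_closed [simp]:
  "\<lbrakk>x \<in> carrier G; y \<in> carrier G\<rbrakk> \<Longrightarrow> commutator x y \<in> carrier G"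
  by (simp add: commutator_def)

lemma inv_commutator:
  "\<lbrakk>x \<in> carrier G; y \<in> carrier G\<rbrakk> \<Longrightarrow> inv (commutator x y) = commutator y x"
  by (simp add: commutator_def inv_mult_group m_assoc)

lemma conj_eq_commutator:
  "\<lbrakk>x \<in> carrier G; y \<in> carrier G\<rbrakk> \<Longrightarrow> x \<otimes> y \<otimes> inv x = commutator x y \<otimes> y"
  by (simp add: commutator_def m_assoc)

lemma commutator_mult_left:
  "\<lbrakk>x \<in> carrier G; y \<in> carrier G; h \<in> carrier G\<rbrakk> \<Longrightarrow>
    commutator (x \<otimes> y) h = (x \<otimes> commutator y h \<otimes> inv x) \<otimes> commutator x h"
  by (simp add: commutator_def inv_mult_group m_assoc mult_inv_cancel)

lemma commutator_inv_left:
  "\<lbrakk>x \<in> carrier G; h \<in> carrier G\<rbrakk> \<Longrightarrow>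
    commutator (inv x) h = inv x \<otimes> inv (commutator x h) \<otimes> x"
  by (simp add: commutator_def inv_mult_group m_assoc mult_inv_cancel)

lemma commutator_conj_left:
  "\<lbrakk>x \<in> carrier G; k \<in> carrier G; h \<in> carrier G\<rbrakk> \<Longrightarrow>
    commutator (k \<otimes> x \<otimes> inv k) h = k \<otimes> commutator x (inv k \<otimes> h \<otimes> k) \<otimes> inv k"
  by (simp add: commutator_def inv_mult_group m_assoc mult_inv_cancel)

lemma normal_conj: "\<lbrakk>N \<lhd> G; x \<in> carrier G; n \<in> N\<rbrakk> \<Longrightarrow> x \<otimes> n \<otimes> inv x \<in> N"
  by (simp add: normal_inv_iff)

lemma normal_conj': "\<lbrakk>N \<lhd> G; x \<in> carrier G; n \<in> N\<rbrakk> \<Longrightarrow> inv x \<otimes> n \<otimes> x \<in> N"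
  using normal_conj[of N "inv x" n] by simp

lemma commutator_in_normal:
  assumes "N \<lhd> G" "n \<in> N" "h \<in> carrier G" shows "commutator n h \<in> N"
proof -
  have s: "subgroup N G" using assms(1) normal_inv_iff by blast
  then have n: "n \<in> carrier G" "inv n \<in> N"
    using subgroup.mem_carrier[OF s assms(2)] subgroup.m_inv_closed[OF s assms(2)] by simp_all
  have "commutator n h = n \<otimes> (h \<otimes> inv n \<otimes> inv h)"
    using n assms(3) by (simp add: commutator_def m_assoc)
  then show ?thesis using normal_conj[OF assms(1,3) n(2)] s assms(2) by (simp add: subgroup.m_closed)
qed

text \<open>A conjugate of \<open>x\<close> is a commutator times \<open>x\<close>, and the
  commutator lies in \<open>N\<close>, hence in \<open>K\<close>.\<close>

lemma normal_between:
  assumes "subgroup K G" "N \<subseteq> K" "\<And>x h. \<lbrakk>x \<in> K; h \<in> carrier G\<rbrakk> \<Longrightarrow> commutator x h \<in> N"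
    "subgroup N G"
  shows "K \<lhd> G"
  unfolding normal_inv_iff
proof (intro conjI ballI assms(1))
  fix h x assume h: "h \<in> carrier G" and x: "x \<in> K"
  have xc: "x \<in> carrier G" by (rule subgroup.mem_carrier[OF assms(1) x])
  have "commutator h x \<in> N"
    using subgroup.m_inv_closed[OF assms(4) assms(3)[OF x h]] inv_commutator[OF xc h] by simp
  then show "h \<otimes> x \<otimes> inv h \<in> K"
    using x assms(1,2) by (simp add: conj_eq_commutator h xc subgroup.m_closed subset_iff)
qed

lemma normal_subgroup: "N \<lhd> G \<Longrightarrow> subgroup N G"
  by (simp add: normal_inv_iff)

lemma normal_mem: "\<lbrakk>N \<lhd> G; x \<in> N\<rbrakk> \<Longrightarrow> x \<in> carrier G"
  by (rule subgroup.mem_carrier[OF normal_subgroup])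

text \<open>The preimage in \<open>G\<close> of the \<open>j\<close>-th term of the upper central
  series of the quotient by \<open>N\<close>. Preimages keep the maximality and Folner arguments
  inside one group, without a quotient type.\<close>

primrec upper_series :: "'a set \<Rightarrow> nat \<Rightarrow> 'a set" where
  "upper_series N 0 = N"
| "upper_series N (Suc j) =
    {x \<in> carrier G. \<forall>h\<in>carrier G. commutator x h \<in> upper_series N j}"

lemma upper_series_normal: "N \<lhd> G \<Longrightarrow> upper_series N j \<lhd> G"
proof (induction j)
  case (Suc j)
  note IH = Suc.IH[OF Suc.prems]
  note s = normal_subgroup[OF IH]
  have "subgroup (upper_series N (Suc j)) G"
  proof (rule subgroupI)
    have "commutator \<one> h = \<one>" if "h \<in> carrier G" for h
      using that by (simp add: commutator_def)
    then show "upper_series N (Suc j) \<noteq> {}"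
      using s by (auto simp: subgroup.one_closed intro!: exI[of _ \<one>])
  next
    fix x assume "x \<in> upper_series N (Suc j)"
    then show "inv x \<in> upper_series N (Suc j)"
      using s normal_conj'[OF IH] by (auto simp: commutator_inv_left subgroup.m_inv_closed)
  next
    fix x y assume "x \<in> upper_series N (Suc j)" "y \<in> upper_series N (Suc j)"
    then show "x \<otimes> y \<in> upper_series N (Suc j)"
      using s normal_conj[OF IH] by (auto simp: commutator_mult_left subgroup.m_closed)
  qed auto
  then show ?case
    unfolding normal_inv_iff using normal_conj[OF IH] by (auto simp: commutator_conj_left)
qed simp

lemma upper_series_mono: assumes "N \<lhd> G" shows "upper_series N j \<subseteq> upper_series N (Suc j)"
  using commutator_in_normal[OF upper_series_normal[OF assms]] normal_mem[OF upper_series_normal[OF assms]]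
  by auto

lemma upper_series_base: assumes "N \<lhd> G" shows "N \<subseteq> upper_series N j"
  proof (induction j)
  case (Suc j)
  then show ?case using upper_series_mono[OF assms, of j] by (rule order_trans)
qed simp

text \<open>The lower series, read backwards from its trivial term, is a central series, so it stays
  below the upper one: its term \<open>c - j\<close> lies in \<open>upper_series N j\<close>, and
  \<open>j = c\<close> gives all of \<open>G\<close>.\<close>

lemma upper_series_top:
  assumes "nilpotent_group G" "N \<lhd> G"
  obtains c where "upper_series N c = carrier G"
proof -
  obtain c where c: "lower_central G c = {\<one>}" using assms by (auto simp: nilpotent_group_def)
  have lc: "lower_central G i \<subseteq> carrier G" for i
  proof (induction i)
    case (Suc i)
    then show ?case unfolding lower_central.simps by (intro generate_incl) auto
  qed simp
  have "j \<le> c \<Longrightarrow> lower_central G (c - j) \<subseteq> upper_series N j" for j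
  proof (induction j)
    case 0
    then show ?case using c normal_subgroup[OF assms(2)] by (simp add: subgroup.one_closed)
  next
    case (Suc j)
    then have e: "c - j = Suc (c - Suc j)" by simp
    have "commutator x h \<in> upper_series N j" if "x \<in> lower_central G (c - Suc j)" "h \<in> carrier G" for x h
    proof -
      have "commutator x h \<in> lower_central G (c - j)"
        unfolding e commutator_def lower_central.simps using that by (intro generate.incl) auto
      then show ?thesis using Suc by auto
    qed
    then show ?case using lc by auto
  qed
  from this[of c] have "carrier G \<subseteq> upper_series N c" by simp
  moreover have "upper_series N c \<subseteq> carrier G"
    using normal_mem[OF upper_series_normal[OF assms(2)]] by blast
  ultimately show thesis using that by blast
qed

text \<open>Modulo \<open>N\<close> the factor \<open>n\<close> disappears: each new
  \<open>n\<close> is carried to the left past \<open>y [^] k\<close> by conjugation and absorbed in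
  \<open>N\<close>.\<close>

lemma normal_mult_pow:
  assumes "N \<lhd> G" "n \<in> N" "y \<in> carrier G"
  shows "\<exists>n'\<in>N. (n \<otimes> y) [^] (k::nat) = n' \<otimes> y [^] k"
proof (induction k)
  case 0
  then show ?case
    using subgroup.one_closed[OF normal_subgroup[OF assms(1)]] by (intro bexI[of _ \<one>]) auto
next
  case (Suc k)
  then obtain n' where n': "n' \<in> N" "(n \<otimes> y) [^] k = n' \<otimes> y [^] k" by auto
  note mem = normal_mem[OF assms(1)]
  have "(n \<otimes> y) [^] Suc k = (n' \<otimes> (y [^] k \<otimes> n \<otimes> inv (y [^] k))) \<otimes> y [^] Suc k"
    using n' assms mem by (simp add: m_assoc mult_inv_cancel)
  moreover have "n' \<otimes> (y [^] k \<otimes> n \<otimes> inv (y [^] k)) \<in> N"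
    using n' assms normal_conj[OF assms(1), of "y [^] k" n] normal_subgroup[OF assms(1)]
    by (simp add: subgroup.m_closed)
  ultimately show ?case by blast
qed

text \<open>Modulo \<open>P\<close> the commutator of \<open>x\<close> with \<open>h\<close> is
  central, so forming the commutator with \<open>h\<close> is multiplicative on the powers of
  \<open>x\<close>.\<close>

lemma commutator_pow_left:
  assumes P: "P \<lhd> G" and x: "x \<in> carrier G" and h: "h \<in> carrier G"
    and c: "\<And>y. y \<in> carrier G \<Longrightarrow> commutator (commutator x h) y \<in> P"
  shows "\<exists>p\<in>P. commutator (x [^] (k::nat)) h = p \<otimes> commutator x h [^] k"
proof (induction k)
  case 0
  then show ?case using normal_subgroup[OF P] h
    by (auto simp: subgroup.one_closed commutator_def intro!: bexI[of _ \<one>])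
next
  case (Suc k)
  then obtain p where p: "p \<in> P" "commutator (x [^] k) h = p \<otimes> commutator x h [^] k" by auto
  define d where "d = commutator x h"
  have d: "d \<in> carrier G" using x h by (simp add: d_def)
  note mem = normal_mem[OF P] and s = normal_subgroup[OF P]
  have xk: "x [^] k \<in> carrier G" using x by simp
  define q where "q = commutator (x [^] k) d"
  have q: "q \<in> P"
    using subgroup.m_inv_closed[OF s c[OF xk]] inv_commutator[OF d xk] by (simp add: d_def q_def)
  have "commutator (x [^] Suc k) h = (x [^] k \<otimes> d \<otimes> inv (x [^] k)) \<otimes> commutator (x [^] k) h"
    using commutator_mult_left[OF xk x h] by (simp add: d_def)
  also have "\<dots> = q \<otimes> d \<otimes> (p \<otimes> d [^] k)"
    using conj_eq_commutator[OF xk d] p by (simp add: q_def d_def)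
  also have "\<dots> = (q \<otimes> (d \<otimes> p \<otimes> inv d)) \<otimes> d [^] Suc k"
  proof -
    have "d [^] Suc k = d \<otimes> d [^] k" using d by (metis nat_pow_Suc2)
    then show ?thesis using d mem[OF q] mem[OF p(1)] by (simp add: m_assoc mult_inv_cancel)
  qed
  finally have "commutator (x [^] Suc k) h = (q \<otimes> (d \<otimes> p \<otimes> inv d)) \<otimes> d [^] Suc k" .
  moreover have "q \<otimes> (d \<otimes> p \<otimes> inv d) \<in> P"
    using q normal_conj[OF P d p(1)] s by (simp add: subgroup.m_closed)
  ultimately show ?case by (auto simp: d_def)
qed

text \<open>Torsion passes down through commutators. If \<open>x [^] k\<close> lies one level down,
  then for every \<open>h\<close> the \<open>k\<close>-th power of \<open>commutator x h\<close>
  lies two levels down, so by induction \<open>commutator x h\<close> itself does, which says that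
  \<open>x\<close> lies one level down. The bottom factor is the hypothesis
  \<open>base\<close>.\<close>

lemma upper_series_torsion_free:
  assumes N: "N \<lhd> G"
    and base: "\<And>x k. \<lbrakk>x \<in> upper_series N 1; 0 < k; x [^] (k::nat) \<in> N\<rbrakk> \<Longrightarrow> x \<in> N"
  shows "\<lbrakk>x \<in> upper_series N (Suc j); 0 < k; x [^] (k::nat) \<in> upper_series N j\<rbrakk>
    \<Longrightarrow> x \<in> upper_series N j"
proof (induction j arbitrary: x)
  case 0
  then show ?case using base[of x k] by simp
next
  case (Suc j)
  note P = upper_series_normal[OF N, of j]
  have x: "x \<in> carrier G" using Suc.prems by auto
  have "commutator x h \<in> upper_series N j" if h: "h \<in> carrier G" for h
  proof -
    have ch: "commutator x h \<in> upper_series N (Suc j)" using Suc.prems(1) h by simp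
    then have "\<And>y. y \<in> carrier G \<Longrightarrow> commutator (commutator x h) y \<in> upper_series N j" by simp
    from commutator_pow_left[OF P x h this] obtain p where p: "p \<in> upper_series N j"
      "commutator (x [^] k) h = p \<otimes> commutator x h [^] k" by blast
    have "commutator (x [^] k) h \<in> upper_series N j" using Suc.prems(3) h by simp
    then have "inv p \<otimes> (p \<otimes> commutator x h [^] k) \<in> upper_series N j"
      using p normal_subgroup[OF P] by (simp add: subgroup.m_closed subgroup.m_inv_closed)
    then have "commutator x h [^] k \<in> upper_series N j"
      using normal_mem[OF P p(1)] x h by (simp add: mult_inv_cancel)
    with Suc.IH[OF ch Suc.prems(2)] show ?thesis by blast
  qed
  then show ?case using x by simp
qed

section \<open>Making \<open>g\<close> central modulo a maximal normal subgroup\<close>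

lemma normal_Union_chain:
  assumes "\<C> \<noteq> {}" "\<And>N. N \<in> \<C> \<Longrightarrow> N \<lhd> G" "\<And>M N. \<lbrakk>M \<in> \<C>; N \<in> \<C>\<rbrakk> \<Longrightarrow> M \<subseteq> N \<or> N \<subseteq> M"
  shows "\<Union>\<C> \<lhd> G"
proof -
  note s = normal_subgroup[OF assms(2)]
  have "subgroup (\<Union>\<C>) G"
  proof (rule subgroupI)
    show "\<Union>\<C> \<subseteq> carrier G" using normal_mem[OF assms(2)] by blast
    show "\<Union>\<C> \<noteq> {}" using assms(1) subgroup.one_closed[OF s] by blast
  next
    fix x assume "x \<in> \<Union>\<C>" then show "inv x \<in> \<Union>\<C>" using subgroup.m_inv_closed[OF s] by blast
  next
    fix x y assume "x \<in> \<Union>\<C>" "y \<in> \<Union>\<C>"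
    then obtain M N where MN: "M \<in> \<C>" "N \<in> \<C>" "x \<in> M" "y \<in> N" by blast
    then have "x \<in> M \<and> y \<in> M \<or> x \<in> N \<and> y \<in> N" using assms(3)[of M N] by blast
    then have "x \<otimes> y \<in> M \<or> x \<otimes> y \<in> N"
      using subgroup.m_closed[OF s[OF MN(1)]] subgroup.m_closed[OF s[OF MN(2)]] by blast
    then show "x \<otimes> y \<in> \<Union>\<C>" using MN by blast
  qed
  then show ?thesis
    unfolding normal_inv_iff using normal_conj[OF assms(2)] by blast
qed

text \<open>Adjoining an element that is central modulo \<open>N\<close> stays inside the centre
  modulo \<open>N\<close>, and every subgroup between \<open>N\<close> and the preimage of that
  centre is normal. This is how normal subgroups are enlarged one generator at a time.\<close>

lemma central_cyclic_normal:
  assumes N: "N \<lhd> G" and x: "x \<in> upper_series N 1"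
  shows "N <#> generate G {x} \<lhd> G" "N \<subseteq> N <#> generate G {x}" "x \<in> N <#> generate G {x}"
proof -
  have xc: "x \<in> carrier G" using x by simp
  have gs: "subgroup (generate G {x}) G" using xc by (intro generate_is_subgroup) auto
  have s: "subgroup (N <#> generate G {x}) G" by (rule mult_norm_subgroup[OF N gs])
  have g1: "\<one> \<in> generate G {x}" by (rule generate.one)
  have gx: "x \<in> generate G {x}" by (rule generate.incl) simp
  show NK: "N \<subseteq> N <#> generate G {x}"
  proof
    fix n assume n: "n \<in> N"
    then have "n = n \<otimes> \<one>" using normal_mem[OF N] by simp
    then show "n \<in> N <#> generate G {x}" unfolding set_mult_def using n g1 by blast
  qed
  show "x \<in> N <#> generate G {x}"
  proof -
    have "x = \<one> \<otimes> x" using xc by simp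
    then show ?thesis
      unfolding set_mult_def using gx subgroup.one_closed[OF normal_subgroup[OF N]] by blast
  qed
  have u: "subgroup (upper_series N 1) G" by (rule normal_subgroup[OF upper_series_normal[OF N]])
  have "generate G {x} \<subseteq> upper_series N 1"
    using generate_subgroup_incl[OF _ u] x by simp
  then have "N <#> generate G {x} \<subseteq> upper_series N 1"
    unfolding set_mult_def using upper_series_base[OF N, of 1] subgroup.m_closed[OF u] by blast
  then have "\<And>y h. \<lbrakk>y \<in> N <#> generate G {x}; h \<in> carrier G\<rbrakk> \<Longrightarrow> commutator y h \<in> N" by auto
  then show "N <#> generate G {x} \<lhd> G"
    using normal_between[OF s NK _ normal_subgroup[OF N]] by blast
qed

lemma mem_mult_cyclic:
  assumes "N \<subseteq> carrier G" "x \<in> carrier G"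
  shows "y \<in> N <#> generate G {x} \<longleftrightarrow> (\<exists>n\<in>N. \<exists>i::int. y = n \<otimes> x [^] i)"
  unfolding set_mult_def generate_pow[OF assms(2)] by auto

text \<open>A normal subgroup maximal among those avoiding all positive powers of $g$ has torsion-free
  upper central factors, and some power of $g$ is central modulo it; so $g$ itself is central.\<close>
lemma exists_normal_central:
  assumes nil: "nilpotent_group G" and g: "g \<in> carrier G" and inf: "\<And>k::nat. 0 < k \<Longrightarrow> g [^] k \<noteq> \<one>"
  obtains N where "N \<lhd> G" "\<And>k::nat. 0 < k \<Longrightarrow> g [^] k \<notin> N" "g \<in> upper_series N 1"
proof -
  define \<A> where "\<A> = {N. N \<lhd> G \<and> (\<forall>k::nat. 0 < k \<longrightarrow> g [^] k \<notin> N)}"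
  have "\<exists>N\<in>\<A>. \<forall>X\<in>\<A>. N \<subseteq> X \<longrightarrow> X = N"
  proof (rule subset_Zorn_nonempty)
    have "{\<one>} \<in> \<A>" using inf by (simp add: \<A>_def one_is_normal)
    then show "\<A> \<noteq> {}" by blast
    fix \<C> assume C: "\<C> \<noteq> {}" "subset.chain \<A> \<C>"
    have sub: "\<C> \<subseteq> \<A>" and ch: "\<And>M N. \<lbrakk>M \<in> \<C>; N \<in> \<C>\<rbrakk> \<Longrightarrow> M \<subseteq> N \<or> N \<subseteq> M"
      using C(2) by (auto simp: subset_chain_def)
    have "\<Union>\<C> \<lhd> G" using normal_Union_chain[OF C(1) _ ch] sub by (auto simp: \<A>_def)
    then show "\<Union>\<C> \<in> \<A>" using sub by (auto simp: \<A>_def)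
  qed
  then obtain N where N\<A>: "N \<in> \<A>" and max: "\<And>X. \<lbrakk>X \<in> \<A>; N \<subseteq> X\<rbrakk> \<Longrightarrow> X = N" by blast
  have N: "N \<lhd> G" and gN: "\<And>k::nat. 0 < k \<Longrightarrow> g [^] k \<notin> N" using N\<A> by (auto simp: \<A>_def)
  note sN = normal_subgroup[OF N]
  have meets: "\<exists>k::nat. 0 < k \<and> g [^] k \<in> K" if "K \<lhd> G" "N \<subseteq> K" "K \<noteq> N" for K
    using max[of K] that by (auto simp: \<A>_def)
  \<comment> \<open>Otherwise adjoining \<open>x\<close> gives a strictly larger normal subgroup,
    which by maximality contains some \<open>g [^] l = n \<otimes> x [^] i\<close>. Its
    \<open>k\<close>-th power lies in \<open>N\<close> because \<open>x [^] k\<close> does, so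
    \<open>g [^] (l * k)\<close> lies in \<open>N\<close>, which is excluded.\<close>
  have base: "x \<in> N" if x: "x \<in> upper_series N 1" and k: "0 < k" "x [^] (k::nat) \<in> N" for x k
  proof (rule ccontr)
    assume "x \<notin> N"
    note K = central_cyclic_normal[OF N x]
    have xc: "x \<in> carrier G" using x by simp
    obtain l :: nat where l: "0 < l" "g [^] l \<in> N <#> generate G {x}"
    proof -
      have "N <#> generate G {x} \<noteq> N" using K(3) \<open>x \<notin> N\<close> by metis
      then show ?thesis using meets[OF K(1,2)] that by blast
    qed
    then obtain n and i :: int where ni: "n \<in> N" "g [^] l = n \<otimes> x [^] i"
      using mem_mult_cyclic[OF subgroup.subset[OF sN] xc] by blast
    obtain n' where n': "n' \<in> N" "(n \<otimes> x [^] i) [^] k = n' \<otimes> (x [^] i) [^] k"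
      using normal_mult_pow[OF N ni(1), of "x [^] i" k] xc by auto
    have "(x [^] i) [^] k = (x [^] k) [^] i"
      using int_pow_pow[OF xc, of i "int k"] int_pow_pow[OF xc, of "int k" i]
      by (simp add: int_pow_int mult.commute)
    then have "(x [^] i) [^] k \<in> N" using subgroup_int_pow_closed[OF sN k(2)] by simp
    then have "(g [^] l) [^] k \<in> N"
      unfolding ni(2) n'(2) using n'(1) sN by (simp add: subgroup.m_closed)
    then have "g [^] (l * k) \<in> N" using nat_pow_pow[OF g] by simp
    then show False using gN[of "l * k"] l k by simp
  qed
  obtain c where c: "upper_series N c = carrier G" using upper_series_top[OF nil N] by blast
  \<comment> \<open>The centre modulo \<open>N\<close> is nontrivial: otherwise the upper series
    would never leave \<open>N\<close>, yet it reaches \<open>g\<close>, which is not in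
    \<open>N\<close>. So maximality applies to it.\<close>
  have "\<exists>k::nat. 0 < k \<and> g [^] k \<in> upper_series N 1"
  proof (rule meets)
    show "upper_series N 1 \<lhd> G" "N \<subseteq> upper_series N 1"
      using upper_series_normal[OF N] upper_series_base[OF N] by blast+
    show "upper_series N 1 \<noteq> N"
    proof
      assume e: "upper_series N 1 = N"
      have "upper_series N j \<subseteq> N" for j
      proof (induction j)
        case (Suc j)
        then have "upper_series N (Suc j) \<subseteq> upper_series N 1" by auto
        then show ?case unfolding e .
      qed simp
      then have "g \<in> N" using c g by (metis subsetD)
      moreover have "g [^] (1::nat) = g" using g by simp
      ultimately show False using gN[of 1, OF zero_less_one] by argo
    qed
  qed
  then obtain k :: nat where k: "0 < k" "g [^] k \<in> upper_series N 1" by blast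
  have mono1: "upper_series N 1 \<subseteq> upper_series N (Suc j)" for j
  proof (induction j)
    case (Suc j)
    then show ?case using upper_series_mono[OF N, of "Suc j"] by (rule order_trans)
  qed simp
  \<comment> \<open>The same power of \<open>g\<close> lies in every term from the first on, so each
    torsion-free factor lets \<open>g\<close> drop by one term, down to the first.\<close>
  have "g \<in> upper_series N (Suc j) \<Longrightarrow> g \<in> upper_series N 1" for j
  proof (induction j)
    case (Suc j)
    have "g [^] k \<in> upper_series N (Suc j)" using k(2) mono1 by (rule subsetD[rotated])
    with upper_series_torsion_free[OF N base Suc.prems k(1)] have "g \<in> upper_series N (Suc j)" by simp
    then show ?case by (rule Suc.IH)
  qed simp
  moreover have "g \<in> upper_series N (Suc c)"
    using upper_series_mono[OF N, of c] g unfolding c by (rule subsetD)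
  ultimately have "g \<in> upper_series N 1" by blast
  with N gN show thesis by (rule that)
qed

section \<open>Folner sets of cosets\<close>

abbreviation escaping :: "'a set \<Rightarrow> 'a \<Rightarrow> 'a set \<Rightarrow> 'a set" where
  "escaping N h A \<equiv> {x\<in>A. \<forall>y\<in>A. inv y \<otimes> (h \<otimes> x) \<notin> N}"

text \<open>\<open>A\<close> stands for a finite set of left cosets of \<open>N\<close>, one
  representative each; \<open>escaping N h A\<close> collects the representatives whose coset
  \<open>h\<close> moves out of that set.\<close>

definition folner_set :: "'a set \<Rightarrow> 'a set \<Rightarrow> real \<Rightarrow> 'a set \<Rightarrow> bool" where
  "folner_set N F e A \<longleftrightarrow> finite A \<and> A \<noteq> {} \<and> (\<forall>x\<in>A. \<forall>y\<in>A. inv x \<otimes> y \<in> N \<longrightarrow> x = y) \<and>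
     (\<forall>h\<in>F. real (card (escaping N h A)) \<le> e * card A)"

text \<open>Folner sets for the action of \<open>K\<close> on its left cosets of \<open>N\<close>.
  Admitting \<open>e = 0\<close> for periodic groups lets one chain of lemmas serve both amenability
  and the finiteness theorem.\<close>

definition rel_folner :: "'a set \<Rightarrow> 'a set \<Rightarrow> bool" where
  "rel_folner K N \<longleftrightarrow> (\<forall>F e. finite F \<and> F \<subseteq> K \<and> (e > 0 \<or> e = 0 \<and> periodic_group G) \<longrightarrow>
     (\<exists>A\<subseteq>K. folner_set N F e A))"

text \<open>There is only one coset, and every \<open>h\<close> in \<open>K\<close> fixes
  it.\<close>

lemma rel_folner_refl:
  assumes "subgroup K G" shows "rel_folner K K"
  unfolding rel_folner_def
proof (intro allI impI)
  fix F and e :: real assume F: "finite F \<and> F \<subseteq> K \<and> (e > 0 \<or> e = 0 \<and> periodic_group G)"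
  have "{x \<in> {\<one>}. \<forall>y\<in>{\<one>}. inv y \<otimes> (h \<otimes> x) \<notin> K} = {}" if "h \<in> F" for h
  proof -
    have "h \<in> K" using F that by blast
    then show ?thesis using subgroup.mem_carrier[OF assms] by simp
  qed
  note bad = this
  have "real (card {x \<in> {\<one>}. \<forall>y\<in>{\<one>}. inv y \<otimes> (h \<otimes> x) \<notin> K}) \<le> e * card {\<one>}" if "h \<in> F" for h
    unfolding bad[OF that] using F by auto
  then have "folner_set K F e {\<one>}" unfolding folner_set_def by blast
  then show "\<exists>A\<subseteq>K. folner_set K F e A"
    using subgroup.one_closed[OF assms] by (intro exI[of _ "{\<one>}"]) auto
qed

text \<open>The Folner set consists of products \<open>a \<otimes> b\<close>, with \<open>a\<close>
  from one for \<open>M\<close> in \<open>K\<close> and \<open>b\<close> from one for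
  \<open>N\<close> in \<open>M\<close>. If \<open>h\<close> carries \<open>a\<close> into the coset
  of \<open>a'\<close>, then \<open>h \<otimes> a = a' \<otimes> m\<close> with \<open>m\<close> in
  \<open>M\<close>, so \<open>a \<otimes> b\<close> can escape only if \<open>a\<close> does or if
  \<open>m\<close> moves \<open>b\<close> out of \<open>B\<close>. Each cause costs at most a
  proportion \<open>e/2\<close>.\<close>

lemma rel_folner_trans:
  assumes KM: "rel_folner K M" and MN: "rel_folner M N"
    and sK: "subgroup K G" and sM: "subgroup M G" and NM: "N \<subseteq> M" and MK: "M \<subseteq> K"
  shows "rel_folner K N"
  unfolding rel_folner_def
proof (intro allI impI)
  fix F and e :: real assume F: "finite F \<and> F \<subseteq> K \<and> (e > 0 \<or> e = 0 \<and> periodic_group G)"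
  then have F2: "finite F \<and> F \<subseteq> K \<and> (e/2 > 0 \<or> e/2 = 0 \<and> periodic_group G)" by auto
  obtain A where A_sub: "A \<subseteq> K" and A_fol: "folner_set M F (e/2) A"
    using KM[unfolded rel_folner_def, rule_format, OF F2] by blast
  have A: "A \<subseteq> K" "finite A" "A \<noteq> {}" "\<And>x y. \<lbrakk>x \<in> A; y \<in> A; inv x \<otimes> y \<in> M\<rbrakk> \<Longrightarrow> x = y"
    "\<And>h. h \<in> F \<Longrightarrow> real (card (escaping M h A)) \<le> e/2 * card A"
    using A_sub A_fol unfolding folner_set_def by simp_all
  \<comment> \<open>All the elements \<open>m\<close> that can occur. They depend on
    \<open>F\<close> and \<open>A\<close> only, so \<open>B\<close> can be chosen afterwards to suit
    them.\<close>
  define E where "E = (\<lambda>(h, x, y). inv y \<otimes> (h \<otimes> x)) ` (F \<times> A \<times> A) \<inter> M"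
  have E2: "finite E \<and> E \<subseteq> M \<and> (e/2 > 0 \<or> e/2 = 0 \<and> periodic_group G)"
    using F A(2) by (auto simp: E_def)
  obtain B where B_sub: "B \<subseteq> M" and B_fol: "folner_set N E (e/2) B"
    using MN[unfolded rel_folner_def, rule_format, OF E2] by blast
  have B: "B \<subseteq> M" "finite B" "B \<noteq> {}" "\<And>x y. \<lbrakk>x \<in> B; y \<in> B; inv x \<otimes> y \<in> N\<rbrakk> \<Longrightarrow> x = y"
    "\<And>h. h \<in> E \<Longrightarrow> real (card (escaping N h B)) \<le> e/2 * card B"
    using B_sub B_fol unfolding folner_set_def by simp_all
  have Ac: "\<And>x. x \<in> A \<Longrightarrow> x \<in> carrier G" and Bc: "\<And>x. x \<in> B \<Longrightarrow> x \<in> carrier G"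
    and Fc: "\<And>x. x \<in> F \<Longrightarrow> x \<in> carrier G"
    using A(1) B(1) F subgroup.subset[OF sK] subgroup.subset[OF sM] by blast+
  define C where "C = (\<lambda>(a, b). a \<otimes> b) ` (A \<times> B)"
  have dist: "a = a' \<and> b = b'"
    if ab: "a \<in> A" "b \<in> B" "a' \<in> A" "b' \<in> B" and N: "inv (a \<otimes> b) \<otimes> (a' \<otimes> b') \<in> N" for a b a' b'
  proof -
    have e: "inv (a \<otimes> b) \<otimes> (a' \<otimes> b') = inv b \<otimes> (inv a \<otimes> a') \<otimes> b'"
      using ab Ac Bc by (simp add: inv_mult_group m_assoc)
    define w where "w = inv b \<otimes> (inv a \<otimes> a') \<otimes> b'"
    have bM: "b \<in> M" "b' \<in> M" using ab B(1) by auto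
    have "w \<in> M" using N NM unfolding e w_def by blast
    then have "b \<otimes> w \<otimes> inv b' \<in> M"
      using bM by (simp add: subgroup.m_closed[OF sM] subgroup.m_inv_closed[OF sM])
    moreover have "b \<otimes> w \<otimes> inv b' = inv a \<otimes> a'"
      using ab Ac Bc by (simp add: w_def m_assoc mult_inv_cancel)
    ultimately have "a = a'" using A(4) ab by simp
    moreover have "b = b'"
    proof -
      have "inv b \<otimes> (inv a \<otimes> a') \<otimes> b' = inv b \<otimes> b'" using ab Ac Bc \<open>a = a'\<close> by simp
      then show ?thesis using N B(4)[OF ab(2,4)] unfolding e by simp
    qed
    ultimately show ?thesis by blast
  qed
  have N1: "inv (a \<otimes> b) \<otimes> (a \<otimes> b) = \<one>" if "a \<in> A" "b \<in> B" for a b using that Ac Bc by simp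
  \<comment> \<open>Not a special case of \<open>dist\<close>: \<open>N\<close> is a bare subset of
    \<open>M\<close> here, so \<one> need not belong to it. The coset of \<open>M\<close> determines
    \<open>a\<close>, and cancellation then determines \<open>b\<close>.\<close>
  have inj: "inj_on (\<lambda>(a, b). a \<otimes> b) (A \<times> B)"
  proof (rule inj_onI, clarify)
    fix a b a' b' assume ab: "a \<in> A" "b \<in> B" "a' \<in> A" "b' \<in> B" "a \<otimes> b = a' \<otimes> b'"
    have e: "inv b \<otimes> (inv a \<otimes> a') \<otimes> b' = \<one>"
    proof -
      have "inv b \<otimes> (inv a \<otimes> a') \<otimes> b' = inv b \<otimes> (inv a \<otimes> (a' \<otimes> b'))"
        using ab(1-4) Ac Bc by (simp add: m_assoc)
      also have "\<dots> = \<one>" unfolding ab(5)[symmetric] using ab(1-4) Ac Bc by (simp add: mult_inv_cancel)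
      finally show ?thesis .
    qed
    have bM: "b \<in> M" "b' \<in> M" using ab B(1) by auto
    have "inv a \<otimes> a' = b \<otimes> (inv b \<otimes> (inv a \<otimes> a') \<otimes> b') \<otimes> inv b'"
      using ab(1-4) Ac Bc by (simp add: m_assoc mult_inv_cancel)
    also have "\<dots> = b \<otimes> inv b'" unfolding e using ab Bc by simp
    finally have "inv a \<otimes> a' \<in> M"
      using bM by (simp add: subgroup.m_closed[OF sM] subgroup.m_inv_closed[OF sM])
    then have "a = a'" using A(4) ab by blast
    then show "a = a' \<and> b = b'" using ab Ac Bc by simp
  qed
  have cC: "card C = card A * card B"
    unfolding C_def using card_image[OF inj] by (simp add: card_cartesian_product)
  have bad: "real (card (escaping N h C)) \<le> e * card C" if h: "h \<in> F" for h
  proof -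
    define A0 where "A0 = escaping M h A"
    define y where "y x = (SOME y. y \<in> A \<and> inv y \<otimes> (h \<otimes> x) \<in> M)" for x
    have y: "y x \<in> A \<and> inv (y x) \<otimes> (h \<otimes> x) \<in> M" if "x \<in> A - A0" for x
      unfolding y_def by (rule someI_ex) (use that in \<open>auto simp: A0_def\<close>)
    define m where "m x = inv (y x) \<otimes> (h \<otimes> x)" for x
    have mE: "m x \<in> E" if "x \<in> A - A0" for x
    proof -
      have "(h, x, y x) \<in> F \<times> A \<times> A" using y[OF that] that h by auto
      then have "m x \<in> (\<lambda>(h, x, y). inv y \<otimes> (h \<otimes> x)) ` (F \<times> A \<times> A)"
        by (rule rev_image_eqI) (simp add: m_def)
      then show ?thesis using y[OF that] by (simp add: E_def m_def)
    qed
    define B0 where "B0 x = {b\<in>B. \<forall>b'\<in>B. inv b' \<otimes> (m x \<otimes> b) \<notin> N}" for x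
    have "escaping N h C \<subseteq> (\<lambda>(a, b). a \<otimes> b) ` (A0 \<times> B \<union> (SIGMA x:A - A0. B0 x))"
    proof clarify
      fix x assume x: "x \<in> C" "\<forall>y\<in>C. inv y \<otimes> (h \<otimes> x) \<notin> N"
      then obtain a b where ab: "a \<in> A" "b \<in> B" "x = a \<otimes> b" by (auto simp: C_def)
      have "b \<in> B0 a" if a0: "a \<in> A - A0"
        unfolding B0_def
      proof (intro CollectI conjI ballI ab)
        fix b' assume b': "b' \<in> B"
        have ya: "y a \<in> A" using y[OF a0] by blast
        have "y a \<otimes> b' \<in> C" using ya b' by (force simp: C_def)
        then have "inv (y a \<otimes> b') \<otimes> (h \<otimes> x) \<notin> N" using x by blast
        moreover have "inv (y a \<otimes> b') \<otimes> (h \<otimes> x) = inv b' \<otimes> (m a \<otimes> b)"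
          using ab b' Ac[OF ab(1)] Ac[OF ya] Bc Fc[OF h] by (simp add: m_def inv_mult_group m_assoc)
        ultimately show "inv b' \<otimes> (m a \<otimes> b) \<notin> N" by simp
      qed
      then have "(a, b) \<in> A0 \<times> B \<union> (SIGMA x:A - A0. B0 x)" using ab by auto
      then show "x \<in> (\<lambda>(a, b). a \<otimes> b) ` (A0 \<times> B \<union> (SIGMA x:A - A0. B0 x))"
        using ab(3) by force
    qed
    moreover have fin: "finite A0" "finite (SIGMA x:A - A0. B0 x)"
      using A(2) B(2) by (auto simp: A0_def B0_def)
    ultimately have "card (escaping N h C) \<le> card (A0 \<times> B \<union> (SIGMA x:A - A0. B0 x))"
      using B(2) by (intro surj_card_le) auto
    also have "\<dots> \<le> card (A0 \<times> B) + card (SIGMA x:A - A0. B0 x)" by (rule card_Un_le)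
    also have "\<dots> = card A0 * card B + (\<Sum>x\<in>A - A0. card (B0 x))"
      using A(2) B(2) by (simp add: card_cartesian_product B0_def)
    finally have "real (card (escaping N h C)) \<le>
        real (card A0) * card B + (\<Sum>x\<in>A - A0. real (card (B0 x)))"
      by (simp flip: of_nat_mult of_nat_sum of_nat_add)
    also have "\<dots> \<le> (e/2 * card A) * card B + (\<Sum>x\<in>A - A0. e/2 * card B)"
      using A(5)[OF h] B(5)[OF mE] unfolding A0_def[symmetric] B0_def
      by (intro add_mono mult_right_mono sum_mono) auto
    also have "\<dots> \<le> (e/2 * card A) * card B + (\<Sum>x\<in>A. e/2 * card B)"
      using F A(2) by (intro add_left_mono sum_mono2) auto
    also have "\<dots> = e * card C" by (simp add: cC)
    finally show ?thesis .
  qed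
  have "C \<subseteq> K"
  proof
    fix x assume "x \<in> C"
    then obtain a b where "a \<in> A" "b \<in> B" "x = a \<otimes> b" by (auto simp: C_def)
    then show "x \<in> K" using A(1) B(1) MK subgroup.m_closed[OF sK, of a b] by blast
  qed
  moreover have "folner_set N F e C"
    unfolding folner_set_def
  proof (intro conjI ballI impI bad)
    show "finite C" "C \<noteq> {}" using A(2,3) B(2,3) by (auto simp: C_def)
    show "x = y" if "x \<in> C" "y \<in> C" "inv x \<otimes> y \<in> N" for x y
      using that dist by (auto simp: C_def)
  qed
  ultimately show "\<exists>A\<subseteq>K. folner_set N F e A" by blast
qed

text \<open>The Folner sets are blocks of consecutive powers of \<open>x\<close>. If some positive
  power of \<open>x\<close> lies in \<open>N\<close>, a block of the least such length represents
  all cosets and nothing escapes, even for \<open>e = 0\<close>. Otherwise the group is not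
  periodic, so \<open>e > 0\<close>, and a long block loses only points near one end.\<close>

lemma rel_folner_cyclic:
  assumes N: "N \<lhd> G" and x: "x \<in> carrier G"
  shows "rel_folner (N <#> generate G {x}) N"
  unfolding rel_folner_def
proof (intro allI impI)
  fix F and e :: real
  assume F: "finite F \<and> F \<subseteq> N <#> generate G {x} \<and> (e > 0 \<or> e = 0 \<and> periodic_group G)"
  note sN = normal_subgroup[OF N]
  have "\<exists>i::int. \<exists>n\<in>N. f = n \<otimes> x [^] i" if "f \<in> F" for f
    using F that mem_mult_cyclic[OF subgroup.subset[OF sN] x] by blast
  then obtain J :: "'a \<Rightarrow> int" where J: "\<And>f. f \<in> F \<Longrightarrow> \<exists>n\<in>N. f = n \<otimes> x [^] J f" by metis
  \<comment> \<open>Modulo \<open>N\<close>, left multiplication by \<open>f\<close> shifts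
    exponents by \<open>J f\<close>, so the action becomes translation of the integers.\<close>
  have move: "inv (x [^] i') \<otimes> (f \<otimes> x [^] i) \<in> N"
    if f: "f \<in> F" and i: "x [^] (J f + i - i') \<in> N" for f and i i' :: int
  proof -
    define j where "j = J f"
    obtain n where n: "n \<in> N" "f = n \<otimes> x [^] j" using J[OF f] unfolding j_def by blast
    have "x [^] j \<otimes> x [^] i = x [^] i' \<otimes> x [^] (j + i - i')"
      using int_pow_mult[OF x, of i' "j + i - i'"] int_pow_mult[OF x, of j i] by simp
    then have "inv (x [^] i') \<otimes> (f \<otimes> x [^] i) = (inv (x [^] i') \<otimes> n \<otimes> x [^] i') \<otimes> x [^] (j + i - i')"
      using normal_mem[OF N n(1)] x by (simp add: n(2) m_assoc)
    then show ?thesis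
      using subgroup.m_closed[OF sN normal_conj'[OF N _ n(1), of "x [^] i'"] i] x by (simp add: j_def)
  qed
  define A where "A n = (\<lambda>i::nat. x [^] int i) ` {..<n}" for n
  have pos: "\<exists>k::nat. 0 < k \<and> int k = \<bar>d\<bar> \<and> x [^] k \<in> N" if d: "x [^] d \<in> N" "d \<noteq> 0" for d :: int
  proof (cases "d > 0")
    case True
    then show ?thesis using d x int_pow_int[of G x "nat d"] by (intro exI[of _ "nat d"]) auto
  next
    case False
    then have "x [^] nat (- d) \<in> N"
      using subgroup.m_inv_closed[OF sN d(1)] x int_pow_int[of G x "nat (- d)"] int_pow_neg[OF x, of d] by simp
    then show ?thesis using d False by (intro exI[of _ "nat (- d)"]) auto
  qed
  have inv_pow: "inv (x [^] int i) \<otimes> x [^] int i' = x [^] (int i' - int i)" for i i' :: nat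
    using x int_pow_mult[OF x, of "- int i" "int i'"] int_pow_neg[OF x, of "int i"] by simp
  have AK: "A n \<subseteq> N <#> generate G {x}" for n
  proof
    fix y assume "y \<in> A n"
    then obtain i :: nat where "y = \<one> \<otimes> x [^] int i" using x by (auto simp: A_def)
    then show "y \<in> N <#> generate G {x}"
      using mem_mult_cyclic[OF subgroup.subset[OF sN] x] subgroup.one_closed[OF sN] by blast
  qed
  have finA: "finite (A n)" for n by (simp add: A_def)
  have sep: "i = i'" if "inv (x [^] int i) \<otimes> x [^] int i' \<in> N" "i < n" "i' < n"
    "\<And>k::nat. \<lbrakk>0 < k; k < n\<rbrakk> \<Longrightarrow> x [^] k \<notin> N" for i i' n :: nat
  proof (rule ccontr)
    assume "i \<noteq> i'"
    then have d: "int i' - int i \<noteq> 0" by simp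
    have "x [^] (int i' - int i) \<in> N" using that(1) by (simp only: inv_pow)
    from pos[OF this d] obtain k :: nat where k: "0 < k" "int k = \<bar>int i' - int i\<bar>" "x [^] k \<in> N" by blast
    then have "k < n" using that(2,3) by linarith
    then show False using that(4) k by blast
  qed
  show "\<exists>A\<subseteq>N <#> generate G {x}. folner_set N F e A"
  proof (cases "\<exists>k::nat. 0 < k \<and> x [^] k \<in> N")
    case True
    define k where "k = (LEAST k::nat. 0 < k \<and> x [^] k \<in> N)"
    have k: "0 < k" "x [^] k \<in> N" using LeastI_ex[OF True] by (auto simp: k_def)
    have least: "x [^] l \<notin> N" if "0 < l" "l < k" for l
      using not_less_Least[of l "\<lambda>k. 0 < k \<and> x [^] k \<in> N"] that by (simp add: k_def)
    have "\<exists>y\<in>A k. inv y \<otimes> (h \<otimes> z) \<in> N" if h: "h \<in> F" and z: "z \<in> A k" for h z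
    proof -
      obtain i where i: "z = x [^] int i" using z by (auto simp: A_def)
      \<comment> \<open>Translation by \<open>J h\<close> wraps around modulo \<open>k\<close>, so
        the image is again represented in the block.\<close>
      define i' where "i' = (J h + int i) mod int k"
      have "J h + int i - i' = int k * ((J h + int i) div int k)"
        by (simp add: i'_def minus_mod_eq_mult_div)
      then have "x [^] (J h + int i - i') = (x [^] k) [^] ((J h + int i) div int k)"
        using int_pow_pow[OF x, of "int k"] by (simp add: int_pow_int)
      then have "x [^] (J h + int i - i') \<in> N" using subgroup_int_pow_closed[OF sN k(2)] by simp
      then have "inv (x [^] i') \<otimes> (h \<otimes> z) \<in> N" using move[OF h] i by simp
      moreover have "x [^] i' \<in> A k"
      proof -
        have "0 \<le> i'" "i' < int k"
          using k(1) by (auto simp: i'_def)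
        then show ?thesis by (auto simp: A_def intro!: image_eqI[of _ _ "nat i'"])
      qed
      ultimately show ?thesis by blast
    qed
    then have bad: "escaping N h (A k) = {}" if "h \<in> F" for h
      using that by blast
    have "folner_set N F e (A k)"
      unfolding folner_set_def
    proof (intro conjI ballI impI finA)
      show "A k \<noteq> {}" using k(1) by (auto simp: A_def)
      show "y = z" if "y \<in> A k" "z \<in> A k" "inv y \<otimes> z \<in> N" for y z
        using that sep[OF _ _ _ least] by (auto simp: A_def)
      show "real (card (escaping N h (A k))) \<le> e * card (A k)" if "h \<in> F" for h
        unfolding bad[OF that] using F by auto
    qed
    then show ?thesis using AK by blast
  next
    case False
    have "\<not> periodic_group G"
    proof
      assume "periodic_group G"
      then have "ord x \<noteq> 0" using x by (simp add: periodic_group_def)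
      moreover have "x [^] ord x \<in> N" using pow_ord_eq_1[OF x] subgroup.one_closed[OF sN] by simp
      ultimately show False using False by blast
    qed
    then have e: "e > 0" using F by auto
    define m where "m = (\<Sum>f\<in>F. \<bar>J f\<bar>)"
    have Jm: "\<bar>J f\<bar> \<le> m" if "f \<in> F" for f
      unfolding m_def using F that by (intro member_le_sum) auto
    \<comment> \<open>\<open>m\<close> bounds every shift, so at most \<open>m\<close> of the
      \<open>n\<close> points will escape, a proportion of at most \<open>e\<close>.\<close>
    obtain n :: nat where n: "n > real_of_int m / e" using reals_Archimedean2 by blast
    have "m \<ge> 0" by (simp add: m_def sum_nonneg)
    then have "real_of_int m / e \<ge> 0" using e by simp
    then have n0: "n > 0" using n by linarith
    have inj: "inj_on (\<lambda>i::nat. x [^] int i) {..<n}"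
    proof (rule inj_onI)
      fix i i' :: nat assume i: "i \<in> {..<n}" "i' \<in> {..<n}" "x [^] int i = x [^] int i'"
      then have "inv (x [^] int i) \<otimes> x [^] int i' \<in> N" using x subgroup.one_closed[OF sN] by simp
      from sep[OF this, of n] show "i = i'" using i False by blast
    qed
    then have cA: "card (A n) = n" by (simp add: A_def card_image)
    have "folner_set N F e (A n)"
      unfolding folner_set_def
    proof (intro conjI ballI impI finA)
      show "A n \<noteq> {}" using n0 by (auto simp: A_def)
      show "y = z" if yz: "y \<in> A n" "z \<in> A n" "inv y \<otimes> z \<in> N" for y z
      proof -
        obtain i i' where i: "y = x [^] int i" "z = x [^] int i'" "i < n" "i' < n"
          using yz by (auto simp: A_def)
        then show ?thesis using sep[of i i' n] False yz by blast
      qed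
      show "real (card (escaping N h (A n))) \<le> e * card (A n)" if h: "h \<in> F" for h
      proof -
        \<comment> \<open>The exponents pushed out of the block: a segment of at most
          \<open>\<bar>J h\<bar>\<close> points, at the end given by the sign of the shift.\<close>
        define B where "B = {i::nat. i < n \<and> \<not> (0 \<le> J h + int i \<and> J h + int i < int n)}"
        have "B \<subseteq> (if J h \<ge> 0 then {n - nat (J h)..<n} else {..<nat (- J h)})"
          by (auto simp: B_def)
        then have "card B \<le> card (if J h \<ge> 0 then {n - nat (J h)..<n} else {..<nat (- J h)})"
          by (rule card_mono[rotated]) simp
        then have cB: "int (card B) \<le> \<bar>J h\<bar>" by (auto split: if_splits)
        have "escaping N h (A n) \<subseteq> (\<lambda>i. x [^] int i) ` B"
        proof clarify
          fix z assume z: "z \<in> A n" "\<forall>y\<in>A n. inv y \<otimes> (h \<otimes> z) \<notin> N"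
          then obtain i where i: "z = x [^] int i" "i < n" by (auto simp: A_def)
          have False if b: "0 \<le> J h + int i" "J h + int i < int n"
          proof -
            have "x [^] (J h + int i) \<in> A n"
              using b by (auto simp: A_def intro!: image_eqI[of _ _ "nat (J h + int i)"])
            moreover have "inv (x [^] (J h + int i)) \<otimes> (h \<otimes> z) \<in> N"
              unfolding i(1) by (rule move[OF h]) (simp add: subgroup.one_closed[OF sN])
            ultimately show False using z(2) by blast
          qed
          then show "z \<in> (\<lambda>i. x [^] int i) ` B" using i by (auto simp: B_def)
        qed
        then have "card (escaping N h (A n)) \<le> card B"
          by (rule surj_card_le[rotated]) (simp add: B_def)
        then have "int (card (escaping N h (A n))) \<le> m"
          using cB Jm[OF h] by linarith
        then have "real (card (escaping N h (A n))) \<le> real_of_int m"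
          by linarith
        also have "\<dots> \<le> e * n" using n e by (simp add: field_simps)
        finally show ?thesis by (simp add: cA)
      qed
    qed
    then show ?thesis using AK by blast
  qed
qed

text \<open>\<open>K\<close> may be infinitely generated over \<open>N\<close>, but only the finite
  set \<open>F\<close> has to be covered. Its elements are adjoined to \<open>N\<close> one by one;
  each is central modulo the subgroup reached so far, so the subgroup stays normal and every
  extension is cyclic.\<close>

lemma rel_folner_central:
  assumes K: "subgroup K G" and N: "N \<lhd> G" and NK: "N \<subseteq> K"
    and c: "\<And>x h. \<lbrakk>x \<in> K; h \<in> carrier G\<rbrakk> \<Longrightarrow> commutator x h \<in> N"
  shows "rel_folner K N"
  unfolding rel_folner_def
proof (intro allI impI)
  fix F and e :: real assume F: "finite F \<and> F \<subseteq> K \<and> (e > 0 \<or> e = 0 \<and> periodic_group G)"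
  have "\<exists>K'. K' \<lhd> G \<and> N \<subseteq> K' \<and> K' \<subseteq> K \<and> E \<subseteq> K' \<and> rel_folner K' N" if "finite E" "E \<subseteq> K" for E
    using that
  proof (induction E)
    case empty
    then show ?case using N NK rel_folner_refl[OF normal_subgroup[OF N]] by auto
  next
    case (insert x E)
    then obtain K' where K': "K' \<lhd> G" "N \<subseteq> K'" "K' \<subseteq> K" "E \<subseteq> K'" "rel_folner K' N" by auto
    have x: "x \<in> K" "x \<in> carrier G" using insert.prems subgroup.mem_carrier[OF K] by auto
    then have xu: "x \<in> upper_series K' 1" using c K'(2) by auto
    note L = central_cyclic_normal[OF K'(1) xu]
    have "K' <#> generate G {x} \<subseteq> K"
    proof
      fix y assume "y \<in> K' <#> generate G {x}"
      then obtain n and i :: int where "n \<in> K'" "y = n \<otimes> x [^] i"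
        using mem_mult_cyclic[OF subgroup.subset[OF normal_subgroup[OF K'(1)]] x(2)] by blast
      then show "y \<in> K"
        using K'(3) subgroup.m_closed[OF K, of n "x [^] i"] subgroup_int_pow_closed[OF K x(1), of i] by auto
    qed
    moreover have "rel_folner (K' <#> generate G {x}) N"
      using rel_folner_trans[OF rel_folner_cyclic[OF K'(1) x(2)] K'(5) normal_subgroup[OF L(1)]
          normal_subgroup[OF K'(1)] K'(2) L(2)] .
    ultimately show ?case using L K' by (intro exI[of _ "K' <#> generate G {x}"]) auto
  qed
  from this[of F] obtain K' where K': "K' \<subseteq> K" "F \<subseteq> K'" "rel_folner K' N" using F by blast
  from K'(3)[unfolded rel_folner_def, rule_format, of F e]
  have "\<exists>A\<subseteq>K'. folner_set N F e A" using F K'(2) by simp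
  then show "\<exists>A\<subseteq>K. folner_set N F e A" using K'(1) by blast
qed

text \<open>Successive terms of the upper central series over \<open>N\<close> are central
  extensions, and Folner sets compose along the series until it reaches \<open>G\<close>.\<close>

lemma nilpotent_rel_folner:
  assumes "nilpotent_group G" and N: "N \<lhd> G"
  shows "rel_folner (carrier G) N"
proof -
  have "rel_folner (upper_series N j) N" for j
  proof (induction j)
    case 0
    then show ?case using rel_folner_refl[OF normal_subgroup[OF N]] by simp
  next
    case (Suc j)
    note n = upper_series_normal[OF N]
    have "rel_folner (upper_series N (Suc j)) (upper_series N j)"
      by (rule rel_folner_central[OF normal_subgroup[OF n] n upper_series_mono[OF N]]) simp
    then show ?case
      using rel_folner_trans[OF _ Suc normal_subgroup[OF n] normal_subgroup[OF n]
          upper_series_base[OF N] upper_series_mono[OF N]] by blast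
  qed
  moreover obtain c where "upper_series N c = carrier G" using upper_series_top[OF assms] .
  ultimately show ?thesis by metis
qed

text \<open>For \<open>e = 0\<close> the Folner set over the trivial subgroup is closed under left
  multiplication by the generators and their inverses, hence by the whole group, so it contains a
  translate of the group.\<close>

lemma finitely_generated_periodic_nilpotent_finite:
  assumes nil: "nilpotent_group G" and per: "periodic_group G"
    and S: "finite S" "S \<subseteq> carrier G" "generate G S = carrier G"
  shows "finite (carrier G)"
proof -
  define F where "F = S \<union> (\<lambda>x. inv x) ` S"
  have F: "finite F" "F \<subseteq> carrier G" using S by (auto simp: F_def)
  obtain A where A: "A \<subseteq> carrier G" "folner_set {\<one>} F 0 A"
    using nilpotent_rel_folner[OF nil one_is_normal, unfolded rel_folner_def, rule_format, of F 0] F per by auto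
  have finA: "finite A" "A \<noteq> {}" using A(2) by (auto simp: folner_set_def)
  have step: "h \<otimes> x \<in> A" if h: "h \<in> F" and x: "x \<in> A" for h x
  proof -
    have "card (escaping {\<one>} h A) = 0"
      using A(2) h by (simp add: folner_set_def)
    then have "escaping {\<one>} h A = {}" using finA(1) by simp
    then obtain y where y: "y \<in> A" "inv y \<otimes> (h \<otimes> x) = \<one>" using x by blast
    have c: "y \<in> carrier G" "h \<otimes> x \<in> carrier G" using A(1) F(2) h x y by auto
    have "h \<otimes> x = y \<otimes> (inv y \<otimes> (h \<otimes> x))" using c by (simp add: mult_inv_cancel)
    then show ?thesis using y c by simp
  qed
  obtain a where a: "a \<in> A" using finA(2) by blast
  have inA: "x \<in> A \<Longrightarrow> h \<otimes> x \<in> A" if "h \<in> generate G S" for h x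
    using that
  proof (induction h arbitrary: x)
    case one then show ?case using A(1) by auto
  next
    case (incl h) then show ?case using step by (simp add: F_def)
  next
    case (inv h) then show ?case using step by (simp add: F_def)
  next
    case (eng h1 h2)
    have "h1 \<otimes> h2 \<otimes> x = h1 \<otimes> (h2 \<otimes> x)"
      using eng.hyps S(3) eng.prems A(1) by (intro m_assoc) auto
    then show ?case using eng.IH(1)[OF eng.IH(2)[OF eng.prems]] by simp
  qed
  have ac: "a \<in> carrier G" using a A(1) by blast
  have "(\<lambda>h. h \<otimes> a) ` carrier G \<subseteq> A" using inA a S(3) by blast
  moreover have "inj_on (\<lambda>h. h \<otimes> a) (carrier G)" using ac by (intro inj_onI) simp
  ultimately show ?thesis using finA(1) inj_on_finite by blast
qed

text \<open>The subgroup $M$ is generated by $g$ and a normal subgroup modulo which $g$ is central of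
  infinite order; $c$ is the exponent of $g$.\<close>
lemma exists_central_character:
  assumes nil: "nilpotent_group G" and g: "g \<in> carrier G" and inf: "\<And>k::nat. 0 < k \<Longrightarrow> g [^] k \<noteq> \<one>"
  obtains M and c :: "'a \<Rightarrow> int"
  where "subgroup M G" "\<And>x y. \<lbrakk>x \<in> M; y \<in> M\<rbrakk> \<Longrightarrow> c (x \<otimes> y) = c x + c y"
    "\<And>h. h \<in> carrier G \<Longrightarrow> inv h \<otimes> g \<otimes> h \<in> M \<and> c (inv h \<otimes> g \<otimes> h) = 1"
    "rel_folner (carrier G) M"
proof -
  obtain N where N: "N \<lhd> G" and gN: "\<And>k::nat. 0 < k \<Longrightarrow> g [^] k \<notin> N" and gc: "g \<in> upper_series N 1"
    using exists_normal_central[OF nil g inf] by blast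
  define M where "M = N <#> generate G {g}"
  note M = central_cyclic_normal[OF N gc, folded M_def]
  note sN = normal_subgroup[OF N]
  have memM: "y \<in> M \<longleftrightarrow> (\<exists>n\<in>N. \<exists>i::int. y = n \<otimes> g [^] i)" for y
    unfolding M_def by (rule mem_mult_cyclic[OF subgroup.subset[OF sN] g])
  have gi: "g [^] i \<in> N \<Longrightarrow> i = 0" for i :: int
  proof (rule ccontr)
    assume i: "g [^] i \<in> N" "i \<noteq> 0"
    show False
    proof (cases "i > 0")
      case True
      then show ?thesis using i gN[of "nat i"] int_pow_int[of G g "nat i"] by simp
    next
      case False
      then show ?thesis
        using i gN[of "nat (- i)"] int_pow_int[of G g "nat (- i)"] int_pow_neg[OF g, of i]
          subgroup.m_inv_closed[OF sN i(1)] by simp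
    qed
  qed
  \<comment> \<open>The exponent is well defined because no nonzero power of \<open>g\<close> lies
    in \<open>N\<close>.\<close>
  define c where "c y = (THE i::int. \<exists>n\<in>N. y = n \<otimes> g [^] i)" for y
  have c_eq: "c (n \<otimes> g [^] i) = i" if n: "n \<in> N" for n and i :: int
    unfolding c_def
  proof (rule the_equality)
    fix j :: int assume "\<exists>n'\<in>N. n \<otimes> g [^] i = n' \<otimes> g [^] j"
    then obtain n' where n': "n' \<in> N" "n \<otimes> g [^] i = n' \<otimes> g [^] j" by blast
    note nc = normal_mem[OF N n] normal_mem[OF N n'(1)]
    have "g [^] (i - j) = g [^] i \<otimes> inv (g [^] j)" using int_pow_diff[OF g] by simp
    also have "\<dots> = inv n \<otimes> (n \<otimes> g [^] i) \<otimes> inv (g [^] j)" using nc g by (simp add: mult_inv_cancel)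
    also have "\<dots> = inv n \<otimes> n'" unfolding n'(2) using nc g by (simp add: m_assoc)
    finally have "g [^] (i - j) \<in> N"
      using subgroup.m_closed[OF sN subgroup.m_inv_closed[OF sN n] n'(1)] by simp
    then show "j = i" using gi by fastforce
  qed (use n in blast)
  have mult: "c (x \<otimes> y) = c x + c y" if xy: "x \<in> M" "y \<in> M" for x y
  proof -
    obtain n n' and i j :: int where e: "n \<in> N" "n' \<in> N" "x = n \<otimes> g [^] i" "y = n' \<otimes> g [^] j"
      using xy memM by metis
    note nc = normal_mem[OF N e(1)] normal_mem[OF N e(2)]
    have "x \<otimes> y = (n \<otimes> (g [^] i \<otimes> n' \<otimes> inv (g [^] i))) \<otimes> g [^] (i + j)"
      using nc g by (simp add: e(3,4) m_assoc mult_inv_cancel int_pow_mult)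
    moreover have "n \<otimes> (g [^] i \<otimes> n' \<otimes> inv (g [^] i)) \<in> N"
      using subgroup.m_closed[OF sN e(1) normal_conj[OF N _ e(2)]] g by simp
    ultimately show ?thesis using c_eq e by simp
  qed
  \<comment> \<open>Since \<open>g\<close> is central modulo \<open>N\<close>, conjugation changes
    it only by a factor in \<open>N\<close>, which \<open>c\<close> ignores. This is what later
    makes \<open>g\<close> act as a scalar.\<close>
  have conj: "inv h \<otimes> g \<otimes> h \<in> M \<and> c (inv h \<otimes> g \<otimes> h) = 1" if h: "h \<in> carrier G" for h
  proof -
    have "commutator g (inv h) \<in> N" using gc h by simp
    from subgroup.m_inv_closed[OF sN this] have n: "commutator (inv h) g \<in> N"
      using inv_commutator[OF g, of "inv h"] h by simp
    have "inv h \<otimes> g \<otimes> h = commutator (inv h) g \<otimes> g [^] (1::int)"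
      using conj_eq_commutator[of "inv h" g] h g by simp
    then show ?thesis using memM n c_eq[OF n] by auto
  qed
  show thesis
    by (rule that[OF normal_subgroup[OF M(1)] mult conj nilpotent_rel_folner[OF nil M(1)]])
qed

end

lemma locally_nilpotent_not_periodic:
  assumes G: "group G" and nil: "locally_nilpotent G" and fin: "\<not> locally_finite G"
  shows "\<not> periodic_group G"
proof
  assume per: "periodic_group G"
  interpret group G by (rule G)
  obtain S where S: "S \<subseteq> carrier G" "finite S" "infinite (generate G S)"
    using fin by (auto simp: locally_finite_def)
  define K where "K = G\<lparr>carrier := generate G S\<rparr>"
  have sub: "subgroup (generate G S) G" by (rule generate_is_subgroup[OF S(1)])
  interpret K: group K unfolding K_def by (rule subgroup_imp_group[OF sub])
  have "periodic_group K"
    unfolding periodic_group_def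
  proof
    fix x assume x: "x \<in> carrier K"
    then have xG: "x \<in> carrier G" using subgroup.mem_carrier[OF sub] by (simp add: K_def)
    have "x [^]\<^bsub>K\<^esub> ord x = \<one>\<^bsub>K\<^esub>"
      using nat_pow_consistent[of x "ord x" "generate G S"] pow_ord_eq_1[OF xG] by (simp add: K_def)
    moreover have "ord x \<noteq> 0" using per xG by (simp add: periodic_group_def)
    ultimately show "K.ord x \<noteq> 0" using K.pow_eq_id[OF x, of "ord x"] by auto
  qed
  moreover have "nilpotent_group K" using nil S by (simp add: locally_nilpotent_def K_def)
  moreover have "S \<subseteq> carrier K" by (auto simp: K_def intro: generate.incl)
  moreover have "generate K S = carrier K"
    using generate_consistent[of S "generate G S"] sub by (auto simp: K_def intro: generate.incl)
  ultimately have "finite (carrier K)"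
    using K.finitely_generated_periodic_nilpotent_finite S(2) by blast
  then show False using S(3) by (simp add: K_def)
qed

section \<open>The group algebra and its full norm\<close>

abbreviation supp :: "('x \<Rightarrow> 'y::zero) \<Rightarrow> 'x set" where "supp f \<equiv> {x. f x \<noteq> 0}"

context group
begin

abbreviation "CG \<equiv> group_algebra G"

abbreviation conv (infixl "\<star>" 70) where "f \<star> h \<equiv> f \<otimes>\<^bsub>CG\<^esub> h"
abbreviation "oneCG \<equiv> \<one>\<^bsub>CG\<^esub>"

lemma CG_carrier: "f \<in> carrier CG \<longleftrightarrow> finite (supp f) \<and> supp f \<subseteq> carrier G"
  by (simp add: group_algebra_def)

lemma CG_zero: "\<zero>\<^bsub>CG\<^esub> = (\<lambda>x. 0)" and CG_one: "oneCG = (\<lambda>x. if x = \<one> then 1 else 0)"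
  and CG_add: "f \<oplus>\<^bsub>CG\<^esub> h = (\<lambda>x. f x + h x)"
  and CG_mult: "f \<star> h =
    (\<lambda>x. if x \<in> carrier G then \<Sum>y | f y \<noteq> 0. f y * h (inv y \<otimes> x) else 0)"
  by (simp_all add: group_algebra_def)

lemma CG_finite: "f \<in> carrier CG \<Longrightarrow> finite (supp f)"
  and CG_supp: "\<lbrakk>f \<in> carrier CG; f g \<noteq> 0\<rbrakk> \<Longrightarrow> g \<in> carrier G"
  by (auto simp: CG_carrier)

lemma CG_comb_closed:
  assumes "f \<in> carrier CG" "h \<in> carrier CG"
  shows "(\<lambda>x. c * f x + d * h x) \<in> carrier CG"
proof -
  have "{x. c * f x + d * h x \<noteq> 0} \<subseteq> supp f \<union> supp h" by auto
  then show ?thesis using assms finite_subset unfolding CG_carrier by (meson finite_UnI le_sup_iff order_trans)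
qed

lemma CG_closed:
  assumes "f \<in> carrier CG" "h \<in> carrier CG"
  shows "(\<lambda>x. f x + h x) \<in> carrier CG" "(\<lambda>x. f x - h x) \<in> carrier CG"
    "(\<lambda>x. c * f x) \<in> carrier CG" "(\<lambda>x. - f x) \<in> carrier CG"
  using CG_comb_closed[OF assms, of 1 1] CG_comb_closed[OF assms, of 1 "-1"]
    CG_comb_closed[OF assms, of c 0] CG_comb_closed[OF assms, of "-1" 0] by simp_all

lemma CG_zero_closed: "(\<lambda>x. 0) \<in> carrier CG"
  by (simp add: CG_carrier)

lemma CG_delta_closed: "g \<in> carrier G \<Longrightarrow> (\<lambda>x. if x = g then c else 0) \<in> carrier CG"
  by (auto simp: CG_carrier)

lemma CG_one_closed: "oneCG \<in> carrier CG"
  by (simp add: CG_one CG_delta_closed)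

lemma CG_mult_supp:
  assumes f: "f \<in> carrier CG" and h: "h \<in> carrier CG"
  shows "{x. (f \<star> h) x \<noteq> 0} \<subseteq> (\<lambda>(y, z). y \<otimes> z) ` (supp f \<times> supp h)"
proof
  fix x assume "x \<in> {x. (f \<star> h) x \<noteq> 0}"
  then have x: "x \<in> carrier G" and "(\<Sum>y | f y \<noteq> 0. f y * h (inv y \<otimes> x)) \<noteq> 0"
    by (auto simp: CG_mult split: if_splits)
  then obtain y where y: "f y \<noteq> 0" "h (inv y \<otimes> x) \<noteq> 0"
    by (metis (mono_tags, lifting) mem_Collect_eq mult_zero_right sum.neutral)
  have yc: "y \<in> carrier G" by (rule CG_supp[OF f y(1)])
  have "x = y \<otimes> (inv y \<otimes> x)" using x yc by (simp flip: m_assoc)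
  then show "x \<in> (\<lambda>(y, z). y \<otimes> z) ` (supp f \<times> supp h)"
    using y by (intro image_eqI[of _ _ "(y, inv y \<otimes> x)"]) auto
qed

lemma CG_mult_closed:
  assumes f: "f \<in> carrier CG" and h: "h \<in> carrier CG"
  shows "f \<star> h \<in> carrier CG"
proof -
  have "finite ((\<lambda>(y, z). y \<otimes> z) ` (supp f \<times> supp h))"
    using CG_finite assms by auto
  then have "finite {x. (f \<star> h) x \<noteq> 0}" using CG_mult_supp[OF assms] by (rule finite_subset[rotated])
  then show ?thesis by (auto simp: CG_carrier CG_mult)
qed

text \<open>The substitution \<open>x = y \<otimes> z\<close> in a convolution, for values
  \<open>V\<close> in any vector space: scalar values yield associativity, vectors
  \<open>U g \<xi>\<close> yield multiplicativity of representations. \<open>P\<close> is a common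
  finite domain holding all products, over which the sums can be exchanged.\<close>

lemma (in vector_space) CG_mult_sum:
  fixes G :: "('c, 'd) monoid_scheme" (structure) and f h :: "'c \<Rightarrow> 'a" and V :: "'c \<Rightarrow> 'b"
  assumes "group G" and f: "finite (supp f)" "supp f \<subseteq> carrier G"
    and h: "finite (supp h)" "supp h \<subseteq> carrier G"
    and k: "\<And>x. k x = (if x \<in> carrier G then \<Sum>y | f y \<noteq> 0. f y * h (inv y \<otimes> x) else 0)"
    and P: "finite P" "supp k \<subseteq> P" "(\<lambda>(y, z). y \<otimes> z) ` (supp f \<times> supp h) \<subseteq> P" "P \<subseteq> carrier G"
  shows "(\<Sum>x | k x \<noteq> 0. scale (k x) (V x)) =
    (\<Sum>y | f y \<noteq> 0. \<Sum>z | h z \<noteq> 0. scale (f y * h z) (V (y \<otimes> z)))"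
proof -
  interpret group G by fact
  have "(\<Sum>x | k x \<noteq> 0. scale (k x) (V x)) = (\<Sum>x\<in>P. scale (k x) (V x))"
    using P by (intro sum.mono_neutral_left) auto
  also have "\<dots> = (\<Sum>x\<in>P. \<Sum>y | f y \<noteq> 0. scale (f y * h (inv y \<otimes> x)) (V x))"
    using P(4) by (intro sum.cong refl) (auto simp: k scale_sum_left)
  also have "\<dots> = (\<Sum>y | f y \<noteq> 0. \<Sum>x\<in>P. scale (f y * h (inv y \<otimes> x)) (V x))"
    by (rule sum.swap)
  also have "\<dots> = (\<Sum>y | f y \<noteq> 0. \<Sum>z | h z \<noteq> 0. scale (f y * h z) (V (y \<otimes> z)))"
  proof (rule sum.cong[OF refl])
    fix y assume "y \<in> supp f"
    then have y: "f y \<noteq> 0" "y \<in> carrier G" using f by auto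
    have inj: "inj_on (\<lambda>z. y \<otimes> z) (supp h)"
      using y h by (intro inj_onI) (auto simp: subset_iff)
    have "(\<Sum>x\<in>P. scale (f y * h (inv y \<otimes> x)) (V x)) =
        (\<Sum>x\<in>(\<lambda>z. y \<otimes> z) ` supp h. scale (f y * h (inv y \<otimes> x)) (V x))"
    proof (intro sum.mono_neutral_right P(1) ballI)
      show "(\<lambda>z. y \<otimes> z) ` supp h \<subseteq> P" using P(3) y by force
      fix x assume x: "x \<in> P - (\<lambda>z. y \<otimes> z) ` supp h"
      then have "x = y \<otimes> (inv y \<otimes> x)" using P(4) y by (auto simp flip: m_assoc)
      then have "h (inv y \<otimes> x) = 0" using x by blast
      then show "scale (f y * h (inv y \<otimes> x)) (V x) = 0" by simp
    qed
    also have "\<dots> = (\<Sum>z | h z \<noteq> 0. scale (f y * h (inv y \<otimes> (y \<otimes> z))) (V (y \<otimes> z)))"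
      by (simp add: sum.reindex[OF inj])
    also have "\<dots> = (\<Sum>z | h z \<noteq> 0. scale (f y * h z) (V (y \<otimes> z)))"
      using h y by (intro sum.cong refl) (auto simp flip: m_assoc)
    finally show "(\<Sum>x\<in>P. scale (f y * h (inv y \<otimes> x)) (V x)) =
      (\<Sum>z | h z \<noteq> 0. scale (f y * h z) (V (y \<otimes> z)))" .
  qed
  finally show ?thesis .
qed

lemma CG_mult_scale_sum:
  fixes scl :: "complex \<Rightarrow> 'h::ab_group_add \<Rightarrow> 'h"
  assumes "vector_space scl" and f: "f \<in> carrier CG" and h: "h \<in> carrier CG"
  shows "(\<Sum>x | (f \<star> h) x \<noteq> 0. scl ((f \<star> h) x) (V x)) =
    (\<Sum>y | f y \<noteq> 0. \<Sum>z | h z \<noteq> 0. scl (f y * h z) (V (y \<otimes> z)))"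
  using f h CG_mult_supp[OF f h]
  by (intro vector_space.CG_mult_sum[OF assms(1) is_group,
        of _ _ _ "(\<lambda>(y, z). y \<otimes> z) ` (supp f \<times> supp h)"])
     (auto simp: CG_carrier CG_mult)

lemma complex_vector_space: "vector_space ((*) :: complex \<Rightarrow> complex \<Rightarrow> complex)"
  by unfold_locales (auto simp: algebra_simps)

lemma CG_mult_superset:
  assumes "f \<in> carrier CG" "finite P" "supp f \<subseteq> P" "x \<in> carrier G"
  shows "(f \<star> h) x = (\<Sum>y\<in>P. f y * h (inv y \<otimes> x))"
  using assms by (auto simp: CG_mult intro!: sum.mono_neutral_left)

lemma ring_CG: "ring CG"
proof (rule ringI)
  show "abelian_group CG"
  proof (rule abelian_groupI)
    fix f assume f: "f \<in> carrier CG"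
    then show "\<exists>y\<in>carrier CG. y \<oplus>\<^bsub>CG\<^esub> f = \<zero>\<^bsub>CG\<^esub>"
      using CG_closed(4)[OF f f] by (auto simp: CG_add CG_zero intro!: bexI[of _ "\<lambda>x. - f x"])
  qed (auto simp: CG_add CG_zero CG_closed CG_zero_closed add.commute add.left_commute add.assoc)
  show "monoid CG"
  proof (rule monoidI)
    fix f h k assume f: "f \<in> carrier CG" and h: "h \<in> carrier CG" and k: "k \<in> carrier CG"
    show "f \<star> h \<in> carrier CG" by (rule CG_mult_closed[OF f h])
    show "(f \<star> h) \<star> k = f \<star> (h \<star> k)"
    proof
      fix x
      show "((f \<star> h) \<star> k) x = (f \<star> (h \<star> k)) x"
      proof (cases "x \<in> carrier G")
        case x: True
        have "((f \<star> h) \<star> k) x = (\<Sum>w | (f \<star> h) w \<noteq> 0. (f \<star> h) w * k (inv w \<otimes> x))"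
          using x by (subst CG_mult) simp
        also have "\<dots> = (\<Sum>y | f y \<noteq> 0. \<Sum>z | h z \<noteq> 0. f y * h z * k (inv (y \<otimes> z) \<otimes> x))"
          by (rule CG_mult_scale_sum[OF complex_vector_space f h])
        also have "\<dots> = (\<Sum>y | f y \<noteq> 0. f y * (\<Sum>z | h z \<noteq> 0. h z * k (inv z \<otimes> (inv y \<otimes> x))))"
          using x CG_supp[OF f] CG_supp[OF h]
          by (intro sum.cong refl) (auto simp: sum_distrib_left inv_mult_group m_assoc mult.assoc intro!: sum.cong)
        also have "\<dots> = (\<Sum>y | f y \<noteq> 0. f y * (h \<star> k) (inv y \<otimes> x))"
          using x CG_supp[OF f] by (intro sum.cong refl) (auto simp: CG_mult)
        finally show ?thesis using x by (simp add: CG_mult[of f])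
      qed (simp add: CG_mult)
    qed
  next
    fix f assume f: "f \<in> carrier CG"
    show "oneCG \<star> f = f"
    proof
      fix x
      have "supp oneCG = {\<one>}" by (auto simp: CG_one)
      then show "(oneCG \<star> f) x = f x"
        using CG_supp[OF f, of x] by (auto simp: CG_mult CG_one)
    qed
    show "f \<star> oneCG = f"
    proof
      fix x
      show "(f \<star> oneCG) x = f x"
      proof (cases "x \<in> carrier G")
        case x: True
        have "(f \<star> oneCG) x = (\<Sum>y | f y \<noteq> 0. if y = x then f y else 0)"
          using x CG_supp[OF f] inv_equality l_inv inv_solve_left'[of _ x \<one>]
          by (simp add: CG_mult CG_one) (intro sum.cong, auto simp: inv_solve_left')
        also have "\<dots> = f x" using CG_finite[OF f] by simp
        finally show ?thesis .
      qed (use CG_supp[OF f, of x] in \<open>auto simp: CG_mult\<close>)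
    qed
  qed (rule CG_one_closed)
next
  fix f h k assume f: "f \<in> carrier CG" and h: "h \<in> carrier CG" and k: "k \<in> carrier CG"
  define P where "P = supp f \<union> supp h"
  have P: "finite P" "supp f \<subseteq> P" "supp h \<subseteq> P" "{y. f y + h y \<noteq> 0} \<subseteq> P"
    using CG_finite[OF f] CG_finite[OF h] by (auto simp: P_def)
  show "(f \<oplus>\<^bsub>CG\<^esub> h) \<star> k = (f \<star> k) \<oplus>\<^bsub>CG\<^esub> (h \<star> k)"
  proof
    fix x
    show "((f \<oplus>\<^bsub>CG\<^esub> h) \<star> k) x = ((f \<star> k) \<oplus>\<^bsub>CG\<^esub> (h \<star> k)) x"
    proof (cases "x \<in> carrier G")
      case x: True
      show ?thesis
        unfolding CG_add
        by (simp add: CG_mult_superset[OF f P(1,2) x] CG_mult_superset[OF h P(1,3) x]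
            CG_mult_superset[OF CG_closed(1)[OF f h] P(1,4) x] ring_distribs sum.distrib)
    qed (simp add: CG_mult CG_add)
  qed
  show "k \<star> (f \<oplus>\<^bsub>CG\<^esub> h) = (k \<star> f) \<oplus>\<^bsub>CG\<^esub> (k \<star> h)"
    by (auto simp: CG_mult CG_add ring_distribs sum.distrib fun_eq_iff)
qed

lemma CG_minus: assumes "f \<in> carrier CG" "h \<in> carrier CG" shows "f \<ominus>\<^bsub>CG\<^esub> h = (\<lambda>x. f x - h x)"
proof -
  interpret R: ring CG by (rule ring_CG)
  have "\<ominus>\<^bsub>CG\<^esub> h = (\<lambda>x. - h x)"
    using CG_closed(4)[OF assms(2,2)] assms(2)
    by (intro R.minus_equality) (auto simp: CG_add CG_zero)
  then show ?thesis by (simp add: a_minus_def CG_add)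
qed

abbreviation "adjCG \<equiv> group_algebra_adj G"

lemma adj_supp: assumes "f \<in> carrier CG" shows "{x. adjCG f x \<noteq> 0} = (\<lambda>x. inv x) ` supp f"
proof -
  have "x \<in> (\<lambda>x. inv x) ` supp f" if "x \<in> carrier G" "f (inv x) \<noteq> 0" for x
    using that by (intro image_eqI[of _ _ "inv x"]) auto
  then show ?thesis using CG_supp[OF assms] by (auto simp: group_algebra_adj_def)
qed

lemma adj_closed: assumes "f \<in> carrier CG" shows "adjCG f \<in> carrier CG"
proof -
  have "{x. adjCG f x \<noteq> 0} \<subseteq> carrier G" by (auto simp: group_algebra_adj_def)
  then show ?thesis using adj_supp[OF assms] CG_finite[OF assms] by (simp add: CG_carrier[of "adjCG f"])
qed

text \<open>The zero space makes the set under the supremum in \<open>full_norm\<close> nonempty and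
  gives the norm its lower bound 0.\<close>

lemma trivial_unitary_rep: "unitary_rep fun_scale {0} (\<lambda>_ _. 0) G (\<lambda>_ x. x :: 'a \<Rightarrow> complex)"
proof -
  interpret F: vector_space "fun_scale :: complex \<Rightarrow> ('a \<Rightarrow> complex) \<Rightarrow> _"
    by unfold_locales (auto simp: fun_eq_iff algebra_simps)
  show ?thesis
    by unfold_locales (auto simp: F.subspace_def fun_eq_iff)
qed

lemma full_norm_least:
  assumes "\<And>(H :: ('a \<Rightarrow> complex) set) ip U \<xi>. \<lbrakk>unitary_rep fun_scale H ip G U; \<xi> \<in> H; sqrt (Re (ip \<xi> \<xi>)) \<le> 1\<rbrakk>
    \<Longrightarrow> sqrt (Re (ip (rep_apply fun_scale U f \<xi>) (rep_apply fun_scale U f \<xi>))) \<le> C"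
  shows "full_norm G f \<le> C"
  unfolding full_norm_def
proof (rule cSup_least)
  show "{sqrt (Re (ip (rep_apply fun_scale U f \<xi>) (rep_apply fun_scale U f \<xi>))) |
      (H :: ('a \<Rightarrow> complex) set) ip U \<xi>.
      unitary_rep fun_scale H ip G U \<and> \<xi> \<in> H \<and> sqrt (Re (ip \<xi> \<xi>)) \<le> 1} \<noteq> {}"
    using trivial_unitary_rep by force
qed (use assms in blast)

lemma full_norm_nonneg: assumes "f \<in> carrier CG" shows "0 \<le> full_norm G f"
proof -
  interpret unitary_rep fun_scale "{0}" "\<lambda>_ _. 0" G "\<lambda>_ x. x :: 'a \<Rightarrow> complex"
    by (rule trivial_unitary_rep)
  show ?thesis using rep_norm_le_full_norm[OF assms, of 0] by simp
qed

end

section \<open>Unitary representations of the group algebra\<close>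

context unitary_rep
begin

lemma U_zero: "g \<in> carrier G \<Longrightarrow> U g 0 = 0"
  using U_scale[of g 0 0] H_closed(1) by simp

lemma U_sum: "\<lbrakk>g \<in> carrier G; \<And>i. i \<in> I \<Longrightarrow> x i \<in> H\<rbrakk> \<Longrightarrow> U g (sum x I) = (\<Sum>i\<in>I. U g (x i))"
proof (induction I rule: infinite_finite_induct)
  case (insert i I)
  then show ?case using U_add[of g "x i" "sum x I"] sum_H[of I x] by simp
qed (simp_all add: U_zero)

lemma ip_sum_left: "\<lbrakk>y \<in> H; \<And>i. i \<in> I \<Longrightarrow> x i \<in> H\<rbrakk> \<Longrightarrow> ip (sum x I) y = (\<Sum>i\<in>I. ip (x i) y)"
proof (induction I rule: infinite_finite_induct)
  case (insert i I)
  then show ?case using ip_add_left[of y "x i" "sum x I"] sum_H[of I x] by simp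
qed (simp_all add: ip_zero)

lemma ip_sum_right: "\<lbrakk>y \<in> H; \<And>i. i \<in> I \<Longrightarrow> x i \<in> H\<rbrakk> \<Longrightarrow> ip y (sum x I) = (\<Sum>i\<in>I. ip y (x i))"
proof (induction I rule: infinite_finite_induct)
  case (insert i I)
  then show ?case using ip_add[of y "x i" "sum x I"] sum_H[of I x] by simp
qed (simp_all add: ip_zero)

lemma rep_apply_superset:
  assumes "finite P" "supp f \<subseteq> P"
  shows "rep_apply scale U f \<xi> = (\<Sum>g\<in>P. f g *s U g \<xi>)"
  unfolding rep_apply_def using assms by (intro sum.mono_neutral_left) auto

lemma term_H: "\<lbrakk>f \<in> carrier CG; f g \<noteq> 0; \<xi> \<in> H\<rbrakk> \<Longrightarrow> c *s U g \<xi> \<in> H"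
  using CG_supp U_closed H_closed by blast

lemma rep_apply_mult:
  assumes f: "f \<in> carrier CG" and h: "h \<in> carrier CG" and \<xi>: "\<xi> \<in> H"
  shows "rep_apply scale U (f \<star> h) \<xi> = rep_apply scale U f (rep_apply scale U h \<xi>)"
proof -
  have "rep_apply scale U (f \<star> h) \<xi> =
      (\<Sum>y | f y \<noteq> 0. \<Sum>z | h z \<noteq> 0. (f y * h z) *s U (y \<otimes> z) \<xi>)"
    unfolding rep_apply_def by (rule CG_mult_scale_sum[OF vector_space_axioms f h])
  also have "\<dots> = (\<Sum>y | f y \<noteq> 0. f y *s (\<Sum>z | h z \<noteq> 0. U y (h z *s U z \<xi>)))"
    using CG_supp[OF f] CG_supp[OF h] \<xi>
    by (intro sum.cong refl) (auto simp: scale_sum_right U_mult U_scale U_closed intro!: sum.cong)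
  also have "\<dots> = (\<Sum>y | f y \<noteq> 0. f y *s U y (rep_apply scale U h \<xi>))"
  proof (rule sum.cong[OF refl])
    fix y assume "y \<in> supp f"
    then have y: "y \<in> carrier G" using CG_supp[OF f] by simp
    have "U y (rep_apply scale U h \<xi>) = (\<Sum>z | h z \<noteq> 0. U y (h z *s U z \<xi>))"
      unfolding rep_apply_def using term_H[OF h _ \<xi>] by (intro U_sum y) simp
    then show "f y *s (\<Sum>z | h z \<noteq> 0. U y (h z *s U z \<xi>)) = f y *s U y (rep_apply scale U h \<xi>)" by simp
  qed
  finally show ?thesis by (simp add: rep_apply_def)
qed

lemma rep_apply_add:
  assumes f: "f \<in> carrier CG" and h: "h \<in> carrier CG"
  shows "rep_apply scale U (\<lambda>x. f x + h x) \<xi> = rep_apply scale U f \<xi> + rep_apply scale U h \<xi>"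
proof -
  define P where "P = supp f \<union> supp h"
  have P: "finite P" "supp f \<subseteq> P" "supp h \<subseteq> P" "{y. f y + h y \<noteq> 0} \<subseteq> P"
    using CG_finite[OF f] CG_finite[OF h] by (auto simp: P_def)
  show ?thesis
    by (simp add: rep_apply_superset[OF P(1,2)] rep_apply_superset[OF P(1,3)]
        rep_apply_superset[OF P(1,4)] scale_left_distrib sum.distrib)
qed

lemma rep_apply_scale:
  "rep_apply scale U (\<lambda>x. c * f x) \<xi> = c *s rep_apply scale U f \<xi>"
  by (cases "c = 0") (auto simp: rep_apply_def scale_sum_right)

lemma rep_apply_diff:
  assumes "f \<in> carrier CG" "h \<in> carrier CG"
  shows "rep_apply scale U (\<lambda>x. f x - h x) \<xi> = rep_apply scale U f \<xi> - rep_apply scale U h \<xi>"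
  using rep_apply_add[OF assms(1) CG_closed(3)[OF assms(2,2), of "-1"], of \<xi>] rep_apply_scale[of "-1" h \<xi>]
  by simp

lemma rep_apply_arg_scale:
  assumes f: "f \<in> carrier CG" and \<xi>: "\<xi> \<in> H"
  shows "rep_apply scale U f (c *s \<xi>) = c *s rep_apply scale U f \<xi>"
  unfolding rep_apply_def scale_sum_right
  using CG_supp[OF f] \<xi> by (intro sum.cong refl) (auto simp: U_scale mult.commute)

lemma rep_apply_arg_add:
  assumes f: "f \<in> carrier CG" and "\<xi> \<in> H" "\<eta> \<in> H"
  shows "rep_apply scale U f (\<xi> + \<eta>) = rep_apply scale U f \<xi> + rep_apply scale U f \<eta>"
  unfolding rep_apply_def sum.distrib[symmetric]
  using CG_supp[OF f] assms by (intro sum.cong refl) (auto simp: U_add scale_right_distrib)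

lemma rep_apply_delta:
  assumes "g \<in> carrier G"
  shows "rep_apply scale U (\<lambda>x. if x = g then 1 else 0) \<xi> = U g \<xi>"
  using rep_apply_superset[of "{g}" "\<lambda>x. if x = g then 1 else 0" \<xi>] by (auto split: if_splits)

lemma rep_apply_one: "\<xi> \<in> H \<Longrightarrow> rep_apply scale U oneCG \<xi> = \<xi>"
  by (simp add: CG_one rep_apply_delta U_one)

lemma U_adj:
  assumes "g \<in> carrier G" "\<xi> \<in> H" "\<eta> \<in> H" shows "ip (U g \<xi>) \<eta> = ip \<xi> (U (inv g) \<eta>)"
  using U_ip[of "inv g" "U g \<xi>" \<eta>] assms U_mult[of "inv g" g \<xi>] U_one U_closed by simp

lemma rep_apply_adj:
  assumes f: "f \<in> carrier CG" and \<xi>: "\<xi> \<in> H" and \<eta>: "\<eta> \<in> H"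
  shows "ip (rep_apply scale U f \<xi>) \<eta> = ip \<xi> (rep_apply scale U (adjCG f) \<eta>)"
proof -
  note s = CG_supp[OF f]
  have inj: "inj_on (\<lambda>x. inv x) (supp f)"
    using s by (intro inj_onI) (auto simp: inv_eq_imp_eq)
  have "ip (rep_apply scale U f \<xi>) \<eta> = (\<Sum>g | f g \<noteq> 0. cnj (f g) * ip \<xi> (U (inv g) \<eta>))"
  proof -
    have "ip (rep_apply scale U f \<xi>) \<eta> = (\<Sum>g | f g \<noteq> 0. ip (f g *s U g \<xi>) \<eta>)"
      unfolding rep_apply_def using term_H[OF f _ \<xi>] by (intro ip_sum_left \<eta>) simp
    also have "\<dots> = (\<Sum>g | f g \<noteq> 0. cnj (f g) * ip \<xi> (U (inv g) \<eta>))"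
      using s by (intro sum.cong refl) (simp add: ip_scale_left \<xi> \<eta> U_closed U_adj)
    finally show ?thesis .
  qed
  also have "\<dots> = (\<Sum>g | f g \<noteq> 0. adjCG f (inv g) * ip \<xi> (U (inv g) \<eta>))"
    using s by (intro sum.cong refl) (auto simp: group_algebra_adj_def)
  also have "\<dots> = (\<Sum>g | adjCG f g \<noteq> 0. adjCG f g * ip \<xi> (U g \<eta>))"
    by (simp add: adj_supp[OF f] sum.reindex[OF inj])
  also have "\<dots> = ip \<xi> (rep_apply scale U (adjCG f) \<eta>)"
  proof -
    have "ip \<xi> (rep_apply scale U (adjCG f) \<eta>) = (\<Sum>g | adjCG f g \<noteq> 0. ip \<xi> (adjCG f g *s U g \<eta>))"
      unfolding rep_apply_def using term_H[OF adj_closed[OF f] _ \<eta>] by (intro ip_sum_right \<xi>) simp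
    also have "\<dots> = (\<Sum>g | adjCG f g \<noteq> 0. adjCG f g * ip \<xi> (U g \<eta>))"
      using CG_supp[OF adj_closed[OF f]] by (intro sum.cong refl) (simp add: ip_scale \<xi> \<eta> U_closed)
    finally show ?thesis by simp
  qed
  finally show ?thesis .
qed

lemma hnorm_eq_0: "\<lbrakk>x \<in> H; hnorm x = 0\<rbrakk> \<Longrightarrow> x = 0"
  using ip_self[of x] ip_definite[of x] by simp

lemma hnorm_zero: "hnorm 0 = 0"
  using ip_zero[OF H_closed(1)] by (simp add: hnorm_def)

text \<open>\<open>rep_norm_le_full_norm\<close>, made homogeneous by scaling to a unit vector. The
  Hilbert space may have any type, which is essential later: the tensor powers consist of functions
  on lists.\<close>

lemma hnorm_rep_apply_le_full_norm:
  assumes f: "f \<in> carrier CG" and \<xi>: "\<xi> \<in> H"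
  shows "hnorm (rep_apply scale U f \<xi>) \<le> full_norm G f * hnorm \<xi>"
proof (cases "hnorm \<xi> = 0")
  case True
  then have "\<xi> = 0" using hnorm_eq_0 \<xi> by blast
  then have "rep_apply scale U f \<xi> = 0"
    using rep_apply_arg_scale[OF f \<xi>, of 0] by simp
  then show ?thesis using True by (simp add: hnorm_zero)
next
  case False
  then have pos: "hnorm \<xi> > 0" using hnorm_ge0[OF \<xi>] by simp
  define \<zeta> where "\<zeta> = complex_of_real (1 / hnorm \<xi>) *s \<xi>"
  have \<zeta>: "\<zeta> \<in> H" "hnorm \<zeta> = 1"
    using \<xi> H_closed pos by (auto simp: \<zeta>_def hnorm_scale norm_divide)
  have "hnorm (rep_apply scale U f \<zeta>) \<le> full_norm G f"
    using rep_norm_le_full_norm[OF f \<zeta>(1)] \<zeta>(2) by (simp add: hnorm_def)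
  moreover have "hnorm (rep_apply scale U f \<zeta>) = hnorm (rep_apply scale U f \<xi>) / hnorm \<xi>"
    using rep_apply_H[OF f \<xi>] pos
    by (simp add: \<zeta>_def rep_apply_arg_scale[OF f \<xi>] hnorm_scale norm_divide)
  ultimately show ?thesis using pos by (simp add: field_simps)
qed

end

context group
begin

text \<open>The inequalities between full norms below are operator inequalities checked in each
  representation; the supremum is dealt with here once.\<close>

lemma full_norm_le:
  assumes "\<And>(H :: ('a \<Rightarrow> complex) set) ip U \<xi>. \<lbrakk>unitary_rep fun_scale H ip G U; \<xi> \<in> H\<rbrakk>
    \<Longrightarrow> complex_hilbert_space.hnorm ip (rep_apply fun_scale U f \<xi>) \<le> C * complex_hilbert_space.hnorm ip \<xi>"
    and "0 \<le> C"
  shows "full_norm G f \<le> C"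
proof (rule full_norm_least)
  fix H :: "('a \<Rightarrow> complex) set" and ip U \<xi>
  assume r: "unitary_rep fun_scale H ip G U" and \<xi>: "\<xi> \<in> H" "sqrt (Re (ip \<xi> \<xi>)) \<le> 1"
  interpret unitary_rep fun_scale H ip G U by (rule r)
  have "hnorm (rep_apply fun_scale U f \<xi>) \<le> C * hnorm \<xi>" by (rule assms(1)[OF r \<xi>(1)])
  also have "\<dots> \<le> C" using \<xi> assms(2) by (simp add: hnorm_def mult_left_le)
  finally show "sqrt (Re (ip (rep_apply fun_scale U f \<xi>) (rep_apply fun_scale U f \<xi>))) \<le> C"
    by (simp add: hnorm_def)
qed

lemma full_norm_add_le:
  assumes f: "f \<in> carrier CG" and h: "h \<in> carrier CG"
  shows "full_norm G (\<lambda>x. f x + h x) \<le> full_norm G f + full_norm G h"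
proof (rule full_norm_le)
  fix H :: "('a \<Rightarrow> complex) set" and ip U \<xi>
  assume r: "unitary_rep fun_scale H ip G U" and \<xi>: "\<xi> \<in> H"
  interpret unitary_rep fun_scale H ip G U by (rule r)
  have "hnorm (rep_apply fun_scale U (\<lambda>x. f x + h x) \<xi>) \<le>
      hnorm (rep_apply fun_scale U f \<xi>) + hnorm (rep_apply fun_scale U h \<xi>)"
    unfolding rep_apply_add[OF f h] by (intro hnorm_triangle rep_apply_H f h \<xi>)
  also have "\<dots> \<le> (full_norm G f + full_norm G h) * hnorm \<xi>"
    using hnorm_rep_apply_le_full_norm[OF f \<xi>] hnorm_rep_apply_le_full_norm[OF h \<xi>] by (simp add: ring_distribs)
  finally show "hnorm (rep_apply fun_scale U (\<lambda>x. f x + h x) \<xi>) \<le> (full_norm G f + full_norm G h) * hnorm \<xi>" .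
qed (simp add: full_norm_nonneg f h)

lemma full_norm_mult_le:
  assumes f: "f \<in> carrier CG" and h: "h \<in> carrier CG"
  shows "full_norm G (f \<star> h) \<le> full_norm G f * full_norm G h"
proof (rule full_norm_le)
  fix H :: "('a \<Rightarrow> complex) set" and ip U \<xi>
  assume r: "unitary_rep fun_scale H ip G U" and \<xi>: "\<xi> \<in> H"
  interpret unitary_rep fun_scale H ip G U by (rule r)
  have "hnorm (rep_apply fun_scale U (f \<star> h) \<xi>) \<le> full_norm G f * hnorm (rep_apply fun_scale U h \<xi>)"
    unfolding rep_apply_mult[OF f h \<xi>] by (intro hnorm_rep_apply_le_full_norm rep_apply_H f h \<xi>)
  also have "\<dots> \<le> full_norm G f * (full_norm G h * hnorm \<xi>)"
    by (intro mult_left_mono hnorm_rep_apply_le_full_norm full_norm_nonneg f h \<xi>)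
  finally show "hnorm (rep_apply fun_scale U (f \<star> h) \<xi>) \<le> full_norm G f * full_norm G h * hnorm \<xi>"
    by (simp add: mult.assoc)
qed (simp add: full_norm_nonneg f h)

lemma full_norm_scale_le:
  assumes f: "f \<in> carrier CG"
  shows "full_norm G (\<lambda>x. c * f x) \<le> norm c * full_norm G f"
proof (rule full_norm_le)
  fix H :: "('a \<Rightarrow> complex) set" and ip U \<xi>
  assume r: "unitary_rep fun_scale H ip G U" and \<xi>: "\<xi> \<in> H"
  interpret unitary_rep fun_scale H ip G U by (rule r)
  show "hnorm (rep_apply fun_scale U (\<lambda>x. c * f x) \<xi>) \<le> norm c * full_norm G f * hnorm \<xi>"
    using mult_left_mono[OF hnorm_rep_apply_le_full_norm[OF f \<xi>], of "norm c"]
    by (simp add: rep_apply_scale hnorm_scale[OF rep_apply_H[OF f \<xi>]] mult.assoc)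
qed (simp add: full_norm_nonneg f)

lemma full_norm_delta_le:
  assumes "g \<in> carrier G"
  shows "full_norm G (\<lambda>x. if x = g then 1 else 0) \<le> 1"
proof (rule full_norm_le)
  fix H :: "('a \<Rightarrow> complex) set" and ip U \<xi>
  assume r: "unitary_rep fun_scale H ip G U" and \<xi>: "\<xi> \<in> H"
  interpret unitary_rep fun_scale H ip G U by (rule r)
  show "hnorm (rep_apply fun_scale U (\<lambda>x. if x = g then 1 else 0) \<xi>) \<le> 1 * hnorm \<xi>"
    by (simp add: rep_apply_delta[OF assms] hnorm_U[OF assms \<xi>])
qed simp

text \<open>The squared norm of the adjoint's value \<eta> is the inner product of \<open>f\<close>
  applied to \<eta> with \<xi>; Cauchy-Schwarz then leaves one factor \<open>hnorm \<eta>\<close> to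
  cancel.\<close>

lemma full_norm_adj_le:
  assumes f: "f \<in> carrier CG"
  shows "full_norm G (adjCG f) \<le> full_norm G f"
proof (rule full_norm_le)
  fix H :: "('a \<Rightarrow> complex) set" and ip U \<xi>
  assume r: "unitary_rep fun_scale H ip G U" and \<xi>: "\<xi> \<in> H"
  interpret unitary_rep fun_scale H ip G U by (rule r)
  define \<eta> where "\<eta> = rep_apply fun_scale U (adjCG f) \<xi>"
  have \<eta>: "\<eta> \<in> H" unfolding \<eta>_def by (intro rep_apply_H adj_closed f \<xi>)
  have "ip \<eta> \<eta> = ip (rep_apply fun_scale U f \<eta>) \<xi>"
    unfolding rep_apply_adj[OF f \<eta> \<xi>] by (simp add: \<eta>_def)
  then have "of_real (hnorm \<eta> ^ 2) = ip (rep_apply fun_scale U f \<eta>) \<xi>"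
    using ip_self[OF \<eta>] by simp
  then have "hnorm \<eta> ^ 2 = norm (ip (rep_apply fun_scale U f \<eta>) \<xi>)"
    by (metis abs_of_nonneg norm_of_real zero_le_power2)
  also have "\<dots> \<le> hnorm (rep_apply fun_scale U f \<eta>) * hnorm \<xi>"
    by (intro Cauchy_Schwarz rep_apply_H f \<eta> \<xi>)
  also have "\<dots> \<le> full_norm G f * hnorm \<eta> * hnorm \<xi>"
    by (intro mult_right_mono hnorm_rep_apply_le_full_norm f \<eta> hnorm_ge0 \<xi>)
  finally have "hnorm \<eta> * hnorm \<eta> \<le> hnorm \<eta> * (full_norm G f * hnorm \<xi>)"
    by (simp add: power2_eq_square mult.commute mult.left_commute)
  then show "hnorm \<eta> \<le> full_norm G f * hnorm \<xi>"
    using hnorm_ge0[OF \<eta>] hnorm_ge0[OF \<xi>] full_norm_nonneg[OF f]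
    by (cases "hnorm \<eta> = 0") auto
qed (simp add: full_norm_nonneg f)

lemma full_norm_zero: "full_norm G (\<lambda>x. 0) = 0"
  using full_norm_scale_le[OF CG_zero_closed, of 0] full_norm_nonneg[OF CG_zero_closed] by simp

lemma full_norm_minus_commute:
  assumes f: "f \<in> carrier CG" and h: "h \<in> carrier CG"
  shows "full_norm G (\<lambda>x. f x - h x) = full_norm G (\<lambda>x. h x - f x)"
proof -
  have "full_norm G (\<lambda>x. f x - h x) \<le> full_norm G (\<lambda>x. h x - f x)"
    if "f \<in> carrier CG" "h \<in> carrier CG" for f h
    using full_norm_scale_le[OF CG_closed(2)[OF that(2,1)], of "-1"] by simp
  then show ?thesis using f h by (meson order_antisym)
qed

end

section \<open>The completion\<close>

context group
begin

abbreviation "CR \<equiv> cauchy_ring G"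
abbreviation "NI \<equiv> null_ideal G"
abbreviation "FC \<equiv> full_group_cstar G"
abbreviation "nm \<equiv> full_norm G"

lemma CR_carrier: "s \<in> carrier CR \<longleftrightarrow> (\<forall>n. s n \<in> carrier CG) \<and>
    (\<forall>e>0. \<exists>M. \<forall>m\<ge>M. \<forall>n\<ge>M. nm (\<lambda>x. s m x - s n x) < e)"
  by (simp add: cauchy_ring_def)

lemma CR_ops: "\<zero>\<^bsub>CR\<^esub> = (\<lambda>n x. 0)" "\<one>\<^bsub>CR\<^esub> = (\<lambda>n. oneCG)"
  "s \<oplus>\<^bsub>CR\<^esub> t = (\<lambda>n x. s n x + t n x)" "s \<otimes>\<^bsub>CR\<^esub> t = (\<lambda>n. s n \<star> t n)"
  by (simp_all add: cauchy_ring_def CG_zero CG_add)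

lemma CR_mem: "s \<in> carrier CR \<Longrightarrow> s n \<in> carrier CG"
  by (simp add: CR_carrier)

lemma CR_cauchy:
  "\<lbrakk>s \<in> carrier CR; e > 0\<rbrakk> \<Longrightarrow> \<exists>M. \<forall>m\<ge>M. \<forall>n\<ge>M. nm (\<lambda>x. s m x - s n x) < e"
  by (simp add: CR_carrier)

lemma nm_diff_abs:
  assumes f: "f \<in> carrier CG" and h: "h \<in> carrier CG"
  shows "\<bar>nm f - nm h\<bar> \<le> nm (\<lambda>x. f x - h x)"
  using full_norm_add_le[OF CG_closed(2)[OF f h] h] full_norm_add_le[OF CG_closed(2)[OF h f] f]
    full_norm_minus_commute[OF f h] by simp

lemma nm_convergent: assumes "s \<in> carrier CR" shows "convergent (\<lambda>n. nm (s n))"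
proof (rule Cauchy_convergent, rule metric_CauchyI)
  fix e :: real assume "e > 0"
  then obtain M where M: "\<forall>m\<ge>M. \<forall>n\<ge>M. nm (\<lambda>x. s m x - s n x) < e" using CR_cauchy[OF assms] by blast
  have "dist (nm (s m)) (nm (s n)) < e" if "m \<ge> M" "n \<ge> M" for m n
    using nm_diff_abs[OF CR_mem[OF assms, of m] CR_mem[OF assms, of n]] M that
    by (auto simp: dist_real_def intro: le_less_trans)
  then show "\<exists>M. \<forall>m\<ge>M. \<forall>n\<ge>M. dist (nm (s m)) (nm (s n)) < e" by blast
qed

lemma nm_bounded: assumes "s \<in> carrier CR" obtains B where "B > 0" "\<And>n. nm (s n) \<le> B"
proof -
  have "Bseq (\<lambda>n. nm (s n))" by (rule convergent_imp_Bseq[OF nm_convergent[OF assms]])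
  then show thesis using that unfolding Bseq_def by (metis abs_ge_self order_trans real_norm_def)
qed

text \<open>Serves scalar multiplication and the adjoint alike, both Lipschitz for the full
  norm.\<close>

lemma CR_Lipschitz:
  assumes F: "\<And>f. f \<in> carrier CG \<Longrightarrow> F f \<in> carrier CG"
    and L: "\<And>f h. \<lbrakk>f \<in> carrier CG; h \<in> carrier CG\<rbrakk> \<Longrightarrow> nm (\<lambda>x. F f x - F h x) \<le> K * nm (\<lambda>x. f x - h x)"
    and s: "s \<in> carrier CR"
  shows "(\<lambda>n. F (s n)) \<in> carrier CR"
  unfolding CR_carrier
proof (intro conjI allI impI)
  show "F (s n) \<in> carrier CG" for n using F CR_mem[OF s] by simp
  fix e :: real assume e: "e > 0"
  \<comment> \<open>\<open>\<bar>K\<bar> + 1\<close> keeps the divisor positive when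
    \<open>K\<close> is 0, as for scaling by 0.\<close>
  then have "e / (\<bar>K\<bar> + 1) > 0" by simp
  then obtain M where M: "\<forall>m\<ge>M. \<forall>n\<ge>M. nm (\<lambda>x. s m x - s n x) < e / (\<bar>K\<bar> + 1)"
    using CR_cauchy[OF s] by blast
  have "nm (\<lambda>x. F (s m) x - F (s n) x) < e" if mn: "m \<ge> M" "n \<ge> M" for m n
  proof -
    have nn: "0 \<le> nm (\<lambda>x. s m x - s n x)"
      by (intro full_norm_nonneg CG_closed CR_mem[OF s])
    have "nm (\<lambda>x. F (s m) x - F (s n) x) \<le> K * nm (\<lambda>x. s m x - s n x)"
      by (rule L[OF CR_mem[OF s] CR_mem[OF s]])
    also have "\<dots> \<le> (\<bar>K\<bar> + 1) * nm (\<lambda>x. s m x - s n x)" using nn by (intro mult_right_mono) auto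
    also have "\<dots> < e" using M mn by (simp add: field_simps)
    finally show ?thesis .
  qed
  then show "\<exists>M. \<forall>m\<ge>M. \<forall>n\<ge>M. nm (\<lambda>x. F (s m) x - F (s n) x) < e" by blast
qed

lemma CR_const: "f \<in> carrier CG \<Longrightarrow> (\<lambda>n. f) \<in> carrier CR"
  by (auto simp: CR_carrier full_norm_zero)

lemma CR_scale: assumes s: "s \<in> carrier CR" shows "(\<lambda>n x. c * s n x) \<in> carrier CR"
proof (rule CR_Lipschitz[where F = "fun_scale c" and K = "norm c", OF _ _ s])
  fix f h assume "f \<in> carrier CG" "h \<in> carrier CG"
  then show "nm (\<lambda>x. c * f x - c * h x) \<le> norm c * nm (\<lambda>x. f x - h x)"
    using full_norm_scale_le[OF CG_closed(2), of f h c] by (simp add: right_diff_distrib)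
qed (auto intro: CG_closed)

lemma adj_diff: "(\<lambda>x. adjCG f x - adjCG h x) = adjCG (\<lambda>x. f x - h x)"
  by (auto simp: group_algebra_adj_def)

lemma CR_adj: assumes s: "s \<in> carrier CR" shows "(\<lambda>n. adjCG (s n)) \<in> carrier CR"
proof (rule CR_Lipschitz[where F = adjCG and K = 1, OF _ _ s])
  fix f h assume "f \<in> carrier CG" "h \<in> carrier CG"
  then show "nm (\<lambda>x. adjCG f x - adjCG h x) \<le> 1 * nm (\<lambda>x. f x - h x)"
    using full_norm_adj_le[OF CG_closed(2), of f h] by (simp add: adj_diff)
qed (auto intro: adj_closed)

lemma CR_add:
  assumes s: "s \<in> carrier CR" and t: "t \<in> carrier CR"
  shows "(\<lambda>n x. s n x + t n x) \<in> carrier CR"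
  unfolding CR_carrier
proof (intro conjI allI impI)
  show "(\<lambda>x. s n x + t n x) \<in> carrier CG" for n
    by (intro CG_closed CR_mem s t)
  fix e :: real assume "e > 0"
  then have e: "e/2 > 0" by simp
  obtain M where M: "\<forall>m\<ge>M. \<forall>n\<ge>M. nm (\<lambda>x. s m x - s n x) < e/2" using CR_cauchy[OF s e] by blast
  obtain N where N: "\<forall>m\<ge>N. \<forall>n\<ge>N. nm (\<lambda>x. t m x - t n x) < e/2" using CR_cauchy[OF t e] by blast
  have "nm (\<lambda>x. (s m x + t m x) - (s n x + t n x)) < e" if "m \<ge> max M N" "n \<ge> max M N" for m n
  proof -
    have "nm (\<lambda>x. (s m x - s n x) + (t m x - t n x)) \<le> nm (\<lambda>x. s m x - s n x) + nm (\<lambda>x. t m x - t n x)"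
      by (intro full_norm_add_le CG_closed CR_mem s t)
    also have "\<dots> < e/2 + e/2" using M N that by (intro add_strict_mono) auto
    finally show ?thesis by (simp add: algebra_simps)
  qed
  then show "\<exists>M. \<forall>m\<ge>M. \<forall>n\<ge>M. nm (\<lambda>x. (s m x + t m x) - (s n x + t n x)) < e" by blast
qed

lemma CR_diff: "\<lbrakk>s \<in> carrier CR; t \<in> carrier CR\<rbrakk> \<Longrightarrow> (\<lambda>n x. s n x - t n x) \<in> carrier CR"
  using CR_add[OF _ CR_scale[of t "-1"], of s] by simp

lemma CG_mult_diff:
  assumes "f \<in> carrier CG" "h \<in> carrier CG" "k \<in> carrier CG"
  shows "f \<star> (\<lambda>x. h x - k x) = (\<lambda>x. (f \<star> h) x - (f \<star> k) x)"
    "(\<lambda>x. h x - k x) \<star> f = (\<lambda>x. (h \<star> f) x - (k \<star> f) x)"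
proof -
  interpret C: ring CG by (rule ring_CG)
  note CG_mult_closed[OF assms(1,2)] CG_mult_closed[OF assms(1,3)]
    CG_mult_closed[OF assms(2,1)] CG_mult_closed[OF assms(3,1)]
  then show "f \<star> (\<lambda>x. h x - k x) = (\<lambda>x. (f \<star> h) x - (f \<star> k) x)"
    "(\<lambda>x. h x - k x) \<star> f = (\<lambda>x. (h \<star> f) x - (k \<star> f) x)"
    using assms by (simp_all flip: CG_minus add: a_minus_def C.r_distr C.l_distr C.r_minus C.l_minus)
qed

lemma CR_mult:
  assumes s: "s \<in> carrier CR" and t: "t \<in> carrier CR"
  shows "(\<lambda>n. s n \<star> t n) \<in> carrier CR"
  unfolding CR_carrier
proof (intro conjI allI impI)
  show "s n \<star> t n \<in> carrier CG" for n
    by (intro CG_mult_closed CR_mem s t)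
  fix e :: real assume "e > 0"
  obtain B where B: "B > 0" "\<And>n. nm (s n) \<le> B" using nm_bounded[OF s] by blast
  obtain C where C: "C > 0" "\<And>n. nm (t n) \<le> C" using nm_bounded[OF t] by blast
  have e1: "e / (2*C) > 0" and e2: "e / (2*B) > 0" using \<open>e > 0\<close> B C by auto
  obtain M where M: "\<forall>m\<ge>M. \<forall>n\<ge>M. nm (\<lambda>x. s m x - s n x) < e / (2*C)" using CR_cauchy[OF s e1] by blast
  obtain N where N: "\<forall>m\<ge>N. \<forall>n\<ge>N. nm (\<lambda>x. t m x - t n x) < e / (2*B)" using CR_cauchy[OF t e2] by blast
  have "nm (\<lambda>x. (s m \<star> t m) x - (s n \<star> t n) x) < e" if mn: "m \<ge> max M N" "n \<ge> max M N" for m n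
  proof -
    note sm = CR_mem[OF s, of m] and sn = CR_mem[OF s, of n]
      and tm = CR_mem[OF t, of m] and tn = CR_mem[OF t, of n]
    note dt = CG_closed(2)[OF tm tn] and ds = CG_closed(2)[OF sm sn]
    have "(\<lambda>x. (s m \<star> t m) x - (s n \<star> t n) x) =
        (\<lambda>x. (s m \<star> (\<lambda>x. t m x - t n x)) x + ((\<lambda>x. s m x - s n x) \<star> t n) x)"
      by (simp add: CG_mult_diff(1)[OF sm tm tn] CG_mult_diff(2)[OF tn sm sn])
    then have "nm (\<lambda>x. (s m \<star> t m) x - (s n \<star> t n) x) \<le>
        nm (s m \<star> (\<lambda>x. t m x - t n x)) + nm ((\<lambda>x. s m x - s n x) \<star> t n)"
      using full_norm_add_le[OF CG_mult_closed[OF sm dt] CG_mult_closed[OF ds tn]] by simp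
    also have "\<dots> \<le> nm (s m) * nm (\<lambda>x. t m x - t n x) + nm (\<lambda>x. s m x - s n x) * nm (t n)"
      by (intro add_mono full_norm_mult_le sm dt ds tn)
    also have "\<dots> \<le> B * nm (\<lambda>x. t m x - t n x) + nm (\<lambda>x. s m x - s n x) * C"
      using full_norm_nonneg[OF dt] full_norm_nonneg[OF ds] full_norm_nonneg[OF tn] B C by (intro add_mono mult_mono) auto
    also have "\<dots> < B * (e / (2*B)) + e / (2*C) * C"
      using M N mn B C by (intro add_strict_mono mult_strict_left_mono mult_strict_right_mono) auto
    also have "\<dots> = e" using B C by simp
    finally show ?thesis .
  qed
  then show "\<exists>M. \<forall>m\<ge>M. \<forall>n\<ge>M. nm (\<lambda>x. (s m \<star> t m) x - (s n \<star> t n) x) < e" by blast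
qed

lemma ring_CR: "ring CR"
proof (rule ringI)
  interpret C: ring CG by (rule ring_CG)
  show "abelian_group CR"
  proof (rule abelian_groupI)
    fix s assume s: "s \<in> carrier CR"
    then show "\<exists>t\<in>carrier CR. t \<oplus>\<^bsub>CR\<^esub> s = \<zero>\<^bsub>CR\<^esub>"
      using CR_scale[OF s, of "-1"] by (intro bexI[of _ "\<lambda>n x. -1 * s n x"]) (auto simp: CR_ops)
  qed (auto simp: CR_ops CR_add CR_const CG_zero_closed add.commute add.left_commute add.assoc)
  show "monoid CR"
    by (rule monoidI)
       (auto simp: CR_ops CR_mult CR_const CG_one_closed C.m_assoc CR_mem)
  fix s t u assume stu: "s \<in> carrier CR" "t \<in> carrier CR" "u \<in> carrier CR"
  have "(s n \<oplus>\<^bsub>CG\<^esub> t n) \<star> u n = (s n \<star> u n) \<oplus>\<^bsub>CG\<^esub> (t n \<star> u n)"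
    "u n \<star> (s n \<oplus>\<^bsub>CG\<^esub> t n) = (u n \<star> s n) \<oplus>\<^bsub>CG\<^esub> (u n \<star> t n)" for n
    using CR_mem[OF stu(1), of n] CR_mem[OF stu(2), of n] CR_mem[OF stu(3), of n]
    by (simp_all add: C.l_distr C.r_distr)
  then show "(s \<oplus>\<^bsub>CR\<^esub> t) \<otimes>\<^bsub>CR\<^esub> u = (s \<otimes>\<^bsub>CR\<^esub> u) \<oplus>\<^bsub>CR\<^esub> (t \<otimes>\<^bsub>CR\<^esub> u)"
    "u \<otimes>\<^bsub>CR\<^esub> (s \<oplus>\<^bsub>CR\<^esub> t) = (u \<otimes>\<^bsub>CR\<^esub> s) \<oplus>\<^bsub>CR\<^esub> (u \<otimes>\<^bsub>CR\<^esub> t)"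
    by (simp_all add: CR_ops CG_add)
qed

lemma CR_uminus: assumes "s \<in> carrier CR" shows "\<ominus>\<^bsub>CR\<^esub> s = (\<lambda>n x. - s n x)"
proof -
  interpret R: ring CR by (rule ring_CR)
  show ?thesis
    using CR_scale[OF assms, of "-1"] assms by (intro R.minus_equality) (auto simp: CR_ops)
qed

lemma NI_iff: "s \<in> NI \<longleftrightarrow> s \<in> carrier CR \<and> (\<lambda>n. nm (s n)) \<longlonglongrightarrow> 0"
  by (simp add: null_ideal_def)

lemma null_squeeze:
  assumes "\<And>n. 0 \<le> b n" "\<And>n. b n \<le> K * (a n :: real)" "a \<longlonglongrightarrow> 0" shows "b \<longlonglongrightarrow> 0"
  by (rule real_tendsto_sandwich[where f = "\<lambda>_. 0" and h = "\<lambda>n. K * a n"])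
     (use assms tendsto_mult_right_zero in auto)

lemma null_Lipschitz:
  assumes "\<And>f. f \<in> carrier CG \<Longrightarrow> F f \<in> carrier CG" "\<And>f. f \<in> carrier CG \<Longrightarrow> nm (F f) \<le> K * nm f"
    "\<And>n. s n \<in> carrier CG" "(\<lambda>n. nm (s n)) \<longlonglongrightarrow> 0"
  shows "(\<lambda>n. nm (F (s n))) \<longlonglongrightarrow> 0"
  by (rule null_squeeze[where K = K and a = "\<lambda>n. nm (s n)"]) (use assms full_norm_nonneg in auto)

lemma null_add:
  assumes "\<And>n. s n \<in> carrier CG" "\<And>n. t n \<in> carrier CG"
    "(\<lambda>n. nm (s n)) \<longlonglongrightarrow> 0" "(\<lambda>n. nm (t n)) \<longlonglongrightarrow> 0"
  shows "(\<lambda>n. nm (\<lambda>x. s n x + t n x)) \<longlonglongrightarrow> 0"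
proof (rule null_squeeze[where K = 1 and a = "\<lambda>n. nm (s n) + nm (t n)"])
  show "0 \<le> nm (\<lambda>x. s n x + t n x)" for n by (intro full_norm_nonneg CG_closed assms)
  show "nm (\<lambda>x. s n x + t n x) \<le> 1 * (nm (s n) + nm (t n))" for n
    using full_norm_add_le[OF assms(1,2)] by simp
  show "(\<lambda>n. nm (s n) + nm (t n)) \<longlonglongrightarrow> 0" using tendsto_add[OF assms(3,4)] by simp
qed

lemma null_scale:
  assumes "\<And>n. s n \<in> carrier CG" "(\<lambda>n. nm (s n)) \<longlonglongrightarrow> 0"
  shows "(\<lambda>n. nm (\<lambda>x. c * s n x)) \<longlonglongrightarrow> 0"
  by (rule null_Lipschitz[where F = "fun_scale c" and K = "norm c" and s = s])
     (use assms CG_closed full_norm_scale_le in auto)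

lemma null_mult_left:
  assumes s: "s \<in> carrier CR" and t: "\<And>n. t n \<in> carrier CG" "(\<lambda>n. nm (t n)) \<longlonglongrightarrow> 0"
  shows "(\<lambda>n. nm (s n \<star> t n)) \<longlonglongrightarrow> 0"
proof -
  obtain B where B: "B > 0" "\<And>n. nm (s n) \<le> B" using nm_bounded[OF s] by blast
  show ?thesis
  proof (rule null_squeeze[where K = B and a = "\<lambda>n. nm (t n)"])
    show "0 \<le> nm (s n \<star> t n)" for n by (intro full_norm_nonneg CG_mult_closed CR_mem s t)
    show "nm (s n \<star> t n) \<le> B * nm (t n)" for n
      using full_norm_mult_le[OF CR_mem[OF s] t(1), of n n]
        mult_right_mono[OF B(2)[of n] full_norm_nonneg[OF t(1)[of n]]] by linarith
  qed (rule t(2))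
qed

lemma null_mult_right:
  assumes s: "s \<in> carrier CR" and t: "\<And>n. t n \<in> carrier CG" "(\<lambda>n. nm (t n)) \<longlonglongrightarrow> 0"
  shows "(\<lambda>n. nm (t n \<star> s n)) \<longlonglongrightarrow> 0"
proof -
  obtain B where B: "B > 0" "\<And>n. nm (s n) \<le> B" using nm_bounded[OF s] by blast
  show ?thesis
  proof (rule null_squeeze[where K = B and a = "\<lambda>n. nm (t n)"])
    show "0 \<le> nm (t n \<star> s n)" for n by (intro full_norm_nonneg CG_mult_closed CR_mem s t)
    show "nm (t n \<star> s n) \<le> B * nm (t n)" for n
      using full_norm_mult_le[OF t(1) CR_mem[OF s], of n n]
        mult_left_mono[OF B(2)[of n] full_norm_nonneg[OF t(1)[of n]]] by (simp add: mult.commute)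
  qed (rule t(2))
qed

lemma NI_ideal: "ideal NI CR"
proof (rule idealI[OF ring_CR])
  interpret R: ring CR by (rule ring_CR)
  show "subgroup NI (add_monoid CR)"
  proof (rule group.subgroupI)
    show "group (add_monoid CR)" by (rule R.a_group)
    show "NI \<subseteq> carrier (add_monoid CR)" by (auto simp: NI_iff)
    have "(\<lambda>n x. 0) \<in> NI" by (simp add: NI_iff CR_const CG_zero_closed full_norm_zero)
    then show "NI \<noteq> {}" by blast
  next
    fix s assume "s \<in> NI"
    then have s: "s \<in> carrier CR" "(\<lambda>n. nm (s n)) \<longlonglongrightarrow> 0" by (auto simp: NI_iff)
    have "inv\<^bsub>add_monoid CR\<^esub> s = \<ominus>\<^bsub>CR\<^esub> s" by (simp add: a_inv_def)
    also have "\<dots> = (\<lambda>n x. -1 * s n x)" by (simp add: CR_uminus[OF s(1)])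
    finally show "inv\<^bsub>add_monoid CR\<^esub> s \<in> NI"
      using CR_scale[OF s(1), of "-1"] null_scale[OF CR_mem[OF s(1)] s(2), of "-1"] by (simp add: NI_iff)
  next
    fix s t assume "s \<in> NI" "t \<in> NI"
    then show "s \<otimes>\<^bsub>add_monoid CR\<^esub> t \<in> NI"
      using CR_add null_add[of s t] by (auto simp: NI_iff CR_ops CR_mem)
  qed
  fix s t assume st: "s \<in> NI" "t \<in> carrier CR"
  then show "t \<otimes>\<^bsub>CR\<^esub> s \<in> NI" "s \<otimes>\<^bsub>CR\<^esub> t \<in> NI"
    using CR_mult null_mult_left[of t s] null_mult_right[of t s] by (auto simp: NI_iff CR_ops CR_mem)
qed

section \<open>The completed algebra, computed through representing sequences\<close>

definition coset :: "(nat \<Rightarrow> 'a \<Rightarrow> complex) \<Rightarrow> (nat \<Rightarrow> 'a \<Rightarrow> complex) set" where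
  "coset s = NI +>\<^bsub>CR\<^esub> s"

lemma mem_coset:
  assumes s: "s \<in> carrier CR"
  shows "t \<in> coset s \<longleftrightarrow> t \<in> carrier CR \<and> (\<lambda>n. nm (\<lambda>x. t n x - s n x)) \<longlonglongrightarrow> 0"
proof
  assume "t \<in> coset s"
  then obtain i where i: "i \<in> NI" "t = (\<lambda>n x. i n x + s n x)"
    by (auto simp: coset_def a_r_coset_def' CR_ops)
  then show "t \<in> carrier CR \<and> (\<lambda>n. nm (\<lambda>x. t n x - s n x)) \<longlonglongrightarrow> 0"
    using CR_add[of i s] s by (simp add: NI_iff)
next
  assume t: "t \<in> carrier CR \<and> (\<lambda>n. nm (\<lambda>x. t n x - s n x)) \<longlonglongrightarrow> 0"
  then have "(\<lambda>n x. t n x - s n x) \<in> NI" using CR_diff s by (simp add: NI_iff)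
  then show "t \<in> coset s"
    by (auto simp: coset_def a_r_coset_def' CR_ops intro!: bexI[of _ "\<lambda>n x. t n x - s n x"])
qed

lemma coset_self: "s \<in> carrier CR \<Longrightarrow> s \<in> coset s"
  by (simp add: mem_coset full_norm_zero)

lemma coset_eqI:
  assumes s: "s \<in> carrier CR" and t: "t \<in> carrier CR" and "(\<lambda>n. nm (\<lambda>x. s n x - t n x)) \<longlonglongrightarrow> 0"
  shows "coset s = coset t"
proof -
  interpret R: ring CR by (rule ring_CR)
  have "s \<in> coset t" using assms by (simp add: mem_coset)
  then show ?thesis
    using R.a_repr_independence[OF _ t additive_subgroup.a_subgroup[OF ideal.axioms(1)[OF NI_ideal]]]
    by (simp add: coset_def)
qed

lemma coset_eqD:
  "\<lbrakk>s \<in> carrier CR; t \<in> carrier CR; coset s = coset t\<rbrakk> \<Longrightarrow> (\<lambda>n. nm (\<lambda>x. s n x - t n x)) \<longlonglongrightarrow> 0"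
  using coset_self[of s] mem_coset[of t s] by simp

lemma FC_simps: "carrier FC = carrier (CR Quot NI)" "mult FC = mult (CR Quot NI)"
  "one FC = one (CR Quot NI)" "zero FC = zero (CR Quot NI)" "add FC = add (CR Quot NI)"
  by (simp_all add: full_group_cstar_def Let_def)

lemma FC_carrier: "carrier FC = coset ` carrier CR"
  by (auto simp: FC_simps FactRing_def A_RCOSETS_def' coset_def)

lemma FC_ops:
  assumes "s \<in> carrier CR" "t \<in> carrier CR"
  shows "coset s \<oplus>\<^bsub>FC\<^esub> coset t = coset (\<lambda>n x. s n x + t n x)"
    "coset s \<otimes>\<^bsub>FC\<^esub> coset t = coset (\<lambda>n. s n \<star> t n)"
    "coset s \<ominus>\<^bsub>FC\<^esub> coset t = coset (\<lambda>n x. s n x - t n x)"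
    "\<one>\<^bsub>FC\<^esub> = coset (\<lambda>n. oneCG)" "\<zero>\<^bsub>FC\<^esub> = coset (\<lambda>n x. 0)"
proof -
  interpret h: ring_hom_ring CR "CR Quot NI" "(+>\<^bsub>CR\<^esub>) NI"
    by (rule ideal.rcos_ring_hom_ring[OF NI_ideal])
  \<comment> \<open>\<open>FC\<close> is a longer record than the quotient ring, but subtraction
    reads only fields that the two share.\<close>
  have m: "x \<ominus>\<^bsub>FC\<^esub> y = x \<ominus>\<^bsub>CR Quot NI\<^esub> y" for x y
    by (simp add: a_minus_def a_inv_def m_inv_def FC_simps)
  show "coset s \<oplus>\<^bsub>FC\<^esub> coset t = coset (\<lambda>n x. s n x + t n x)"
    using h.hom_add[OF assms] by (simp add: FC_simps coset_def CR_ops)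
  show "coset s \<otimes>\<^bsub>FC\<^esub> coset t = coset (\<lambda>n. s n \<star> t n)"
    using h.hom_mult[OF assms] by (simp add: FC_simps coset_def CR_ops)
  show "coset s \<ominus>\<^bsub>FC\<^esub> coset t = coset (\<lambda>n x. s n x - t n x)"
    using h.hom_add[OF assms(1) h.R.a_inv_closed[OF assms(2)]] h.hom_a_inv[OF assms(2)]
    unfolding m by (simp add: coset_def a_minus_def CR_ops CR_uminus[OF assms(2)])
  show "\<one>\<^bsub>FC\<^esub> = coset (\<lambda>n. oneCG)" using h.hom_one by (simp add: FC_simps coset_def CR_ops)
  show "\<zero>\<^bsub>FC\<^esub> = coset (\<lambda>n x. 0)" using h.hom_zero by (simp add: FC_simps coset_def CR_ops)
qed

text \<open>The scalar multiple and the adjoint of a coset are unions over all its representatives.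
  A Lipschitz map sends equivalent sequences to equivalent ones, so the united cosets are all equal
  and any one representative computes the result.\<close>

lemma FC_Lipschitz_Union:
  assumes F: "\<And>f. f \<in> carrier CG \<Longrightarrow> F f \<in> carrier CG"
    and L: "\<And>f h. \<lbrakk>f \<in> carrier CG; h \<in> carrier CG\<rbrakk> \<Longrightarrow> nm (\<lambda>x. F f x - F h x) \<le> K * nm (\<lambda>x. f x - h x)"
    and s: "s \<in> carrier CR"
  shows "(\<Union>t\<in>coset s. NI +>\<^bsub>CR\<^esub> (\<lambda>n. F (t n))) = coset (\<lambda>n. F (s n))"
proof -
  have "coset (\<lambda>n. F (t n)) = coset (\<lambda>n. F (s n))" if "t \<in> coset s" for t
  proof (rule coset_eqI)
    have t: "t \<in> carrier CR" "(\<lambda>n. nm (\<lambda>x. t n x - s n x)) \<longlonglongrightarrow> 0" using that mem_coset[OF s] by auto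
    show "(\<lambda>n. F (t n)) \<in> carrier CR" by (rule CR_Lipschitz[where F = F and K = K, OF F L t(1)])
    show "(\<lambda>n. F (s n)) \<in> carrier CR" by (rule CR_Lipschitz[where F = F and K = K, OF F L s])
    show "(\<lambda>n. nm (\<lambda>x. F (t n) x - F (s n) x)) \<longlonglongrightarrow> 0"
    proof (rule null_squeeze[OF _ _ t(2)])
      show "0 \<le> nm (\<lambda>x. F (t n) x - F (s n) x)" for n
        by (intro full_norm_nonneg CG_closed F CR_mem s t(1))
      show "nm (\<lambda>x. F (t n) x - F (s n) x) \<le> K * nm (\<lambda>x. t n x - s n x)" for n
        by (intro L CR_mem s t(1))
    qed
  qed
  then have "(\<Union>t\<in>coset s. coset (\<lambda>n. F (t n))) = (\<Union>t\<in>coset s. coset (\<lambda>n. F (s n)))"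
    by (intro SUP_cong refl)
  also have "\<dots> = coset (\<lambda>n. F (s n))" using coset_self[OF s] by blast
  finally show ?thesis by (simp only: coset_def)
qed

lemma FC_smult: assumes "s \<in> carrier CR" shows "c \<odot>\<^bsub>FC\<^esub> coset s = coset (\<lambda>n x. c * s n x)"
proof -
  have "c \<odot>\<^bsub>FC\<^esub> coset s = (\<Union>t\<in>coset s. NI +>\<^bsub>CR\<^esub> (\<lambda>n. fun_scale c (t n)))"
    by (simp add: full_group_cstar_def Let_def)
  also have "\<dots> = coset (\<lambda>n. fun_scale c (s n))"
  proof (rule FC_Lipschitz_Union[OF _ _ assms])
    fix f h assume "f \<in> carrier CG" "h \<in> carrier CG"
    then show "nm (\<lambda>x. c * f x - c * h x) \<le> norm c * nm (\<lambda>x. f x - h x)"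
      using full_norm_scale_le[OF CG_closed(2), of f h c] by (simp add: right_diff_distrib)
  qed (auto intro: CG_closed)
  finally show ?thesis .
qed

lemma FC_adj: assumes "s \<in> carrier CR" shows "adj FC (coset s) = coset (\<lambda>n. adjCG (s n))"
proof -
  have "adj FC (coset s) = (\<Union>t\<in>coset s. NI +>\<^bsub>CR\<^esub> (\<lambda>n. adjCG (t n)))"
    by (simp add: full_group_cstar_def Let_def)
  also have "\<dots> = coset (\<lambda>n. adjCG (s n))"
  proof (rule FC_Lipschitz_Union[OF _ _ assms])
    fix f h assume "f \<in> carrier CG" "h \<in> carrier CG"
    then show "nm (\<lambda>x. adjCG f x - adjCG h x) \<le> 1 * nm (\<lambda>x. f x - h x)"
      using full_norm_adj_le[OF CG_closed(2), of f h] by (simp add: adj_diff)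
  qed (auto intro: adj_closed)
  finally show ?thesis .
qed

text \<open>Norms along equivalent sequences have the same limit, so the definite description in
  \<open>cnorm\<close> denotes it.\<close>

lemma FC_cnorm: assumes s: "s \<in> carrier CR" shows "(\<lambda>n. nm (s n)) \<longlonglongrightarrow> cnorm FC (coset s)"
proof -
  obtain r where r: "(\<lambda>n. nm (s n)) \<longlonglongrightarrow> r" using nm_convergent[OF s] by (auto simp: convergent_def)
  have lim: "(\<lambda>n. nm (t n)) \<longlonglongrightarrow> r" if "t \<in> coset s" for t
  proof -
    have t: "t \<in> carrier CR" "(\<lambda>n. nm (\<lambda>x. t n x - s n x)) \<longlonglongrightarrow> 0" using that mem_coset[OF s] by auto
    have "(\<lambda>n. nm (t n) - nm (s n)) \<longlonglongrightarrow> 0"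
      by (rule Lim_null_comparison[OF _ t(2)])
         (use nm_diff_abs[OF CR_mem[OF t(1)] CR_mem[OF s]] in auto)
    from tendsto_add[OF this r] show ?thesis by simp
  qed
  have "cnorm FC (coset s) = (THE r. \<forall>t\<in>coset s. (\<lambda>n. nm (t n)) \<longlonglongrightarrow> r)"
    by (simp add: full_group_cstar_def Let_def)
  also have "\<dots> = r"
    using lim coset_self[OF s] by (intro the_equality) (auto intro: LIMSEQ_unique)
  finally show ?thesis using r by simp
qed

text \<open>Half of g plus its inverse in the group algebra, as a sum of two point masses so that it
  is also right when \<open>g\<close> equals its inverse.\<close>

definition cosine :: "'a \<Rightarrow> 'a \<Rightarrow> complex" where
  "cosine g = (\<lambda>x. (1/2) * ((if x = g then 1 else 0) + (if x = inv g then 1 else 0)))"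

lemma cosine_closed: "g \<in> carrier G \<Longrightarrow> cosine g \<in> carrier CG"
  unfolding cosine_def
  by (rule CG_closed(3)[OF CG_closed(1)[OF CG_delta_closed CG_delta_closed] CG_zero_closed]) auto

lemma adj_cosine: "g \<in> carrier G \<Longrightarrow> adjCG (cosine g) = cosine g"
  by (auto simp: group_algebra_adj_def cosine_def fun_eq_iff)

lemma nm_cosine: assumes "g \<in> carrier G" shows "nm (cosine g) \<le> 1"
proof -
  have d: "(\<lambda>x. if x = g then 1 else 0) \<in> carrier CG" "(\<lambda>x. if x = inv g then 1 else 0) \<in> carrier CG"
    using assms by (auto intro: CG_delta_closed)
  have "nm (cosine g) \<le> norm (1/2 :: complex) *
      nm (\<lambda>x. (if x = g then 1 else 0) + (if x = inv g then 1 else 0))"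
    unfolding cosine_def by (intro full_norm_scale_le CG_closed d)
  also have "nm (\<lambda>x. (if x = g then 1 else 0) + (if x = inv g then 1 else 0)) \<le> 1 + 1"
    using full_norm_add_le[OF d] full_norm_delta_le[OF assms] full_norm_delta_le[of "inv g"] assms by simp
  finally show ?thesis by simp
qed

lemma FC_cosine:
  assumes "g \<in> carrier G"
  shows "(1/2) \<odot>\<^bsub>FC\<^esub> (group_unitary G g \<oplus>\<^bsub>FC\<^esub> group_unitary G (inv g)) = coset (\<lambda>n. cosine g)"
proof -
  have d: "(\<lambda>n x. if x = g then 1 else 0) \<in> carrier CR" "(\<lambda>n x. if x = inv g then 1 else 0) \<in> carrier CR"
    using assms by (auto intro: CR_const CG_delta_closed)
  have u: "group_unitary G k = coset (\<lambda>n x. if x = k then 1 else 0)" for k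
    by (simp add: group_unitary_def coset_def)
  show ?thesis by (simp add: u FC_ops(1)[OF d] FC_smult[OF CR_add[OF d]] cosine_def)
qed

text \<open>Invertibility in the completion, pulled back to sequences. Only the left inverse is
  kept: up to a small error it already bounds the operator from below in every
  representation.\<close>

lemma spectrum_approx_inverse:
  assumes s: "s \<in> carrier CR" and z: "z \<notin> spectrum FC (coset s)"
  obtains b where "b \<in> carrier CR"
    "(\<lambda>n. nm (\<lambda>x. (b n \<star> (\<lambda>x. s n x - z * oneCG x)) x - oneCG x)) \<longlonglongrightarrow> 0"
proof -
  have o: "(\<lambda>n. oneCG) \<in> carrier CR" by (rule CR_const[OF CG_one_closed])
  note zo = CR_scale[OF o, of z]
  note d = CR_diff[OF s zo]
  have "coset s \<ominus>\<^bsub>FC\<^esub> (z \<odot>\<^bsub>FC\<^esub> \<one>\<^bsub>FC\<^esub>) \<in> Units FC" using z by (simp add: spectrum_def)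
  then have "coset (\<lambda>n x. s n x - z * oneCG x) \<in> Units FC"
    by (simp add: FC_ops(4)[OF s s] FC_smult[OF o] FC_ops(3)[OF s zo])
  then obtain y where y: "y \<in> carrier FC" "y \<otimes>\<^bsub>FC\<^esub> coset (\<lambda>n x. s n x - z * oneCG x) = \<one>\<^bsub>FC\<^esub>"
    by (auto simp: Units_def)
  then obtain b where b: "b \<in> carrier CR" "y = coset b" by (auto simp: FC_carrier)
  have "coset (\<lambda>n. b n \<star> (\<lambda>x. s n x - z * oneCG x)) = coset (\<lambda>n. oneCG)"
    using y(2) by (simp add: b(2) FC_ops(2)[OF b(1) d] FC_ops(4)[OF s s])
  from coset_eqD[OF CR_mult[OF b(1) d] o this] show thesis using that b(1) by blast
qed

text \<open>Zero is the competitor that bounds the distance by the norm of \<open>cosine g\<close>,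
  and it makes the infimum one over a nonempty set.\<close>

lemma zero_fin_spec_sa: "\<zero>\<^bsub>FC\<^esub> \<in> fin_spec_sa FC"
proof -
  have c0: "(\<lambda>n x. 0) \<in> carrier CR" and o: "(\<lambda>n. oneCG) \<in> carrier CR"
    by (auto intro: CR_const CG_zero_closed CG_one_closed)
  note zero = FC_ops(5)[OF c0 c0] and one = FC_ops(4)[OF c0 c0]
  have "adj FC \<zero>\<^bsub>FC\<^esub> = \<zero>\<^bsub>FC\<^esub>"
  proof -
    have "adjCG (\<lambda>x. 0) = (\<lambda>x. 0)" by (simp add: group_algebra_adj_def fun_eq_iff)
    then show ?thesis unfolding zero FC_adj[OF c0] by simp
  qed
  moreover have "spectrum FC \<zero>\<^bsub>FC\<^esub> \<subseteq> {0}"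
  proof
    fix z assume z: "z \<in> spectrum FC \<zero>\<^bsub>FC\<^esub>"
    show "z \<in> {0}"
    proof (rule ccontr)
      assume "z \<notin> {0}"
      then have z0: "z \<noteq> 0" by simp
      interpret C: ring CG by (rule ring_CG)
      define p q where "p = (\<lambda>(n::nat) x. - z * oneCG x)" and "q = (\<lambda>(n::nat) x. - (1/z) * oneCG x)"
      have pq: "p \<in> carrier CR" "q \<in> carrier CR"
        unfolding p_def q_def by (rule CR_scale[OF o])+
      have sc: "(\<lambda>x. c * oneCG x) \<star> (\<lambda>x. d * oneCG x) = (\<lambda>x. c * d * oneCG x)"
        if "c \<noteq> 0" for c d
      proof -
        have "{y. c * oneCG y \<noteq> 0} = {\<one>}" using that by (auto simp: CG_one)
        then show ?thesis by (auto simp: CG_mult CG_one fun_eq_iff)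
      qed
      have "p n \<star> q n = oneCG" "q n \<star> p n = oneCG" for n
        using z0 sc[of "- z" "- (1/z)"] sc[of "- (1/z)" "- z"] unfolding p_def q_def by simp_all
      then have "coset p \<otimes>\<^bsub>FC\<^esub> coset q = \<one>\<^bsub>FC\<^esub>" "coset q \<otimes>\<^bsub>FC\<^esub> coset p = \<one>\<^bsub>FC\<^esub>"
        by (simp_all add: FC_ops(2) pq one)
      moreover have "coset p \<in> carrier FC" "coset q \<in> carrier FC" using pq by (auto simp: FC_carrier)
      ultimately have "coset p \<in> Units FC" unfolding Units_def by blast
      moreover have "\<zero>\<^bsub>FC\<^esub> \<ominus>\<^bsub>FC\<^esub> (z \<odot>\<^bsub>FC\<^esub> \<one>\<^bsub>FC\<^esub>) = coset p"
        by (simp add: zero one FC_smult[OF o] FC_ops(3)[OF c0 CR_scale[OF o]] p_def)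
      ultimately show False using z by (simp add: spectrum_def)
    qed
  qed
  ultimately show ?thesis
    using finite_subset[of "spectrum FC \<zero>\<^bsub>FC\<^esub>" "{0}"] c0 by (auto simp: fin_spec_sa_def zero FC_carrier)
qed

text \<open>Carries the problem from the completion to the group algebra: from a sequence for
  \<open>v\<close> it extracts a self-adjoint \<open>u\<close> with an approximate left inverse, to
  which \<open>core\<close> applies.\<close>

lemma cnorm_cosine_diff_ge_1:
  assumes g: "g \<in> carrier G"
    and core: "\<And>u b. \<lbrakk>u \<in> carrier CG; b \<in> carrier CG; adjCG u = u;
      nm (\<lambda>x. (b \<star> u) x - oneCG x) \<le> 1/2\<rbrakk> \<Longrightarrow> 1 \<le> nm (\<lambda>x. cosine g x - u x)"
    and v: "v \<in> fin_spec_sa FC"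
  shows "1 \<le> cnorm FC (coset (\<lambda>n. cosine g) \<ominus>\<^bsub>FC\<^esub> v)"
proof (rule ccontr)
  note ac = CR_const[OF cosine_closed[OF g]]
  obtain s where s: "s \<in> carrier CR" "v = coset s" "adj FC (coset s) = coset s" "finite (spectrum FC (coset s))"
    using v by (auto simp: fin_spec_sa_def FC_carrier)
  define r where "r = cnorm FC (coset (\<lambda>n. cosine g) \<ominus>\<^bsub>FC\<^esub> v)"
  assume "\<not> 1 \<le> cnorm FC (coset (\<lambda>n. cosine g) \<ominus>\<^bsub>FC\<^esub> v)"
  then have r1: "r < 1" by (simp add: r_def)
  have lim: "(\<lambda>n. nm (\<lambda>x. cosine g x - s n x)) \<longlonglongrightarrow> r"
    using FC_cnorm[OF CR_diff[OF ac s(1)]] by (simp add: r_def s(2) FC_ops(3)[OF ac s(1)])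
  \<comment> \<open>A finite spectrum misses some real \<open>t\<close> in this interval. Its length
    is half of the slack below 1; the other half is shared by the two approximation errors.\<close>
  have "infinite {0 <..< (1 - r)/2}" using r1 by simp
  then have "infinite (complex_of_real ` {0 <..< (1 - r)/2})"
    by (simp add: finite_image_iff inj_on_def)
  then have "\<not> complex_of_real ` {0 <..< (1 - r)/2} \<subseteq> spectrum FC (coset s)"
    using finite_subset[OF _ s(4)] by blast
  then obtain t where "t \<in> {0 <..< (1 - r)/2}" "complex_of_real t \<notin> spectrum FC (coset s)" by blast
  then have t: "0 < t" "t < (1 - r)/2" "complex_of_real t \<notin> spectrum FC (coset s)" by simp_all
  obtain b where b: "b \<in> carrier CR"
    "(\<lambda>n. nm (\<lambda>x. (b n \<star> (\<lambda>x. s n x - of_real t * oneCG x)) x - oneCG x)) \<longlonglongrightarrow> 0"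
    using spectrum_approx_inverse[OF s(1) t(3)] by blast
  \<comment> \<open>\<open>D n\<close> is the skew-adjoint part of \<open>s n\<close> and tends to 0
    because \<open>v\<close> is self-adjoint. Removing it leaves as \<open>u n\<close> the
    self-adjoint part of \<open>s n\<close> minus the real scalar \<open>t\<close>, which is exactly
    self-adjoint.\<close>
  define D where "D n = (\<lambda>x. (1/2) * (s n x - adjCG (s n) x))" for n
  define u where "u n = (\<lambda>x. (s n x - of_real t * oneCG x) - D n x)" for n
  have sn: "s n \<in> carrier CG" and bn: "b n \<in> carrier CG" for n using CR_mem s b by blast+
  note on = CG_closed(3)[OF CG_one_closed CG_one_closed, of "of_real t"]
  note stn = CG_closed(2)[OF sn on]
  have Dn: "D n \<in> carrier CG" for n
    unfolding D_def by (rule CG_closed(3)[OF CG_closed(2)[OF sn adj_closed[OF sn]] sn])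
  have un: "u n \<in> carrier CG" for n unfolding u_def by (intro CG_closed stn Dn)
  have "(\<lambda>n. nm (\<lambda>x. s n x - adjCG (s n) x)) \<longlonglongrightarrow> 0"
    using coset_eqD[OF s(1) CR_adj[OF s(1)]] s(3) FC_adj[OF s(1)] by simp
  then have Dlim: "(\<lambda>n. nm (D n)) \<longlonglongrightarrow> 0"
    unfolding D_def by (intro null_scale CG_closed sn adj_closed)
  have adju: "adjCG (u n) = u n" for n
  proof
    fix x
    have "adjCG (s n) (inv x) = cnj (s n x)" if "x \<in> carrier G"
      using that by (simp add: group_algebra_adj_def)
    moreover have "s n x = 0" "oneCG x = 0" if "x \<notin> carrier G"
      using CG_supp[OF sn] CG_supp[OF CG_one_closed] that by blast+
    moreover have "inv x = \<one> \<longleftrightarrow> x = \<one>" if "x \<in> carrier G" using that by (simp add: inv_eq_1_iff)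
    ultimately show "adjCG (u n) x = u n x"
      by (auto simp: u_def D_def group_algebra_adj_def CG_one field_simps)
  qed
  \<comment> \<open>Dropping \<open>D n\<close> changes the product with the bounded sequence
    \<open>b\<close> by a null sequence.\<close>
  have "(\<lambda>n. nm (\<lambda>x. (b n \<star> u n) x - oneCG x)) \<longlonglongrightarrow> 0"
  proof -
    have bD: "b n \<star> D n \<in> carrier CG" for n by (intro CG_mult_closed bn Dn)
    have bDlim: "(\<lambda>n. nm (\<lambda>x. -1 * (b n \<star> D n) x)) \<longlonglongrightarrow> 0"
      by (intro null_scale bD null_mult_left b(1) Dn Dlim)
    have m1: "(\<lambda>x. (b n \<star> (\<lambda>x. s n x - of_real t * oneCG x)) x - oneCG x) \<in> carrier CG" for n
      by (intro CG_closed CG_mult_closed bn sn CG_one_closed on)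
    have "(\<lambda>n. nm (\<lambda>x. ((b n \<star> (\<lambda>x. s n x - of_real t * oneCG x)) x - oneCG x) +
        -1 * (b n \<star> D n) x)) \<longlonglongrightarrow> 0"
      by (rule null_add[OF m1 CG_closed(3)[OF bD bD] b(2) bDlim])
    then show ?thesis
      unfolding u_def CG_mult_diff(1)[OF bn stn Dn] by (simp add: algebra_simps)
  qed
  then have "\<forall>\<^sub>F n in sequentially. nm (\<lambda>x. (b n \<star> u n) x - oneCG x) < 1/2"
    by (rule order_tendstoD) simp
  moreover have "\<forall>\<^sub>F n in sequentially. nm (\<lambda>x. cosine g x - s n x) < r + (1 - r)/4"
    by (rule order_tendstoD[OF lim]) (use r1 in simp)
  moreover have "\<forall>\<^sub>F n in sequentially. nm (D n) < (1 - r)/4"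
    by (rule order_tendstoD[OF Dlim]) (use r1 in simp)
  ultimately have "\<forall>\<^sub>F n in sequentially. False"
  proof eventually_elim
    case (elim n)
    have "nm (\<lambda>x. (\<lambda>x. cosine g x - s n x) x + (\<lambda>x. D n x + of_real t * oneCG x) x)
        \<le> nm (\<lambda>x. cosine g x - s n x) + nm (\<lambda>x. D n x + of_real t * oneCG x)"
      by (intro full_norm_add_le CG_closed cosine_closed g sn Dn on)
    also have "nm (\<lambda>x. D n x + of_real t * oneCG x) \<le> nm (D n) + nm (\<lambda>x. of_real t * oneCG x)"
      by (intro full_norm_add_le Dn on)
    also have "nm (\<lambda>x. of_real t * oneCG x) \<le> t"
    proof -
      have "nm (\<lambda>x. of_real t * oneCG x) \<le> norm (complex_of_real t) * nm oneCG"
        by (rule full_norm_scale_le[OF CG_one_closed])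
      also have "\<dots> \<le> t * 1"
        using t(1) full_norm_delta_le[OF one_closed] by (simp add: CG_one mult_left_le)
      finally show ?thesis by simp
    qed
    finally have "nm (\<lambda>x. (\<lambda>x. cosine g x - s n x) x + (\<lambda>x. D n x + of_real t * oneCG x) x)
        \<le> nm (\<lambda>x. cosine g x - s n x) + (nm (D n) + t)" by simp
    moreover have "(\<lambda>x. cosine g x - u n x) =
        (\<lambda>x. (\<lambda>x. cosine g x - s n x) x + (\<lambda>x. D n x + of_real t * oneCG x) x)"
      by (simp add: u_def fun_eq_iff)
    ultimately have "nm (\<lambda>x. cosine g x - u n x) \<le> nm (\<lambda>x. cosine g x - s n x) + (nm (D n) + t)" by simp
    moreover have "A < 1" if "A \<le> B + (C + t)" "B < r + (1 - r)/4" "C < (1 - r)/4" for A B C :: real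
      using that t(2) by (simp add: field_simps)
    ultimately have "nm (\<lambda>x. cosine g x - u n x) < 1" using elim(2,3) by blast
    moreover have "1 \<le> nm (\<lambda>x. cosine g x - u n x)"
      by (rule core[OF un bn[of n] adju]) (use elim(1) in linarith)
    ultimately show False by simp
  qed
  then show False by simp
qed

text \<open>The previous lemma bounds the distance from below and the competitor zero bounds it from
  above. The same self-adjoint element refutes real rank zero at \<epsilon> = 1.\<close>

lemma dist_fin_spec_cosine:
  assumes g: "g \<in> carrier G"
    and core: "\<And>u b. \<lbrakk>u \<in> carrier CG; b \<in> carrier CG; adjCG u = u;
      nm (\<lambda>x. (b \<star> u) x - oneCG x) \<le> 1/2\<rbrakk> \<Longrightarrow> 1 \<le> nm (\<lambda>x. cosine g x - u x)"
  shows "dist_fin_spec FC (coset (\<lambda>n. cosine g)) = 1" "\<not> real_rank_zero FC"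
proof -
  note ac = CR_const[OF cosine_closed[OF g]]
  have ge: "1 \<le> cnorm FC (coset (\<lambda>n. cosine g) \<ominus>\<^bsub>FC\<^esub> v)" if "v \<in> fin_spec_sa FC" for v
    using g core that by (rule cnorm_cosine_diff_ge_1)
  have c0: "(\<lambda>n x. 0) \<in> carrier CR" by (auto intro: CR_const CG_zero_closed)
  define S where "S = {cnorm FC (coset (\<lambda>n. cosine g) \<ominus>\<^bsub>FC\<^esub> v) | v. v \<in> fin_spec_sa FC}"
  have "cnorm FC (coset (\<lambda>n. cosine g) \<ominus>\<^bsub>FC\<^esub> \<zero>\<^bsub>FC\<^esub>) = nm (cosine g)"
    using FC_cnorm[OF ac] by (simp add: FC_ops(5)[OF c0 c0] FC_ops(3)[OF ac c0] LIMSEQ_const_iff)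
  then have m: "nm (cosine g) \<in> S" 
    unfolding S_def by (intro CollectI exI[of _ "\<zero>\<^bsub>FC\<^esub>"] conjI zero_fin_spec_sa) simp
  have S: "1 \<le> x" if x: "x \<in> S" for x
  proof -
    obtain v where "v \<in> fin_spec_sa FC" "x = cnorm FC (coset (\<lambda>n. cosine g) \<ominus>\<^bsub>FC\<^esub> v)"
      using x unfolding S_def by blast
    then show ?thesis using ge[of v] by simp
  qed
  have "Inf S \<le> nm (cosine g)" by (rule cInf_lower[OF m bdd_belowI[of S 1]]) (rule S)
  moreover have "1 \<le> Inf S" by (rule cInf_greatest) (use m S in blast)+
  ultimately show "dist_fin_spec FC (coset (\<lambda>n. cosine g)) = 1"
    using nm_cosine[OF g] by (simp add: dist_fin_spec_def S_def)
  show "\<not> real_rank_zero FC"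
  proof
    assume rr: "real_rank_zero FC"
    have "coset (\<lambda>n. cosine g) \<in> carrier FC" using ac by (simp add: FC_carrier)
    moreover have "adj FC (coset (\<lambda>n. cosine g)) = coset (\<lambda>n. cosine g)"
      by (simp add: FC_adj[OF ac] adj_cosine[OF g])
    ultimately have "\<exists>v\<in>fin_spec_sa FC. cnorm FC (coset (\<lambda>n. cosine g) \<ominus>\<^bsub>FC\<^esub> v) < 1"
      using rr[unfolded real_rank_zero_def, THEN bspec, THEN mp, THEN spec[of _ 1]] by simp
    then show False using ge by (meson not_le)
  qed
qed

end

section \<open>Monomial representations on square-summable functions\<close>

text \<open>Vectors are functions on the whole type; vanishing off \<open>Y\<close> makes the inner
  product over \<open>Y\<close> definite.\<close>

definition ell2 :: "'y set \<Rightarrow> ('y \<Rightarrow> complex) set" where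
  "ell2 Y = {f. (\<forall>y. y \<notin> Y \<longrightarrow> f y = 0) \<and> (\<lambda>y. (cmod (f y))\<^sup>2) summable_on Y}"

definition ell2_ip :: "'y set \<Rightarrow> ('y \<Rightarrow> complex) \<Rightarrow> ('y \<Rightarrow> complex) \<Rightarrow> complex" where
  "ell2_ip Y f g = (\<Sum>\<^sub>\<infinity>y\<in>Y. cnj (f y) * g y)"

lemma ell2_ip_summable:
  assumes f: "f \<in> ell2 Y" and g: "g \<in> ell2 Y"
  shows "(\<lambda>y. cnj (f y) * g y) summable_on Y"
proof (rule abs_summable_summable)
  have s: "(\<lambda>y. (cmod (f y))\<^sup>2 + (cmod (g y))\<^sup>2) summable_on Y"
    using f g by (intro summable_on_add) (auto simp: ell2_def)
  show "(\<lambda>y. cmod (cnj (f y) * g y)) summable_on Y"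
  proof (rule summable_on_comparison_test[OF s])
    fix y
    have "2 * (cmod (f y) * cmod (g y)) \<le> (cmod (f y))\<^sup>2 + (cmod (g y))\<^sup>2"
      using sum_squares_bound[of "cmod (f y)" "cmod (g y)"] by simp
    moreover have "0 \<le> cmod (f y) * cmod (g y)" by simp
    ultimately show "cmod (cnj (f y) * g y) \<le> (cmod (f y))\<^sup>2 + (cmod (g y))\<^sup>2"
      unfolding norm_mult complex_mod_cnj by linarith
  qed auto
qed

lemma ell2_ip_self:
  assumes "f \<in> ell2 Y" shows "ell2_ip Y f f = of_real (\<Sum>\<^sub>\<infinity>y\<in>Y. (cmod (f y))\<^sup>2)"
proof -
  have e: "cnj (f y) * f y = of_real ((cmod (f y))\<^sup>2)" for y
    by (simp add: complex_norm_square mult.commute del: of_real_power)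
  have "((\<lambda>y. (cmod (f y))\<^sup>2) has_sum (\<Sum>\<^sub>\<infinity>y\<in>Y. (cmod (f y))\<^sup>2)) Y"
    using assms by (intro has_sum_infsum) (simp add: ell2_def)
  then have "((\<lambda>y. complex_of_real ((cmod (f y))\<^sup>2)) has_sum of_real (\<Sum>\<^sub>\<infinity>y\<in>Y. (cmod (f y))\<^sup>2)) Y"
    by (simp only: has_sum_of_real_iff)
  then show ?thesis unfolding ell2_ip_def e by (rule infsumI)
qed

lemma ell2_add:
  assumes f: "f \<in> ell2 Y" and g: "g \<in> ell2 Y" shows "f + g \<in> ell2 Y"
proof -
  have s: "(\<lambda>y. 2 * (cmod (f y))\<^sup>2 + 2 * (cmod (g y))\<^sup>2) summable_on Y"
    using f g by (intro summable_on_add summable_on_cmult_right) (auto simp: ell2_def)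
  have "(\<lambda>y. (cmod (f y + g y))\<^sup>2) summable_on Y"
  proof (rule summable_on_comparison_test[OF s])
    fix y
    have "(cmod (f y + g y))\<^sup>2 \<le> (cmod (f y) + cmod (g y))\<^sup>2"
      by (intro power_mono norm_triangle_ineq) auto
    also have "\<dots> \<le> 2 * (cmod (f y))\<^sup>2 + 2 * (cmod (g y))\<^sup>2"
      using sum_squares_bound[of "cmod (f y)" "cmod (g y)"] by (simp add: power2_sum)
    finally show "(cmod (f y + g y))\<^sup>2 \<le> 2 * (cmod (f y))\<^sup>2 + 2 * (cmod (g y))\<^sup>2" .
  qed auto
  then show ?thesis using f g by (auto simp: ell2_def)
qed

lemma ell2_scale: assumes "f \<in> ell2 Y" shows "(\<lambda>y. c * f y) \<in> ell2 Y"
  using assms summable_on_cmult_right[of "\<lambda>y. (cmod (f y))\<^sup>2" Y "(cmod c)\<^sup>2"]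
  by (auto simp: ell2_def norm_mult power_mult_distrib)

lemma ell2_zero: "0 \<in> ell2 Y"
  by (simp add: ell2_def)

lemma ell2_diff: assumes "f \<in> ell2 Y" "g \<in> ell2 Y" shows "f - g \<in> ell2 Y"
proof -
  have "f - g = f + (\<lambda>y. - 1 * g y)" by (auto simp: fun_eq_iff)
  then show ?thesis using ell2_add[OF assms(1) ell2_scale[OF assms(2)]] by metis
qed

lemma ell2_sum_le:
  assumes f: "f \<in> ell2 Y" and F: "finite F" "F \<subseteq> Y"
  shows "(\<Sum>y\<in>F. (cmod (f y))\<^sup>2) \<le> Re (ell2_ip Y f f)"
  using finite_sum_le_infsum[of "\<lambda>y. (cmod (f y))\<^sup>2" Y F] assms by (simp add: ell2_ip_self[OF f] ell2_def)

lemma ell2_component_le: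
  assumes f: "f \<in> ell2 Y" shows "cmod (f y) \<le> sqrt (Re (ell2_ip Y f f))"
proof (cases "y \<in> Y")
  case True
  then show ?thesis using ell2_sum_le[OF f, of "{y}"] by (intro real_le_rsqrt) simp
next
  case False
  then have "f y = 0" using f by (simp add: ell2_def)
  moreover have "0 \<le> Re (ell2_ip Y f f)" using ell2_sum_le[OF f, of "{}"] by simp
  ultimately show ?thesis by simp
qed

text \<open>A bound on all finite partial sums survives pointwise limits, which is what completeness
  uses.\<close>

lemma ell2_bounded_sums:
  assumes "\<And>y. y \<notin> Y \<Longrightarrow> f y = 0" "\<And>F. \<lbrakk>finite F; F \<subseteq> Y\<rbrakk> \<Longrightarrow> (\<Sum>y\<in>F. (cmod (f y))\<^sup>2) \<le> B"
  shows "f \<in> ell2 Y" "Re (ell2_ip Y f f) \<le> B"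
proof -
  have s: "(\<lambda>y. (cmod (f y))\<^sup>2) summable_on Y"
    using assms(2) by (intro nonneg_bdd_above_summable_on bdd_aboveI[of _ B]) auto
  then show f: "f \<in> ell2 Y" using assms(1) by (simp add: ell2_def)
  show "Re (ell2_ip Y f f) \<le> B"
    using infsum_le_finite_sums[OF s] assms(2) by (simp add: ell2_ip_self[OF f])
qed

text \<open>The limit is taken pointwise. For fixed \<open>m\<close>, letting \<open>n\<close> grow
  in the bounds on finite sums of \<open>X m - X n\<close> shows that \<open>X m - x\<close> is
  square-summable and small.\<close>

lemma ell2_complete:
  assumes X: "\<And>n. X n \<in> ell2 Y"
    and Cau: "\<And>e. e > 0 \<Longrightarrow> \<exists>M. \<forall>m\<ge>M. \<forall>n\<ge>M. sqrt (Re (ell2_ip Y (X m - X n) (X m - X n))) < e"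
  shows "\<exists>x\<in>ell2 Y. (\<lambda>n. sqrt (Re (ell2_ip Y (X n - x) (X n - x)))) \<longlonglongrightarrow> 0"
proof -
  have "Cauchy (\<lambda>n. X n y)" for y
  proof (rule metric_CauchyI)
    fix e :: real assume "e > 0"
    then obtain M where M: "\<forall>m\<ge>M. \<forall>n\<ge>M. sqrt (Re (ell2_ip Y (X m - X n) (X m - X n))) < e"
      using Cau by blast
    have "dist (X m y) (X n y) < e" if "m \<ge> M" "n \<ge> M" for m n
      using ell2_component_le[OF ell2_diff[OF X[of m] X[of n]], of y] M that
      by (auto simp: dist_norm intro: le_less_trans)
    then show "\<exists>M. \<forall>m\<ge>M. \<forall>n\<ge>M. dist (X m y) (X n y) < e" by blast
  qed
  then have "\<forall>y. \<exists>l. (\<lambda>n. X n y) \<longlonglongrightarrow> l"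
    using Cauchy_convergent_iff convergent_def by metis
  then obtain x where x: "\<And>y. (\<lambda>n. X n y) \<longlonglongrightarrow> x y" by metis
  have x0: "x y = 0" if "y \<notin> Y" for y
    using x[of y] X that by (simp add: ell2_def LIMSEQ_const_iff)
  have close: "\<exists>M. \<forall>m\<ge>M. X m - x \<in> ell2 Y \<and> Re (ell2_ip Y (X m - x) (X m - x)) \<le> e\<^sup>2" if e: "e > 0" for e
  proof -
    obtain M where M: "\<forall>m\<ge>M. \<forall>n\<ge>M. sqrt (Re (ell2_ip Y (X m - X n) (X m - X n))) < e"
      using Cau[OF e] by blast
    have "X m - x \<in> ell2 Y \<and> Re (ell2_ip Y (X m - x) (X m - x)) \<le> e\<^sup>2" if m: "m \<ge> M" for m
    proof -
      have zero: "(X m - x) y = 0" if "y \<notin> Y" for y using x0[OF that] X[of m] that by (simp add: ell2_def)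
      have sums: "(\<Sum>y\<in>F. (cmod ((X m - x) y))\<^sup>2) \<le> e\<^sup>2" if F: "finite F" "F \<subseteq> Y" for F
      proof -
        have lim: "(\<lambda>n. \<Sum>y\<in>F. (cmod ((X m - X n) y))\<^sup>2) \<longlonglongrightarrow> (\<Sum>y\<in>F. (cmod ((X m - x) y))\<^sup>2)"
          using x by (auto intro!: tendsto_intros)
        have "(\<Sum>y\<in>F. (cmod ((X m - X n) y))\<^sup>2) \<le> e\<^sup>2" if n: "n \<ge> M" for n
        proof -
          have "(\<Sum>y\<in>F. (cmod ((X m - X n) y))\<^sup>2) \<le> Re (ell2_ip Y (X m - X n) (X m - X n))"
            by (rule ell2_sum_le[OF ell2_diff[OF X X] F])
          also have "\<dots> \<le> e\<^sup>2" using M m n e by (meson less_imp_le real_sqrt_le_iff sqrt_le_D)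
          finally show ?thesis .
        qed
        then show ?thesis by (intro LIMSEQ_le_const2[OF lim] exI[of _ M]) auto
      qed
      show ?thesis using ell2_bounded_sums[of Y "X m - x" "e\<^sup>2", OF zero sums] by blast
    qed
    then show ?thesis by blast
  qed
  obtain M where "X M - x \<in> ell2 Y" using close[of 1] by auto
  then have "X M - (X M - x) \<in> ell2 Y" by (rule ell2_diff[OF X])
  then have xY: "x \<in> ell2 Y" by simp
  have "(\<lambda>n. sqrt (Re (ell2_ip Y (X n - x) (X n - x)))) \<longlonglongrightarrow> 0"
  proof (rule metric_LIMSEQ_I)
    fix e :: real assume e: "e > 0"
    then obtain M where M: "\<forall>m\<ge>M. Re (ell2_ip Y (X m - x) (X m - x)) \<le> (e/2)\<^sup>2"
      using close[of "e/2"] by auto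
    have "dist (sqrt (Re (ell2_ip Y (X m - x) (X m - x)))) 0 < e" if "m \<ge> M" for m
    proof -
      have "sqrt (Re (ell2_ip Y (X m - x) (X m - x))) \<le> e/2"
        using M that e by (intro real_le_lsqrt) auto
      moreover have "0 \<le> Re (ell2_ip Y (X m - x) (X m - x))"
        using ell2_sum_le[OF ell2_diff[OF X xY], of "{}"] by simp
      ultimately show ?thesis using e by (simp add: dist_norm)
    qed
    then show "\<exists>M. \<forall>m\<ge>M. dist (sqrt (Re (ell2_ip Y (X m - x) (X m - x)))) 0 < e" by blast
  qed
  then show ?thesis using xY by blast
qed

lemma ell2_hilbert: "complex_hilbert_space fun_scale (ell2 Y) (ell2_ip Y)"
proof -
  interpret F: vector_space "fun_scale :: complex \<Rightarrow> ('y \<Rightarrow> complex) \<Rightarrow> _"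
    by unfold_locales (auto simp: fun_eq_iff algebra_simps)
  show ?thesis
  proof
    show "F.subspace (ell2 Y)"
      by (auto simp: F.subspace_def ell2_zero ell2_add ell2_scale)
    show "ell2_ip Y x (y + z) = ell2_ip Y x y + ell2_ip Y x z"
      if "x \<in> ell2 Y" "y \<in> ell2 Y" "z \<in> ell2 Y" for x y z
      using infsum_add[OF ell2_ip_summable[OF that(1,2)] ell2_ip_summable[OF that(1,3)]]
      by (simp add: ell2_ip_def ring_distribs)
    show "ell2_ip Y x (fun_scale c y) = c * ell2_ip Y x y" for x y c
      using infsum_cmult_right'[of c "\<lambda>k. cnj (x k) * y k" Y] by (simp add: ell2_ip_def mult.left_commute)
    show "ell2_ip Y y x = cnj (ell2_ip Y x y)" for x y
      by (simp add: ell2_ip_def mult.commute flip: infsum_cnj)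
    show "0 \<le> Re (ell2_ip Y x x)" if "x \<in> ell2 Y" for x
      using ell2_sum_le[OF that, of "{}"] by simp
    show "x = 0" if "x \<in> ell2 Y" "ell2_ip Y x x = 0" for x
    proof
      fix y show "x y = 0 y" using ell2_component_le[OF that(1), of y] that(2) by simp
    qed
  qed (rule ell2_complete)
qed

lemma ell2_finite_support:
  assumes "finite P" "P \<subseteq> Y" "\<And>y. y \<notin> P \<Longrightarrow> f y = 0"
  shows "f \<in> ell2 Y" "ell2_ip Y f g = (\<Sum>y\<in>P. cnj (f y) * g y)"
proof -
  have "(\<lambda>y. (cmod (f y))\<^sup>2) summable_on P" using assms(1) by simp
  then have "(\<lambda>y. (cmod (f y))\<^sup>2) summable_on Y"
    using assms(2,3) by (subst summable_on_cong_neutral[of P Y _ "\<lambda>y. (cmod (f y))\<^sup>2"]) auto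
  then show "f \<in> ell2 Y" using assms(2,3) by (auto simp: ell2_def)
  have "ell2_ip Y f g = infsum (\<lambda>y. cnj (f y) * g y) P"
    unfolding ell2_ip_def by (rule infsum_cong_neutral) (use assms in auto)
  then show "ell2_ip Y f g = (\<Sum>y\<in>P. cnj (f y) * g y)" using assms(1) by simp
qed

text \<open>The group permutes a basis up to phases; \<open>ph h y\<close> is the phase collected in
  passing from \<open>y\<close> to \<open>act h y\<close>, whence the cocycle rule. Representations
  induced from a character have this shape, and tensor powers keep it.\<close>

locale monomial_rep = group G for G :: "('a, 'b) monoid_scheme" (structure) +
  fixes Y :: "'y set" and act :: "'a \<Rightarrow> 'y \<Rightarrow> 'y" and ph :: "'a \<Rightarrow> 'y \<Rightarrow> complex"
  assumes act_closed: "\<lbrakk>h \<in> carrier G; y \<in> Y\<rbrakk> \<Longrightarrow> act h y \<in> Y"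
    and act_one: "y \<in> Y \<Longrightarrow> act \<one> y = y"
    and act_mult: "\<lbrakk>h \<in> carrier G; k \<in> carrier G; y \<in> Y\<rbrakk> \<Longrightarrow> act (h \<otimes> k) y = act h (act k y)"
    and ph_mult: "\<lbrakk>h \<in> carrier G; k \<in> carrier G; y \<in> Y\<rbrakk> \<Longrightarrow> ph (h \<otimes> k) y = ph h (act k y) * ph k y"
    and norm_ph: "\<lbrakk>h \<in> carrier G; y \<in> Y\<rbrakk> \<Longrightarrow> cmod (ph h y) = 1"
begin

text \<open>The point mass at \<open>y\<close> goes to \<open>ph h y\<close> times the point mass at
  \<open>act h y\<close>; the inverse appears because the value at a point comes from the point sent
  there.\<close>

definition mop :: "'a \<Rightarrow> ('y \<Rightarrow> complex) \<Rightarrow> 'y \<Rightarrow> complex" where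
  "mop h f = (\<lambda>y. if y \<in> Y then ph h (act (inv h) y) * f (act (inv h) y) else 0)"

lemma ph_one: "y \<in> Y \<Longrightarrow> ph \<one> y = 1"
  using ph_mult[of \<one> \<one> y] norm_ph[of \<one> y] act_one[of y] by auto

lemma act_inv: "\<lbrakk>h \<in> carrier G; y \<in> Y\<rbrakk> \<Longrightarrow> act h (act (inv h) y) = y"
  "\<lbrakk>h \<in> carrier G; y \<in> Y\<rbrakk> \<Longrightarrow> act (inv h) (act h y) = y"
  using act_mult[of h "inv h" y] act_mult[of "inv h" h y] act_one[of y] by auto

lemma act_bij: "h \<in> carrier G \<Longrightarrow> bij_betw (act h) Y Y"
  by (rule bij_betwI[where g = "act (inv h)"]) (auto simp: act_closed act_inv)

lemma cmod_mop: "\<lbrakk>h \<in> carrier G; y \<in> Y\<rbrakk> \<Longrightarrow> cmod (mop h f y) = cmod (f (act (inv h) y))"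
  by (simp add: mop_def norm_mult norm_ph act_closed)

lemma mop_ell2: assumes h: "h \<in> carrier G" and f: "f \<in> ell2 Y" shows "mop h f \<in> ell2 Y"
proof -
  have "(\<lambda>y. (cmod (f (act (inv h) y)))\<^sup>2) summable_on Y"
    using summable_on_reindex_bij_betw[OF act_bij[of "inv h"], of "\<lambda>y. (cmod (f y))\<^sup>2"] h f
    by (simp add: ell2_def)
  then have "(\<lambda>y. (cmod (mop h f y))\<^sup>2) summable_on Y"
    by (rule summable_on_cong[THEN iffD1, rotated]) (simp add: cmod_mop h)
  then show ?thesis by (simp add: ell2_def mop_def)
qed

lemma mop_unitary_rep: "unitary_rep fun_scale (ell2 Y) (ell2_ip Y) G mop"
proof (intro unitary_rep.intro ell2_hilbert is_group unitary_rep_axioms.intro)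
  fix h f g c assume h: "h \<in> carrier G"
  show "mop h f \<in> ell2 Y" if "f \<in> ell2 Y" using mop_ell2[OF h that] .
  show "mop h (f + g) = mop h f + mop h g" by (auto simp: mop_def fun_eq_iff ring_distribs)
  show "mop h (fun_scale c f) = fun_scale c (mop h f)" by (auto simp: mop_def fun_eq_iff)
  have "cnj (mop h f y) * mop h g y = cnj (f (act (inv h) y)) * g (act (inv h) y)" if y: "y \<in> Y" for y
  proof -
    have "cnj (ph h (act (inv h) y)) * ph h (act (inv h) y) = 1"
      using norm_ph[OF h act_closed[of "inv h" y]] h y complex_norm_square[of "ph h (act (inv h) y)"]
      by (simp add: mult.commute)
    then show ?thesis using y by (simp add: mop_def algebra_simps)
  qed
  then have "ell2_ip Y (mop h f) (mop h g) = (\<Sum>\<^sub>\<infinity>y\<in>Y. cnj (f (act (inv h) y)) * g (act (inv h) y))"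
    unfolding ell2_ip_def by (intro infsum_cong) auto
  also have "\<dots> = ell2_ip Y f g"
    unfolding ell2_ip_def
    using infsum_reindex_bij_betw[OF act_bij[of "inv h"], of "\<lambda>y. cnj (f y) * g y"] h by simp
  finally show "ell2_ip Y (mop h f) (mop h g) = ell2_ip Y f g" .
next
  fix f assume "f \<in> ell2 Y"
  then show "mop \<one> f = f" by (auto simp: mop_def fun_eq_iff ph_one act_one ell2_def)
next
  fix h k f assume hk: "h \<in> carrier G" "k \<in> carrier G"
  show "mop (h \<otimes> k) f = mop h (mop k f)"
  proof
    fix y
    show "mop (h \<otimes> k) f y = mop h (mop k f) y"
    proof (cases "y \<in> Y")
      case y: True
      have hy: "act (inv h) y \<in> Y" using hk y by (simp add: act_closed)
      define z where "z = act (inv k) (act (inv h) y)"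
      have z: "z \<in> Y" "act k z = act (inv h) y" using hk hy by (auto simp: z_def act_closed act_inv)
      have "act (inv (h \<otimes> k)) y = z"
        using hk y by (simp add: inv_mult_group act_mult z_def)
      then show ?thesis using y hy ph_mult[OF hk z(1)] z(2) by (simp add: mop_def z_def)
    qed (simp add: mop_def)
  qed
qed

end

text \<open>The $k$-th tensor power of a monomial representation lives on the words of length $k$.\<close>
lemma monomial_rep_lists:
  fixes G (structure)
  assumes "monomial_rep G Y act ph"
  shows "monomial_rep G {ys. length ys = k \<and> set ys \<subseteq> Y} (\<lambda>h. map (act h)) (\<lambda>h ys. prod_list (map (ph h) ys))"
proof -
  interpret monomial_rep G Y act ph by fact
  show ?thesis
  proof
    fix h ys assume "h \<in> carrier G" "ys \<in> {ys. length ys = k \<and> set ys \<subseteq> Y}"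
    then show "map (act h) ys \<in> {ys. length ys = k \<and> set ys \<subseteq> Y}" by (auto simp: act_closed subset_iff)
  next
    fix ys assume "ys \<in> {ys. length ys = k \<and> set ys \<subseteq> Y}"
    then show "map (act \<one>) ys = ys" by (auto intro!: map_idI simp: act_one subset_iff)
  next
    fix h l ys assume *: "h \<in> carrier G" "l \<in> carrier G" "ys \<in> {ys. length ys = k \<and> set ys \<subseteq> Y}"
    then show "map (act (h \<otimes> l)) ys = map (act h) (map (act l) ys)"
      by (auto simp: act_mult subset_iff)
    have "set ys \<subseteq> Y" using * by simp
    then show "prod_list (map (ph (h \<otimes> l)) ys) = prod_list (map (ph h) (map (act l) ys)) * prod_list (map (ph l) ys)"
      by (induction ys) (use * ph_mult in auto)
  next
    fix h ys assume *: "h \<in> carrier G" "ys \<in> {ys. length ys = k \<and> set ys \<subseteq> Y}"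
    then have "set ys \<subseteq> Y" by simp
    then show "cmod (prod_list (map (ph h) ys)) = 1"
      by (induction ys) (use * norm_ph in \<open>auto simp: norm_mult\<close>)
  qed
qed

section \<open>Numerical ranges of operators with a spectral gap\<close>

context complex_hilbert_space
begin

text \<open>If s > 0 is the supremum of the quadratic form over unit vectors of \<open>D\<close>,
  nearly maximising vectors are approximate eigenvectors of \<open>T\<close> for s, and the gap
  forces \<open>\<kappa> \<le> s\<close>. No spectral theory is invoked: \<open>D\<close> will be a
  space of finitely supported vectors, not necessarily complete, where the supremum need not be
  attained. Halving \<kappa> pays for that.\<close>

lemma numerical_range_gap:
  fixes D :: "'h set" and T :: "'h \<Rightarrow> 'h"
  assumes DH: "D \<subseteq> H"
    and Dadd: "\<And>x y. \<lbrakk>x \<in> D; y \<in> D\<rbrakk> \<Longrightarrow> x + y \<in> D" and Dscale: "\<And>x c. x \<in> D \<Longrightarrow> c *s x \<in> D"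
    and TD: "\<And>x. x \<in> D \<Longrightarrow> T x \<in> D"
    and Tadd: "\<And>x y. \<lbrakk>x \<in> D; y \<in> D\<rbrakk> \<Longrightarrow> T (x + y) = T x + T y"
    and Tscale: "\<And>x c. x \<in> D \<Longrightarrow> T (c *s x) = c *s T x"
    and sym: "\<And>x y. \<lbrakk>x \<in> D; y \<in> D\<rbrakk> \<Longrightarrow> ip (T x) y = ip x (T y)"
    and bound: "\<And>x. x \<in> D \<Longrightarrow> hnorm (T x) \<le> R * hnorm x"
    and gap: "\<And>x. x \<in> D \<Longrightarrow> \<kappa> * hnorm x \<le> hnorm (T x)" and \<kappa>: "0 < \<kappa>"
    and x0: "x0 \<in> D" "0 < Re (ip x0 (T x0))"
  obtains x where "x \<in> D" "hnorm x = 1" "\<kappa> / 2 \<le> Re (ip x (T x))"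
proof -
  define S where "S = {Re (ip x (T x)) | x. x \<in> D \<and> hnorm x = 1}"
  have inH: "x \<in> H" if "x \<in> D" for x using DH that by blast
  have q_le: "\<bar>Re (ip x (T x))\<bar> \<le> R * (hnorm x)\<^sup>2" if x: "x \<in> D" for x
  proof -
    have "\<bar>Re (ip x (T x))\<bar> \<le> hnorm x * hnorm (T x)"
      using Cauchy_Schwarz[OF inH[OF x] inH[OF TD[OF x]]] abs_Re_le_cmod order_trans by blast
    also have "\<dots> \<le> hnorm x * (R * hnorm x)"
      by (intro mult_left_mono bound x hnorm_ge0 inH)
    finally show ?thesis by (simp add: power2_eq_square mult_ac)
  qed
  have q_scale: "Re (ip (of_real t *s x) (T (of_real t *s x))) = t\<^sup>2 * Re (ip x (T x))" if x: "x \<in> D" for x t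
    using x by (simp add: Tscale ip_scale ip_scale_left inH Dscale TD H_closed power2_eq_square)
  have normalize: "(1 / hnorm x)\<^sup>2 * Re (ip x (T x)) \<in> S" if x: "x \<in> D" "hnorm x \<noteq> 0" for x
  proof -
    have "hnorm (of_real (1 / hnorm x) *s x) = 1"
      using x hnorm_ge0[OF inH[OF x(1)]] by (simp add: hnorm_scale inH norm_divide)
    then show ?thesis
      unfolding S_def using q_scale[OF x(1), of "1 / hnorm x"] Dscale[OF x(1)]
      by (intro CollectI exI[of _ "of_real (1 / hnorm x) *s x"]) auto
  qed
  have bdd: "bdd_above S"
  proof (rule bdd_aboveI[of _ R])
    fix a assume "a \<in> S"
    then obtain x where "x \<in> D" "hnorm x = 1" "a = Re (ip x (T x))" by (auto simp: S_def)
    then show "a \<le> R" using q_le[of x] by simp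
  qed
  have n0: "hnorm x0 \<noteq> 0"
    using q_le[OF x0(1)] x0(2) by auto
  define s where "s = Sup S"
  have s_upper: "y \<le> s" if "y \<in> S" for y unfolding s_def by (rule cSup_upper[OF that bdd])
  have s0: "0 < s"
  proof -
    have "0 < (1 / hnorm x0)\<^sup>2 * Re (ip x0 (T x0))" using x0(2) n0 by (intro mult_pos_pos) auto
    then show ?thesis using s_upper[OF normalize[OF x0(1) n0]] by linarith
  qed
  have Sne: "S \<noteq> {}" using normalize[OF x0(1) n0] by blast
  have q_s: "Re (ip x (T x)) \<le> s * (hnorm x)\<^sup>2" if x: "x \<in> D" for x
  proof (cases "hnorm x = 0")
    case True then show ?thesis using q_le[OF x] by simp
  next
    case False
    have "(1 / hnorm x)\<^sup>2 * Re (ip x (T x)) \<le> s" by (rule s_upper[OF normalize[OF x False]])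
    then have "(hnorm x)\<^sup>2 * ((1 / hnorm x)\<^sup>2 * Re (ip x (T x))) \<le> (hnorm x)\<^sup>2 * s"
      by (intro mult_left_mono) auto
    then show ?thesis using False by (simp add: power_divide mult.commute)
  qed
  have R0: "0 \<le> R"
  proof -
    have "0 \<le> R * hnorm x0" using bound[OF x0(1)] hnorm_ge0[OF inH[OF TD[OF x0(1)]]] by linarith
    then show ?thesis using n0 hnorm_ge0[OF inH[OF x0(1)]] by (simp add: zero_le_mult_iff)
  qed
  \<comment> \<open>The Cauchy-Schwarz estimate for the nonnegative form of s - T, whose form is
    bounded by s + R.\<close>
  have key: "(hnorm (of_real s *s x - T x))\<^sup>2 \<le> (s + R) * (s - Re (ip x (T x)))"
    if x: "x \<in> D" "hnorm x = 1" for x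
  proof -
    define y where "y = of_real s *s x + (-1) *s T x"
    have y: "y \<in> D" unfolding y_def by (intro Dadd Dscale TD x)
    have y_eq: "of_real s *s x - T x = y" by (simp add: y_def)
    \<comment> \<open>With \<open>y\<close> the value of s - T at \<open>x\<close>, the form of s -
      T at x - t y is at most its value at \<open>x\<close>, minus 2 t times the squared norm of
      \<open>y\<close>, plus t^2 (s + R) times it. This \<open>t\<close> minimises that bound, which
      must stay nonnegative.\<close>
    define t where "t = 1 / (s + R)"
    define z where "z = x + of_real (- t) *s y"
    have z: "z \<in> D" unfolding z_def by (intro Dadd Dscale x y)
    note H = inH[OF x(1)] inH[OF y] inH[OF TD[OF x(1)]] inH[OF TD[OF y]] inH[OF z] H_closed
    have xx: "ip x x = 1" using ip_self[OF inH[OF x(1)]] x(2) by simp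
    have yy: "ip y y = of_real ((hnorm y)\<^sup>2)" by (rule ip_self[OF inH[OF y]])
    have cross: "Re (ip x y) * s - Re (ip x (T y)) = (hnorm y)\<^sup>2"
    proof -
      have "ip y y = of_real s * ip x y - ip x (T y)"
        using H sym[OF x(1) y] by (subst (1) y_def) (simp add: ip_add_left ip_scale_left ip_diff_left)
      then show ?thesis using yy by (simp add: complex_eq_iff mult.commute)
    qed
    have sym2: "Re (ip y (T x)) = Re (ip x (T y))" "Re (ip y x) = Re (ip x y)"
      using sym[OF x(1) y] ip_cnj[OF inH[OF TD[OF x(1)]] inH[OF y]] ip_cnj[OF inH[OF x(1)] inH[OF y]]
      by simp_all
    have Tz: "T z = T x + of_real (- t) *s T y"
      unfolding z_def by (simp only: Tadd[OF x(1) Dscale[OF y]] Tscale[OF y])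
    have "ip z (T z) = ip x (T x) - of_real t * ip x (T y) - of_real t * ip y (T x) + of_real (t * t) * ip y (T y)"
      unfolding Tz unfolding z_def using H
      by (simp add: ip_add ip_add_left ip_scale ip_scale_left ip_diff ip_diff_left algebra_simps)
    then have "Re (ip z (T z)) = Re (ip x (T x)) - 2 * t * Re (ip x (T y)) + t\<^sup>2 * Re (ip y (T y))"
      using sym2 by (simp add: power2_eq_square)
    moreover have "(hnorm z)\<^sup>2 = 1 - 2 * t * Re (ip x y) + t\<^sup>2 * (hnorm y)\<^sup>2"
    proof -
      have "ip z z = ip x x - of_real t * ip x y - of_real t * ip y x + of_real (t * t) * ip y y"
        unfolding z_def using H Dscale[OF y]
        by (simp add: ip_add ip_add_left ip_scale ip_scale_left ip_diff ip_diff_left algebra_simps)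
      then have "Re (ip z z) = 1 - 2 * t * Re (ip x y) + t\<^sup>2 * (hnorm y)\<^sup>2"
        using sym2 by (simp add: xx yy power2_eq_square flip: of_real_power of_real_mult)
      then show ?thesis using ip_self[OF inH[OF z]] by simp
    qed
    moreover have "Re (ip z (T z)) \<le> s * (hnorm z)\<^sup>2" by (rule q_s[OF z])
    ultimately have "0 \<le> s * (1 - 2 * t * Re (ip x y) + t\<^sup>2 * (hnorm y)\<^sup>2) -
        (Re (ip x (T x)) - 2 * t * Re (ip x (T y)) + t\<^sup>2 * Re (ip y (T y)))" by simp
    also have "\<dots> = s - Re (ip x (T x)) - 2 * t * (Re (ip x y) * s - Re (ip x (T y)))
        + t\<^sup>2 * (s * (hnorm y)\<^sup>2 - Re (ip y (T y)))" by (simp add: algebra_simps)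
    also have "\<dots> \<le> s - Re (ip x (T x)) - 2 * t * (hnorm y)\<^sup>2 + t\<^sup>2 * ((s + R) * (hnorm y)\<^sup>2)"
      using q_le[OF y] unfolding cross by (intro add_left_mono mult_left_mono) (auto simp: algebra_simps)
    also have "t\<^sup>2 * ((s + R) * (hnorm y)\<^sup>2) = t * (hnorm y)\<^sup>2"
      using s0 R0 by (simp add: t_def power2_eq_square)
    finally have "t * (hnorm y)\<^sup>2 \<le> s - Re (ip x (T x))" by simp
    then show ?thesis using s0 R0 by (simp add: y_eq t_def field_simps)
  qed
  have "\<kappa> \<le> s"
  proof (rule ccontr)
    assume "\<not> \<kappa> \<le> s"
    then have d: "0 < \<kappa> - s" by simp
    \<comment> \<open>Chosen so that \<open>(s + R) * e\<close> is half of the square of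
      \<open>\<kappa> - s\<close>; at a vector within \<open>e\<close> of the supremum,
      \<open>key\<close> then contradicts the gap.\<close>
    define e where "e = (\<kappa> - s)\<^sup>2 / (2 * (s + R))"
    have e: "0 < e" using d s0 R0 by (simp add: e_def)
    have "s - e < Sup S" using e by (simp add: s_def)
    then obtain a where "a \<in> S" "s - e < a" using Sne by (rule less_cSupE)
    then obtain x where x: "x \<in> D" "hnorm x = 1" "s - e < Re (ip x (T x))" by (auto simp: S_def)
    have xH: "of_real s *s x - T x \<in> H" "T x - of_real s *s x \<in> H" "T x \<in> H" "of_real s *s x \<in> H"
      using inH[OF x(1)] inH[OF TD[OF x(1)]] H_closed by auto
    have "\<kappa> \<le> hnorm (T x)" using gap[OF x(1)] x(2) by simp
    also have "\<dots> = hnorm (of_real s *s x + (-1) *s (of_real s *s x - T x))" by simp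
    also have "\<dots> \<le> hnorm (of_real s *s x) + hnorm ((-1) *s (of_real s *s x - T x))"
      by (intro hnorm_triangle H_closed xH)
    also have "\<dots> = s + hnorm (of_real s *s x - T x)"
      using s0 x(2) hnorm_scale[OF inH[OF x(1)], of "of_real s"] hnorm_scale[OF xH(1), of "-1"] by simp
    finally have "\<kappa> - s \<le> hnorm (of_real s *s x - T x)" by simp
    then have "(\<kappa> - s)\<^sup>2 \<le> (hnorm (of_real s *s x - T x))\<^sup>2" using d by (intro power_mono) auto
    also have "\<dots> \<le> (s + R) * (s - Re (ip x (T x)))" by (rule key[OF x(1,2)])
    also have "\<dots> < (s + R) * e" using x(3) s0 R0 by (intro mult_strict_left_mono) auto
    also have "\<dots> = (\<kappa> - s)\<^sup>2 / 2"
    proof -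
      have *: "w * (d / (2 * w)) = d / 2" if "w \<noteq> 0" for w d :: real using that by simp
      show ?thesis unfolding e_def by (rule *) (use s0 R0 in simp)
    qed
    finally show False using d by simp
  qed
  then have "\<kappa> / 2 < Sup S" using \<kappa> by (simp add: s_def)
  then obtain a where "a \<in> S" "\<kappa> / 2 < a" using Sne by (rule less_cSupE)
  then obtain x where "x \<in> D" "hnorm x = 1" "\<kappa> / 2 < Re (ip x (T x))" by (auto simp: S_def)
  then show thesis by (intro that[of x]) simp_all
qed

end

section \<open>Almost invariant vectors in induced representations\<close>

text \<open>The chord \<open>2 * \<bar>sin (t/2)\<bar>\<close> is no longer than the arc.\<close>

lemma cmod_cis_diff_one_le: "cmod (cis t - 1) \<le> \<bar>t\<bar>"
proof -
  have "(cmod (cis t - 1))\<^sup>2 = (cos t - 1)\<^sup>2 + (sin t)\<^sup>2" by (simp add: cmod_def)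
  also have "\<dots> = 2 - 2 * cos t"
    using sin_cos_squared_add[of t] by (simp add: power2_eq_square algebra_simps)
  also have "\<dots> = 4 * (sin (t/2))\<^sup>2" using cos_double_sin[of "t/2"] by simp
  also have "\<dots> \<le> 4 * \<bar>t/2\<bar>\<^sup>2"
    using abs_sin_x_le_abs_x[of "t/2"] by (intro mult_left_mono) (auto intro: abs_le_square_iff[THEN iffD1])
  also have "\<dots> = \<bar>t\<bar>\<^sup>2" by (simp add: power2_eq_square)
  finally show ?thesis by (rule power2_le_imp_le) simp
qed

text \<open>Induces from a subgroup \<open>M\<close> to \<open>G\<close> the character of
  \<open>M\<close> that turns the exponent \<open>c\<close> into an angle of that many times pi/n.
  \<open>T\<close> holds one representative of each left coset of \<open>M\<close> in
  \<open>G\<close>, \<open>Z\<close> those coming from \<open>K\<close>. The sum in the last clause,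
  divided by \<open>card A\<close>, is the matrix coefficient of \<open>h\<close> at the normalised
  indicator of \<open>A\<close>, so the clause makes this vector almost invariant. Induction goes up
  to \<open>G\<close> because the full norm sees representations of \<open>G\<close>.\<close>

lemma exists_almost_invariant_monomial_rep:
  fixes G (structure) and \<delta> :: real
  assumes G: "group G" and K: "subgroup K G" and nil: "nilpotent_group (G\<lparr>carrier := K\<rparr>)"
    and g: "g \<in> K" and inf: "group.ord G g = 0" and F: "finite F" "F \<subseteq> K" and \<delta>: "0 < \<delta>"
  obtains T Z :: "'a set" and act :: "'a \<Rightarrow> 'a \<Rightarrow> 'a" and ph :: "'a \<Rightarrow> 'a \<Rightarrow> complex" and n :: nat and A
  where "monomial_rep G T act ph" "Z \<subseteq> T" "\<And>h x. \<lbrakk>h \<in> K; x \<in> Z\<rbrakk> \<Longrightarrow> act h x \<in> Z" "0 < n"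
    "\<And>x. x \<in> Z \<Longrightarrow> act g x = x \<and> ph g x = cis (pi / n)"
    "finite A" "A \<noteq> {}" "A \<subseteq> Z"
    "\<And>h. h \<in> F \<Longrightarrow> cmod ((\<Sum>x\<in>A. if act h x \<in> A then ph h x else 0) - card A) \<le> \<delta> * card A"
proof -
  interpret group G by (rule G)
  define KG where "KG = G\<lparr>carrier := K\<rparr>"
  interpret KG: group KG unfolding KG_def by (rule subgroup_imp_group[OF K])
  have KG_simps: "carrier KG = K" "mult KG = mult G" "one KG = one G" by (simp_all add: KG_def)
  have KG_inv: "inv\<^bsub>KG\<^esub> x = inv x" if "x \<in> K" for x
    using m_inv_consistent[OF K that] by (simp add: KG_def)
  have Kc: "x \<in> carrier G" if "x \<in> K" for x by (rule subgroup.mem_carrier[OF K that])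
  have gpow: "g [^]\<^bsub>KG\<^esub> k \<noteq> \<one>\<^bsub>KG\<^esub>" if "0 < k" for k :: nat
  proof -
    have "g [^] k \<noteq> \<one>" using inf that ord_eq_0[OF Kc[OF g]] by simp
    then show ?thesis using nat_pow_consistent[of g k K] by (simp add: KG_def)
  qed
  obtain M and c :: "'a \<Rightarrow> int" where M: "subgroup M KG"
    and cmult: "\<And>x y. \<lbrakk>x \<in> M; y \<in> M\<rbrakk> \<Longrightarrow> c (x \<otimes>\<^bsub>KG\<^esub> y) = c x + c y"
    and cg: "\<And>h. h \<in> carrier KG \<Longrightarrow> inv\<^bsub>KG\<^esub> h \<otimes>\<^bsub>KG\<^esub> g \<otimes>\<^bsub>KG\<^esub> h \<in> M \<and> c (inv\<^bsub>KG\<^esub> h \<otimes>\<^bsub>KG\<^esub> g \<otimes>\<^bsub>KG\<^esub> h) = 1"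
    and fol: "KG.rel_folner (carrier KG) M"
    using KG.exists_central_character[of g] nil g gpow unfolding KG_simps KG_def[symmetric] by metis
  have MG: "subgroup M G" using incl_subgroup[OF K] M by (simp add: KG_def)
  have MK: "M \<subseteq> K" using subgroup.subset[OF M] by (simp add: KG_simps)
  note Mm = subgroup.m_closed[OF MG] and Mi = subgroup.m_inv_closed[OF MG] and M1 = subgroup.one_closed[OF MG]
  have Mc: "x \<in> carrier G" if "x \<in> M" for x by (rule subgroup.mem_carrier[OF MG that])

  \<comment> \<open>The chosen representative of the coset of \<open>x\<close>. It depends on the
    coset only, since equivalent elements give the choice operator the same predicate.\<close>
  define r where "r x = (SOME y. y \<in> carrier G \<and> inv x \<otimes> y \<in> M)" for x
  have r: "r x \<in> carrier G \<and> inv x \<otimes> r x \<in> M" if "x \<in> carrier G" for x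
    unfolding r_def by (rule someI[of _ x]) (use that M1 in simp)
  have r_inv: "inv (r x) \<otimes> x \<in> M" if x: "x \<in> carrier G" for x
    using Mi[of "inv x \<otimes> r x"] r[OF x] x by (simp add: inv_mult_group)
  have r_eq: "r x = r x'" if x: "x \<in> carrier G" "x' \<in> carrier G" "inv x \<otimes> x' \<in> M" for x x'
  proof -
    have "inv x \<otimes> y \<in> M \<longleftrightarrow> inv x' \<otimes> y \<in> M" if y: "y \<in> carrier G" for y
    proof
      assume "inv x \<otimes> y \<in> M"
      from Mm[OF Mi[OF x(3)] this] show "inv x' \<otimes> y \<in> M"
        using x y by (simp add: inv_mult_group m_assoc mult_inv_cancel)
    next
      assume "inv x' \<otimes> y \<in> M"
      from Mm[OF x(3) this] show "inv x \<otimes> y \<in> M"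
        using x y by (simp add: m_assoc mult_inv_cancel)
    qed
    then show ?thesis unfolding r_def by (metis (no_types, lifting))
  qed
  have rr: "r (r x) = r x" if x: "x \<in> carrier G" for x
    by (rule r_eq[symmetric]) (use r[OF x] x in auto)
  have rK: "r x \<in> K" if x: "x \<in> K" for x
  proof -
    have "x \<otimes> (inv x \<otimes> r x) \<in> K" using r[OF Kc[OF x]] MK by (intro subgroup.m_closed[OF K x]) auto
    then show ?thesis using r[OF Kc[OF x]] Kc[OF x] by (simp add: mult_inv_cancel)
  qed
  define act where "act h x = r (h \<otimes> x)" for h x
  \<comment> \<open>The exponent of the \<open>M\<close>-part of \<open>h \<otimes> x\<close>
    relative to its representative: the cocycle of the induced representation.\<close>
  define e where "e h x = c (inv (r (h \<otimes> x)) \<otimes> (h \<otimes> x))" for h x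
  define T where "T = r ` carrier G"
  define Z where "Z = r ` K"
  have Tc: "x \<in> carrier G" "r x = x" if "x \<in> T" for x using that r rr by (auto simp: T_def)
  have Zc: "x \<in> K" "r x = x" if "x \<in> Z" for x using that rK rr Kc by (auto simp: Z_def)
  have act_mult: "act (h \<otimes> k) x = act h (act k x)"
    if hk: "h \<in> carrier G" "k \<in> carrier G" "x \<in> T" for h k x
  proof -
    note x = Tc(1)[OF hk(3)]
    have kx: "k \<otimes> x \<in> carrier G" using hk x by simp
    show ?thesis unfolding act_def
    proof (rule r_eq)
      have "inv (h \<otimes> k \<otimes> x) \<otimes> (h \<otimes> r (k \<otimes> x)) = inv (k \<otimes> x) \<otimes> r (k \<otimes> x)"
        using hk x r[OF kx] by (simp add: inv_mult_group m_assoc mult_inv_cancel)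
      then show "inv (h \<otimes> k \<otimes> x) \<otimes> (h \<otimes> r (k \<otimes> x)) \<in> M" using r[OF kx] by simp
    qed (use hk x r[OF kx] in auto)
  qed
  have e_mult: "e (h \<otimes> k) x = e h (act k x) + e k x"
    if hk: "h \<in> carrier G" "k \<in> carrier G" "x \<in> T" for h k x
  proof -
    note x = Tc(1)[OF hk(3)]
    have kx: "k \<otimes> x \<in> carrier G" using hk x by simp
    define w where "w = r (k \<otimes> x)"
    have w: "w \<in> carrier G" using r[OF kx] by (simp add: w_def)
    have hw: "h \<otimes> w \<in> carrier G" using hk w by simp
    define v where "v = r (h \<otimes> w)"
    have v: "v \<in> carrier G" using r[OF hw] by (simp add: v_def)
    have v2: "r (h \<otimes> k \<otimes> x) = v" using act_mult[OF hk] by (simp add: act_def w_def v_def)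
    have "inv v \<otimes> (h \<otimes> k \<otimes> x) = (inv v \<otimes> (h \<otimes> w)) \<otimes> (inv w \<otimes> (k \<otimes> x))"
      using hk x v w by (simp add: m_assoc mult_inv_cancel)
    moreover have "inv v \<otimes> (h \<otimes> w) \<in> M" "inv w \<otimes> (k \<otimes> x) \<in> M"
      using r_inv[OF hw] r_inv[OF kx] by (simp_all add: v_def w_def)
    ultimately have "c (inv v \<otimes> (h \<otimes> k \<otimes> x)) = c (inv v \<otimes> (h \<otimes> w)) + c (inv w \<otimes> (k \<otimes> x))"
      using cmult[of "inv v \<otimes> (h \<otimes> w)" "inv w \<otimes> (k \<otimes> x)"] by (simp only: KG_simps)
    moreover have "e (h \<otimes> k) x = c (inv v \<otimes> (h \<otimes> k \<otimes> x))" by (simp only: e_def v2)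
    moreover have "e h (act k x) = c (inv v \<otimes> (h \<otimes> w))" by (simp only: e_def act_def w_def v_def)
    moreover have "e k x = c (inv w \<otimes> (k \<otimes> x))" by (simp only: e_def w_def)
    ultimately show ?thesis by simp
  qed
  have rep: "monomial_rep G T act (\<lambda>h x. cis (\<theta> * e h x))" for \<theta> :: real
  proof
    fix h x assume hx: "h \<in> carrier G" "x \<in> T"
    have "h \<otimes> x \<in> carrier G" using hx(1) Tc(1)[OF hx(2)] by simp
    then show "act h x \<in> T" unfolding act_def T_def by (rule imageI)
  next
    fix x assume x: "x \<in> T"
    then show "act \<one> x = x" using Tc[OF x] by (simp add: act_def)
  next
    fix h k x assume hk: "h \<in> carrier G" "k \<in> carrier G" "x \<in> T"
    then show "act (h \<otimes> k) x = act h (act k x)" by (rule act_mult)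
    show "cis (\<theta> * e (h \<otimes> k) x) = cis (\<theta> * e h (act k x)) * cis (\<theta> * e k x)"
      by (simp add: e_mult[OF hk] cis_mult ring_distribs)
  qed simp
  have ZT: "Z \<subseteq> T" using Kc by (auto simp: Z_def T_def)
  have actZ: "act h x \<in> Z" if "h \<in> K" "x \<in> Z" for h x
    using subgroup.m_closed[OF K that(1) Zc(1)[OF that(2)]] by (auto simp: act_def Z_def)
  \<comment> \<open>For \<open>x\<close> in \<open>K\<close> the conjugate
    \<open>inv x \<otimes> g \<otimes> x\<close> lies in \<open>M\<close> with exponent 1, so
    \<open>g\<close> fixes the coset of \<open>x\<close> and contributes exactly one unit of
    phase.\<close>
  have act_g: "act g x = x \<and> e g x = 1" if x: "x \<in> Z" for x
  proof -
    note xK = Zc[OF x] and xc = Kc[OF Zc(1)[OF x]] and gc = Kc[OF g]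
    have "inv x \<otimes> (g \<otimes> x) \<in> M" "c (inv x \<otimes> (g \<otimes> x)) = 1"
      using cg[of x] xK xc gc by (simp_all add: KG_simps KG_inv m_assoc)
    then show ?thesis
      using r_eq[of x "g \<otimes> x"] xK xc gc by (simp add: act_def e_def)
  qed
  \<comment> \<open>Half of \<delta> is spent on points leaving the set, the other half on the
    phases.\<close>
  have "\<exists>A\<subseteq>carrier KG. KG.folner_set M F (\<delta>/2) A"
    using fol[unfolded KG.rel_folner_def, rule_format, of F "\<delta>/2"] F \<delta> by (simp add: KG_simps)
  then obtain A0 where A0: "A0 \<subseteq> K" "KG.folner_set M F (\<delta>/2) A0" by (auto simp: KG_simps)
  have A0c: "x \<in> carrier G" "x \<in> K" if "x \<in> A0" for x using A0(1) Kc that by auto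
  have finA0: "finite A0" "A0 \<noteq> {}" using A0(2) by (auto simp: KG.folner_set_def)
  have sep: "x = y" if "x \<in> A0" "y \<in> A0" "inv x \<otimes> y \<in> M" for x y
    using A0(2) that KG_inv[OF A0c(2)[OF that(1)]] by (auto simp: KG.folner_set_def KG_simps)
  \<comment> \<open>The Folner set is moved to the chosen representatives, on which
    \<open>act\<close> operates. Its elements lie in distinct cosets, so its size is
    unchanged.\<close>
  define A where "A = r ` A0"
  have inj: "inj_on r A0"
  proof (rule inj_onI)
    fix x y assume xy: "x \<in> A0" "y \<in> A0" "r x = r y"
    note c = A0c(1)[OF xy(1)] A0c(1)[OF xy(2)]
    have "inv x \<otimes> y = (inv x \<otimes> r x) \<otimes> (inv (r y) \<otimes> y)"
      using c r[OF c(1)] r[OF c(2)] xy(3) by (simp add: m_assoc mult_inv_cancel)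
    also have "\<dots> \<in> M" using Mm r[OF c(1)] r_inv[OF c(2)] by blast
    finally show "x = y" by (rule sep[OF xy(1,2)])
  qed
  have cA: "card A = card A0" by (simp add: A_def card_image inj)
  have A: "finite A" "A \<noteq> {}" "A \<subseteq> Z" using finA0 A0(1) by (auto simp: A_def Z_def)
  have bad: "real (card {x\<in>A. act h x \<notin> A}) \<le> \<delta>/2 * card A" if h: "h \<in> F" for h
  proof -
    have hK: "h \<in> K" "h \<in> carrier G" using F h Kc by auto
    have "{x\<in>A. act h x \<notin> A} \<subseteq> r ` KG.escaping M h A0"
    proof clarify
      fix z assume z: "z \<in> A" "act h z \<notin> A"
      then obtain x where x: "x \<in> A0" "z = r x" by (auto simp: A_def)
      note xc = A0c(1)[OF x(1)]
      have "inv\<^bsub>KG\<^esub> y \<otimes>\<^bsub>KG\<^esub> (h \<otimes>\<^bsub>KG\<^esub> x) \<notin> M" if y: "y \<in> A0" for y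
      proof
        assume m: "inv\<^bsub>KG\<^esub> y \<otimes>\<^bsub>KG\<^esub> (h \<otimes>\<^bsub>KG\<^esub> x) \<in> M"
        note yc = A0c[OF y]
        have m2: "inv y \<otimes> (h \<otimes> x) \<in> M" using m yc by (simp add: KG_simps KG_inv)
        have "inv y \<otimes> (h \<otimes> r x) = (inv y \<otimes> (h \<otimes> x)) \<otimes> (inv x \<otimes> r x)"
          using yc xc hK r[OF xc] by (simp add: m_assoc mult_inv_cancel)
        then have "inv y \<otimes> (h \<otimes> r x) \<in> M" using Mm m2 r[OF xc] by simp
        then have "r y = r (h \<otimes> r x)" using yc hK r[OF xc] by (intro r_eq) auto
        then have "act h z = r y" by (simp add: act_def x(2))
        then have "act h z \<in> A" unfolding A_def using y by blast
        then show False using z(2) by simp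
      qed
      then show "z \<in> r ` KG.escaping M h A0" using x by blast
    qed
    then have "card {x\<in>A. act h x \<notin> A} \<le> card (KG.escaping M h A0)"
      using finA0(1) by (intro surj_card_le) auto
    moreover have "real (card (KG.escaping M h A0)) \<le> \<delta>/2 * card A0"
      using A0(2) h by (simp add: KG.folner_set_def)
    ultimately show ?thesis unfolding cA by linarith
  qed
  define B where "B = (\<Sum>(h, x)\<in>F \<times> A. \<bar>real_of_int (e h x)\<bar>)"
  have B: "\<bar>real_of_int (e h x)\<bar> \<le> B" if "h \<in> F" "x \<in> A" for h x
    unfolding B_def
    using member_le_sum[of "(h, x)" "F \<times> A" "\<lambda>(h, x). \<bar>real_of_int (e h x)\<bar>"] F(1) A(1) that by auto
  have B0: "0 \<le> B" by (auto simp: B_def intro!: sum_nonneg)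
  \<comment> \<open>\<open>n\<close> is chosen last: \<open>A\<close> is finite, so \<open>B\<close>
    bounds the exponents over \<open>F\<close> and \<open>A\<close>, and a small enough angle pi/n
    brings all phases there within \<delta>/2 of 1.\<close>
  obtain n0 :: nat where n0: "2 * pi * B / \<delta> < n0" using reals_Archimedean2 by blast
  define n where "n = Suc n0"
  have n: "0 < n" "pi / n * B \<le> \<delta> / 2"
  proof -
    have "2 * pi * B / \<delta> \<le> n" using n0 by (simp add: n_def)
    then show "pi / n * B \<le> \<delta> / 2" using \<delta> by (simp add: field_simps n_def)
  qed (simp add: n_def)
  define ph where "ph h x = cis (pi / n * e h x)" for h x
  show thesis
  proof (rule that[of T act ph Z n A])
    show "monomial_rep G T act ph" using rep[of "pi / n"] by (simp add: ph_def[abs_def])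
    show "act g x = x \<and> ph g x = cis (pi / n)" if "x \<in> Z" for x
      using act_g[OF that] by (simp add: ph_def)
    show "cmod ((\<Sum>x\<in>A. if act h x \<in> A then ph h x else 0) - card A) \<le> \<delta> * card A" if h: "h \<in> F" for h
    proof -
      have "(\<Sum>x\<in>A. if act h x \<in> A then ph h x else 0) - card A =
          (\<Sum>x\<in>A. (if act h x \<in> A then ph h x else 0) - 1)" by (simp add: sum_subtractf)
      also have "cmod \<dots> \<le> (\<Sum>x\<in>A. \<delta>/2 + (if act h x \<notin> A then 1 else 0))"
      proof (rule sum_norm_le)
        fix x assume x: "x \<in> A"
        have "cmod (ph h x - 1) \<le> \<bar>pi / n * e h x\<bar>" unfolding ph_def by (rule cmod_cis_diff_one_le)
        also have "\<dots> = pi / n * \<bar>real_of_int (e h x)\<bar>" by (simp add: abs_mult)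
        also have "\<dots> \<le> pi / n * B" by (intro mult_left_mono B h x) simp
        also have "\<dots> \<le> \<delta> / 2" by (rule n(2))
        finally show "cmod ((if act h x \<in> A then ph h x else 0) - 1) \<le> \<delta>/2 + (if act h x \<notin> A then 1 else 0)"
          using \<delta> by auto
      qed
      also have "\<dots> = \<delta>/2 * card A + card {x\<in>A. act h x \<notin> A}"
        using A(1) by (simp add: sum.distrib sum.If_cases Int_def conj_commute)
      also have "\<dots> \<le> \<delta> * card A" using bad[OF h] by simp
      finally show ?thesis .
    qed
  qed (use ZT actZ n A in auto)
qed

section \<open>Transport of positivity along tensor powers\<close>

definition fin_supp :: "'y set \<Rightarrow> ('y \<Rightarrow> complex) set" where
  "fin_supp Z = {f. finite (supp f) \<and> supp f \<subseteq> Z}"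

lemma fin_supp_add:
  assumes "f \<in> fin_supp Z" "h \<in> fin_supp Z" shows "f + h \<in> fin_supp Z"
proof -
  have sub: "{y. (f + h) y \<noteq> 0} \<subseteq> supp f \<union> supp h" by auto
  moreover have "finite (supp f \<union> supp h)" "supp f \<union> supp h \<subseteq> Z"
    using assms by (auto simp: fin_supp_def)
  ultimately show ?thesis unfolding fin_supp_def by (blast intro: finite_subset)
qed

lemma fin_supp_scale: "f \<in> fin_supp Z \<Longrightarrow> (\<lambda>y. c * f y) \<in> fin_supp Z"
  using finite_subset[of "{y. c * f y \<noteq> 0}" "supp f"] by (auto simp: fin_supp_def)

lemma fin_supp_sum: "(\<And>i. i \<in> I \<Longrightarrow> f i \<in> fin_supp Z) \<Longrightarrow> sum f I \<in> fin_supp Z"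
  by (induction I rule: infinite_finite_induct) (auto simp: fin_supp_add, auto simp: fin_supp_def)

lemma fin_supp_ell2: "\<lbrakk>f \<in> fin_supp Z; Z \<subseteq> Y\<rbrakk> \<Longrightarrow> f \<in> ell2 Y"
  by (rule ell2_finite_support(1)[of "supp f"]) (auto simp: fin_supp_def)

lemma fin_supp_ip:
  "\<lbrakk>f \<in> fin_supp Z; Z \<subseteq> Y\<rbrakk> \<Longrightarrow> ell2_ip Y f h = (\<Sum>y | f y \<noteq> 0. cnj (f y) * h y)"
  by (rule ell2_finite_support(2)) (auto simp: fin_supp_def)

context unitary_rep
begin

lemma ip_rep_apply:
  assumes f: "f \<in> carrier CG" and \<xi>: "\<xi> \<in> H"
  shows "ip \<xi> (rep_apply scale U f \<xi>) = (\<Sum>h | f h \<noteq> 0. f h * ip \<xi> (U h \<xi>))"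
proof -
  have "ip \<xi> (rep_apply scale U f \<xi>) = (\<Sum>h | f h \<noteq> 0. ip \<xi> (f h *s U h \<xi>))"
    unfolding rep_apply_def using term_H[OF f _ \<xi>] by (intro ip_sum_right \<xi>) simp
  also have "\<dots> = (\<Sum>h | f h \<noteq> 0. f h * ip \<xi> (U h \<xi>))"
    using CG_supp[OF f] \<xi> by (intro sum.cong refl) (simp add: ip_scale U_closed)
  finally show ?thesis .
qed

text \<open>As \<open>c * c = 1\<close>, an eigenvector of \<open>g\<close> for \<open>c\<close> is
  one of \<open>inv g\<close> for the same \<open>c\<close>.\<close>

lemma rep_apply_cosine:
  assumes g: "g \<in> carrier G" and \<xi>: "\<xi> \<in> H" and e: "U g \<xi> = c *s \<xi>" "c * c = 1"
  shows "rep_apply scale U (cosine g) \<xi> = c *s \<xi>"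
proof -
  have ig: "inv g \<in> carrier G" using g by simp
  have "U (inv g) (U g \<xi>) = \<xi>" using U_mult[OF ig g \<xi>] U_one[OF \<xi>] g by simp
  then have "c *s U (inv g) \<xi> = \<xi>" using U_scale[OF ig \<xi>] e(1) by simp
  then have "c *s (c *s U (inv g) \<xi>) = c *s \<xi>" by simp
  then have "U (inv g) \<xi> = c *s \<xi>" using e(2) by simp
  then show ?thesis
    unfolding cosine_def rep_apply_scale rep_apply_add[OF CG_delta_closed[OF g] CG_delta_closed[OF ig]]
      rep_apply_delta[OF g] rep_apply_delta[OF ig] e(1)
    by (simp flip: scale_left_distrib)
qed

text \<open>Used at both ends of the argument. If the norm on the right is below 1, then at a
  nonzero \<xi> the form of \<open>u\<close> is positive for \<open>c = 1\<close> and negative for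
  \<open>c = -1\<close>.\<close>

lemma cosine_diff_bound:
  assumes g: "g \<in> carrier G" and \<xi>: "\<xi> \<in> H" and e: "U g \<xi> = of_real c *s \<xi>" "c * c = 1"
    and u: "u \<in> carrier CG"
  shows "\<bar>c * (hnorm \<xi>)\<^sup>2 - Re (ip \<xi> (rep_apply scale U u \<xi>))\<bar> \<le> nm (\<lambda>x. cosine g x - u x) * (hnorm \<xi>)\<^sup>2"
proof -
  note a = cosine_closed[OF g]
  note d = CG_closed(2)[OF a u]
  have c2: "(of_real c :: complex) * of_real c = 1" using e(2) by (metis of_real_1 of_real_mult)
  note dH = rep_apply_H[OF d \<xi>] and aH = rep_apply_H[OF a \<xi>] and uH = rep_apply_H[OF u \<xi>]
  have "ip \<xi> (rep_apply scale U (\<lambda>x. cosine g x - u x) \<xi>) = of_real (c * (hnorm \<xi>)\<^sup>2) - ip \<xi> (rep_apply scale U u \<xi>)"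
    using rep_apply_cosine[OF g \<xi> e(1) c2] ip_self[OF \<xi>] aH uH
    by (simp add: rep_apply_diff[OF a u] ip_diff[OF \<xi> _ uH] ip_scale \<xi> H_closed)
  then have "\<bar>c * (hnorm \<xi>)\<^sup>2 - Re (ip \<xi> (rep_apply scale U u \<xi>))\<bar> =
      \<bar>Re (ip \<xi> (rep_apply scale U (\<lambda>x. cosine g x - u x) \<xi>))\<bar>" by simp
  also have "\<dots> \<le> hnorm \<xi> * hnorm (rep_apply scale U (\<lambda>x. cosine g x - u x) \<xi>)"
    using Cauchy_Schwarz[OF \<xi> dH] abs_Re_le_cmod order_trans by blast
  also have "\<dots> \<le> hnorm \<xi> * (nm (\<lambda>x. cosine g x - u x) * hnorm \<xi>)"
    by (intro mult_left_mono hnorm_rep_apply_le_full_norm d \<xi> hnorm_ge0)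
  finally show ?thesis by (simp add: power2_eq_square mult_ac)
qed

text \<open>Applying \<open>b\<close> to the value of \<open>u\<close> returns \<xi> up to half its
  norm, so that value cannot be small. The constant depends on \<open>b\<close> only and is the same
  in every representation; adding 1 to \<open>nm b\<close> avoids a division by zero.\<close>

lemma approx_inverse_gap:
  assumes u: "u \<in> carrier CG" and b: "b \<in> carrier CG"
    and inv: "nm (\<lambda>x. (b \<star> u) x - oneCG x) \<le> 1/2" and \<xi>: "\<xi> \<in> H"
  shows "1 / (2 * (nm b + 1)) * hnorm \<xi> \<le> hnorm (rep_apply scale U u \<xi>)"
proof -
  note bu = CG_mult_closed[OF b u]
  note d = CG_closed(2)[OF bu CG_one_closed]
  note uH = rep_apply_H[OF u \<xi>]
  note nb = full_norm_nonneg[OF b] and hu = hnorm_ge0[OF uH]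
  define w where "w = rep_apply scale U (\<lambda>x. (b \<star> u) x - oneCG x) \<xi>"
  have wH: "w \<in> H" unfolding w_def by (rule rep_apply_H[OF d \<xi>])
  have w: "w = rep_apply scale U b (rep_apply scale U u \<xi>) - \<xi>"
    unfolding w_def by (simp add: rep_apply_diff[OF bu CG_one_closed] rep_apply_mult[OF b u \<xi>] rep_apply_one[OF \<xi>])
  have hw: "hnorm w \<le> 1/2 * hnorm \<xi>"
    using hnorm_rep_apply_le_full_norm[OF d \<xi>] mult_right_mono[OF inv hnorm_ge0[OF \<xi>]] by (simp add: w_def)
  have "hnorm \<xi> = hnorm (rep_apply scale U b (rep_apply scale U u \<xi>) + (-1) *s w)" by (simp add: w)
  also have "\<dots> \<le> hnorm (rep_apply scale U b (rep_apply scale U u \<xi>)) + hnorm ((-1) *s w)"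
    by (intro hnorm_triangle rep_apply_H b uH H_closed wH)
  also have "\<dots> \<le> nm b * hnorm (rep_apply scale U u \<xi>) + 1/2 * hnorm \<xi>"
    using hnorm_rep_apply_le_full_norm[OF b uH] hw hnorm_scale[OF wH, of "-1"] by simp
  finally have "hnorm \<xi> \<le> 2 * (nm b * hnorm (rep_apply scale U u \<xi>))" by simp
  also have "\<dots> \<le> 2 * (nm b + 1) * hnorm (rep_apply scale U u \<xi>)" using hu by (simp add: algebra_simps)
  finally show ?thesis using nb by (simp add: field_simps)
qed

end

context monomial_rep
begin

lemma mop_fin_supp:
  assumes h: "h \<in> carrier G" and Z: "Z \<subseteq> Y" "\<And>x. x \<in> Z \<Longrightarrow> act h x \<in> Z" and f: "f \<in> fin_supp Z"
  shows "mop h f \<in> fin_supp Z"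
proof -
  have "{y. mop h f y \<noteq> 0} \<subseteq> act h ` supp f"
  proof
    fix y assume "y \<in> {y. mop h f y \<noteq> 0}"
    then have y: "y \<in> Y" "f (act (inv h) y) \<noteq> 0" by (auto simp: mop_def split: if_splits)
    then show "y \<in> act h ` supp f"
      using act_inv(1)[OF h y(1)] by (intro image_eqI[of _ _ "act (inv h) y"]) auto
  qed
  moreover have "act h ` supp f \<subseteq> Z" using f Z(2) by (auto simp: fin_supp_def)
  moreover have "finite (act h ` supp f)" using f by (simp add: fin_supp_def)
  ultimately show ?thesis unfolding fin_supp_def by (auto intro: finite_subset)
qed

text \<open>The gap of \<open>u\<close> upgrades one positive value of the form to a definite amount
  at a unit vector. The new vector is again finitely supported in \<open>Z\<close>, because the
  support of \<open>u\<close> maps \<open>Z\<close> into itself, so the step can be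
  repeated.\<close>

lemma positivity_sharpen:
  assumes u: "u \<in> carrier CG" "adjCG u = u" and b: "b \<in> carrier CG"
    and inv: "nm (\<lambda>x. (b \<star> u) x - oneCG x) \<le> 1/2"
    and Z: "Z \<subseteq> Y" "\<And>h x. \<lbrakk>u h \<noteq> 0; x \<in> Z\<rbrakk> \<Longrightarrow> act h x \<in> Z"
    and f: "f \<in> fin_supp Z" "0 < Re (ell2_ip Y f (rep_apply fun_scale mop u f))"
  obtains f' where "f' \<in> fin_supp Z" "ell2_ip Y f' f' = 1"
    "1 / (2 * (nm b + 1)) / 2 \<le> Re (ell2_ip Y f' (rep_apply fun_scale mop u f'))"
proof -
  interpret R: unitary_rep fun_scale "ell2 Y" "ell2_ip Y" G mop by (rule mop_unitary_rep)
  have DH: "fin_supp Z \<subseteq> ell2 Y" using fin_supp_ell2 Z(1) by blast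
  note inH = subsetD[OF DH]
  have uZ: "rep_apply fun_scale mop u x \<in> fin_supp Z" if x: "x \<in> fin_supp Z" for x
    unfolding rep_apply_def
  proof (intro fin_supp_sum fin_supp_scale)
    fix h assume "h \<in> supp u"
    then have h: "u h \<noteq> 0" by simp
    show "mop h x \<in> fin_supp Z" by (rule mop_fin_supp[OF CG_supp[OF u(1) h] Z(1) Z(2)[OF h] x])
  qed
  have "0 < 1 / (2 * (nm b + 1))" using full_norm_nonneg[OF b] by simp
  from R.numerical_range_gap[of "fin_supp Z" "rep_apply fun_scale mop u", OF DH fin_supp_add fin_supp_scale uZ
      R.rep_apply_arg_add[OF u(1) inH inH] R.rep_apply_arg_scale[OF u(1) inH]
      R.rep_apply_adj[OF u(1) inH inH, unfolded u(2)]
      R.hnorm_rep_apply_le_full_norm[OF u(1) inH] R.approx_inverse_gap[OF u(1) b inv inH] this f]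
  obtain f' where f': "f' \<in> fin_supp Z" "R.hnorm f' = 1"
    "1 / (2 * (nm b + 1)) / 2 \<le> Re (ell2_ip Y f' (rep_apply fun_scale mop u f'))" by blast
  have "ell2_ip Y f' f' = 1" using R.ip_self[OF inH[OF f'(1)]] f'(2) by simp
  then show thesis using f' by (intro that[of f'])
qed

section \<open>Tensor powers as functions on words\<close>

definition words :: "nat \<Rightarrow> 'y list set" where
  "words k = {ys. length ys = k \<and> set ys \<subseteq> Y}"

lemma mem_words: "ys \<in> words k \<longleftrightarrow> length ys = k \<and> set ys \<subseteq> Y"
  by (simp add: words_def)

abbreviation "wact \<equiv> \<lambda>h. map (act h)"
abbreviation "wph \<equiv> \<lambda>h ys. prod_list (map (ph h) ys)"

lemma words_rep: "monomial_rep G (words k) wact wph"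
  unfolding words_def by (rule monomial_rep_lists[OF monomial_rep_axioms])

abbreviation "wop k \<equiv> monomial_rep.mop G (words k) wact wph"

text \<open>The elementary tensor of \<open>f\<close> and \<open>w\<close>: splitting off the first
  letter identifies words of length \<open>Suc k\<close> with pairs. The value 0 at the empty word
  keeps the support among the nonempty words.\<close>

definition tensor :: "('y \<Rightarrow> complex) \<Rightarrow> ('y list \<Rightarrow> complex) \<Rightarrow> 'y list \<Rightarrow> complex" where
  "tensor f w = (\<lambda>ys. case ys of [] \<Rightarrow> 0 | y # ys \<Rightarrow> f y * w ys)"

lemma wop_apply:
  "wop k h w ys = (if ys \<in> words k then wph h (wact (inv h) ys) * w (wact (inv h) ys) else 0)"
  by (simp add: monomial_rep.mop_def[OF words_rep])

lemma tensor_supp: "{ys. tensor f w ys \<noteq> 0} = (\<lambda>(y, ys). y # ys) ` (supp f \<times> supp w)"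
proof (rule Set.set_eqI)
  fix ys
  show "ys \<in> {ys. tensor f w ys \<noteq> 0} \<longleftrightarrow> ys \<in> (\<lambda>(y, ys). y # ys) ` (supp f \<times> supp w)"
    by (cases ys) (auto simp: tensor_def)
qed

lemma tensor_fin_supp:
  assumes f: "f \<in> fin_supp Z" and w: "w \<in> fin_supp {ys. length ys = k \<and> set ys \<subseteq> Z}"
  shows "tensor f w \<in> fin_supp {ys. length ys = Suc k \<and> set ys \<subseteq> Z}"
proof -
  have "finite {ys. tensor f w ys \<noteq> 0}" using f w unfolding tensor_supp by (simp add: fin_supp_def)
  moreover have "{ys. tensor f w ys \<noteq> 0} \<subseteq> {ys. length ys = Suc k \<and> set ys \<subseteq> Z}"
    using f w unfolding tensor_supp by (auto simp: fin_supp_def subset_iff)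
  ultimately show ?thesis by (simp add: fin_supp_def)
qed

lemma tensor_ip:
  assumes f: "f \<in> fin_supp Y" and w: "w \<in> fin_supp (words k)"
  shows "ell2_ip (words (Suc k)) (tensor f w) (tensor f' w') = ell2_ip Y f f' * ell2_ip (words k) w w'"
proof -
  have t: "tensor f w \<in> fin_supp (words (Suc k))"
    using tensor_fin_supp[OF f w[unfolded words_def]] by (simp add: words_def)
  have inj: "inj_on (\<lambda>(y, ys). y # ys) (supp f \<times> supp w)" by (auto simp: inj_on_def)
  have "ell2_ip (words (Suc k)) (tensor f w) (tensor f' w') =
      (\<Sum>(y, ys)\<in>supp f \<times> supp w. (cnj (f y) * f' y) * (cnj (w ys) * w' ys))"
    unfolding fin_supp_ip[OF t subset_refl] tensor_supp sum.reindex[OF inj]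
    by (intro sum.cong refl) (auto simp: tensor_def mult_ac)
  also have "\<dots> = ell2_ip Y f f' * ell2_ip (words k) w w'"
    unfolding fin_supp_ip[OF f subset_refl] fin_supp_ip[OF w subset_refl]
    by (simp add: sum_product sum.cartesian_product)
  finally show ?thesis .
qed

lemma wop_tensor: "wop (Suc k) h (tensor f w) = tensor (mop h f) (wop k h w)"
proof
  fix ys
  show "wop (Suc k) h (tensor f w) ys = tensor (mop h f) (wop k h w) ys"
    by (cases ys; simp only: wop_apply; auto simp: tensor_def wop_apply mem_words mop_def)
qed

text \<open>A point \<open>x\<close> contributes only if both \<open>x\<close> and
  \<open>act h x\<close> lie in \<open>A\<close>; substituting \<open>act h x\<close> for
  \<open>y\<close> produces the sum that the Folner construction controls.\<close>

lemma indicator_coefficient: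
  assumes A: "finite A" "A \<subseteq> Y" "A \<noteq> {}" and h: "h \<in> carrier G"
  defines "f \<equiv> \<lambda>y. if y \<in> A then complex_of_real (1 / sqrt (card A)) else 0"
  shows "ell2_ip Y f (mop h f) = (\<Sum>x\<in>A. if act h x \<in> A then ph h x else 0) / card A"
proof -
  have cpos: "real (card A) > 0" using A by (simp add: card_gt_0_iff)
  have sq: "complex_of_real (1 / sqrt (card A)) * complex_of_real (1 / sqrt (card A)) = 1 / card A"
    using cpos by (simp flip: of_real_mult of_real_divide)
  have "ell2_ip Y f (mop h f) = (\<Sum>y\<in>A. cnj (f y) * mop h f y)"
    by (rule ell2_finite_support(2)[OF A(1,2)]) (simp add: f_def)
  also have "\<dots> = (\<Sum>y\<in>A. if act (inv h) y \<in> A then ph h (act (inv h) y) / card A else 0)"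
  proof (rule sum.cong[OF refl])
    fix y assume "y \<in> A"
    then show "cnj (f y) * mop h f y = (if act (inv h) y \<in> A then ph h (act (inv h) y) / card A else 0)"
      using A(2) sq by (auto simp: f_def mop_def)
  qed
  also have "\<dots> = (\<Sum>y\<in>{y\<in>A. act (inv h) y \<in> A}. ph h (act (inv h) y) / card A)"
    using A(1) by (simp add: sum.inter_filter)
  also have "\<dots> = (\<Sum>x\<in>{x\<in>A. act h x \<in> A}. ph h x / card A)"
    using A(2) h by (intro sum.reindex_bij_witness[of _ "act h" "act (inv h)"]) (auto simp: act_inv subset_iff)
  also have "\<dots> = (\<Sum>x\<in>A. if act h x \<in> A then ph h x / card A else 0)"
    using A(1) by (simp add: sum.inter_filter)
  also have "\<dots> = (\<Sum>x\<in>A. if act h x \<in> A then ph h x else 0) / card A"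
    unfolding sum_divide_distrib by (intro sum.cong) auto
  finally show ?thesis .
qed

text \<open>A positive value on \<open>k\<close> factors is sharpened to at least half of the gap
  constant at a unit vector \<open>w\<close>. Tensoring with the normalised indicator of
  \<open>A\<close> then changes the form by at most \<delta> times the sum of the moduli of the
  coefficients of \<open>u\<close>, which \<open>small\<close> keeps below that amount. Sharpening
  anew at each step prevents the losses from adding up.\<close>

lemma positivity_tensor_powers:
  fixes \<delta> :: real
  assumes u: "u \<in> carrier CG" "adjCG u = u" and b: "b \<in> carrier CG"
    and inv: "nm (\<lambda>x. (b \<star> u) x - oneCG x) \<le> 1/2"
    and Z: "Z \<subseteq> Y" "\<And>h x. \<lbrakk>u h \<noteq> 0; x \<in> Z\<rbrakk> \<Longrightarrow> act h x \<in> Z"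
    and g: "g \<in> carrier G" and less: "nm (\<lambda>x. cosine g x - u x) < 1"
    and A: "finite A" "A \<noteq> {}" "A \<subseteq> Z"
    and \<delta>: "\<And>h. u h \<noteq> 0 \<Longrightarrow> cmod ((\<Sum>x\<in>A. if act h x \<in> A then ph h x else 0) - card A) \<le> \<delta> * card A"
    and small: "\<delta> * (\<Sum>h | u h \<noteq> 0. cmod (u h)) < 1 / (2 * (nm b + 1)) / 2"
  shows "\<exists>w\<in>fin_supp {ys. length ys = k \<and> set ys \<subseteq> Z}.
    0 < Re (ell2_ip (words k) w (rep_apply fun_scale (wop k) u w))"
proof (induction k)
  case 0
  interpret R: unitary_rep fun_scale "ell2 (words 0)" "ell2_ip (words 0)" G "wop 0"
    by (rule monomial_rep.mop_unitary_rep[OF words_rep])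
  \<comment> \<open>The zeroth power is the trivial representation on the empty word, where
    \<open>g\<close> has eigenvalue 1.\<close>
  define w :: "'y list \<Rightarrow> complex" where "w = (\<lambda>ys. if ys = [] then 1 else 0)"
  have w: "w \<in> fin_supp {ys. length ys = 0 \<and> set ys \<subseteq> Z}" by (auto simp: fin_supp_def w_def)
  have wH: "w \<in> ell2 (words 0)" by (rule fin_supp_ell2[OF w]) (auto simp: mem_words)
  have ip1: "ell2_ip (words 0) w w = 1"
    using ell2_finite_support(2)[of "{[]}" "words 0" w w] by (simp add: w_def words_def)
  then have h1: "(R.hnorm w)\<^sup>2 = 1" using R.ip_self[OF wH] by (metis of_real_1 of_real_eq_iff)
  have "wop 0 g w = fun_scale (of_real 1) w"
    by (rule ext) (auto simp: wop_apply w_def mem_words)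
  from R.cosine_diff_bound[OF g wH this _ u(1)]
  have "0 < Re (ell2_ip (words 0) w (rep_apply fun_scale (wop 0) u w))" using less h1 by simp
  then show ?case using w by blast
next
  case (Suc k)
  then obtain w0 where w0: "w0 \<in> fin_supp {ys. length ys = k \<and> set ys \<subseteq> Z}"
    "0 < Re (ell2_ip (words k) w0 (rep_apply fun_scale (wop k) u w0))" by blast
  have Zw: "{ys. length ys = k \<and> set ys \<subseteq> Z} \<subseteq> words k" using Z(1) by (auto simp: words_def)
  have Zact: "wact h ys \<in> {ys. length ys = k \<and> set ys \<subseteq> Z}"
    if "u h \<noteq> 0" "ys \<in> {ys. length ys = k \<and> set ys \<subseteq> Z}" for h ys
    using that Z(2) by auto
  obtain w where w: "w \<in> fin_supp {ys. length ys = k \<and> set ys \<subseteq> Z}" "ell2_ip (words k) w w = 1"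
    "1 / (2 * (nm b + 1)) / 2 \<le> Re (ell2_ip (words k) w (rep_apply fun_scale (wop k) u w))"
    using monomial_rep.positivity_sharpen[OF words_rep u b inv Zw Zact w0] by blast
  interpret R: unitary_rep fun_scale "ell2 (words k)" "ell2_ip (words k)" G "wop k"
    by (rule monomial_rep.mop_unitary_rep[OF words_rep])
  interpret R': unitary_rep fun_scale "ell2 (words (Suc k))" "ell2_ip (words (Suc k))" G "wop (Suc k)"
    by (rule monomial_rep.mop_unitary_rep[OF words_rep])
  define f where "f = (\<lambda>y. if y \<in> A then complex_of_real (1 / sqrt (card A)) else 0)"
  have cpos: "real (card A) > 0" using A by (simp add: card_gt_0_iff)
  have AY: "A \<subseteq> Y" using A(3) Z(1) by simp
  have f: "f \<in> fin_supp Z" using A by (auto simp: fin_supp_def f_def intro: finite_subset)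
  have fY: "f \<in> fin_supp Y" using f Z(1) by (auto simp: fin_supp_def)
  have wY: "w \<in> fin_supp (words k)" using w(1) Zw by (auto simp: fin_supp_def)
  have wH: "w \<in> ell2 (words k)" by (rule fin_supp_ell2[OF wY subset_refl])
  have t: "tensor f w \<in> fin_supp {ys. length ys = Suc k \<and> set ys \<subseteq> Z}"
    by (rule tensor_fin_supp[OF f w(1)])
  have Zw': "{ys. length ys = Suc k \<and> set ys \<subseteq> Z} \<subseteq> words (Suc k)" using Z(1) by (auto simp: words_def)
  have tH: "tensor f w \<in> ell2 (words (Suc k))" by (rule fin_supp_ell2[OF t Zw'])
  have hw: "R.hnorm w = 1"
    using R.ip_self[OF wH] w(2) R.hnorm_ge0[OF wH] by (metis abs_of_nonneg of_real_1 of_real_eq_iff power2_eq_1_iff real_sqrt_abs real_sqrt_one)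
  have coef: "cmod (ell2_ip Y f (mop h f) - 1) \<le> \<delta>" if h: "u h \<noteq> 0" for h
  proof -
    have hG: "h \<in> carrier G" by (rule CG_supp[OF u(1) h])
    have "ell2_ip Y f (mop h f) - 1 = ((\<Sum>x\<in>A. if act h x \<in> A then ph h x else 0) - card A) / card A"
      unfolding f_def indicator_coefficient[OF A(1) AY A(2) hG] using cpos by (simp add: diff_divide_distrib)
    then have "cmod (ell2_ip Y f (mop h f) - 1) \<le> \<delta> * card A / card A"
      using divide_right_mono[OF \<delta>[OF h], of "real (card A)"] cpos by (simp add: norm_divide)
    then show ?thesis using cpos by simp
  qed
  \<comment> \<open>Matrix coefficients of a tensor product multiply, so each term changes by the
    coefficient of the new factor minus 1.\<close>
  have "ell2_ip (words (Suc k)) (tensor f w) (rep_apply fun_scale (wop (Suc k)) u (tensor f w)) -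
      ell2_ip (words k) w (rep_apply fun_scale (wop k) u w) =
      (\<Sum>h | u h \<noteq> 0. u h * (ell2_ip Y f (mop h f) - 1) * ell2_ip (words k) w (wop k h w))"
    unfolding R'.ip_rep_apply[OF u(1) tH] R.ip_rep_apply[OF u(1) wH] wop_tensor tensor_ip[OF fY wY]
    by (simp add: algebra_simps flip: sum_subtractf)
  also have "cmod \<dots> \<le> (\<Sum>h | u h \<noteq> 0. cmod (u h) * \<delta>)"
  proof (rule sum_norm_le)
    fix h assume "h \<in> supp u"
    then have h: "u h \<noteq> 0" "h \<in> carrier G" using CG_supp[OF u(1)] by auto
    have "cmod (ell2_ip (words k) w (wop k h w)) \<le> R.hnorm w * R.hnorm (wop k h w)"
      by (intro R.Cauchy_Schwarz R.U_closed h wH)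
    then have "cmod (ell2_ip (words k) w (wop k h w)) \<le> 1" using R.hnorm_U[OF h(2) wH] hw by simp
    then have "cmod (ell2_ip Y f (mop h f) - 1) * cmod (ell2_ip (words k) w (wop k h w)) \<le> \<delta> * 1"
      using coef[OF h(1)] order_trans[OF norm_ge_zero coef[OF h(1)]] by (intro mult_mono) auto
    then show "cmod (u h * (ell2_ip Y f (mop h f) - 1) * ell2_ip (words k) w (wop k h w)) \<le> cmod (u h) * \<delta>"
      using mult_left_mono[of _ _ "cmod (u h)"] by (simp add: norm_mult mult.assoc)
  qed
  also have "\<dots> = \<delta> * (\<Sum>h | u h \<noteq> 0. cmod (u h))" by (simp add: sum_distrib_left mult.commute)
  finally have "cmod (ell2_ip (words (Suc k)) (tensor f w) (rep_apply fun_scale (wop (Suc k)) u (tensor f w)) -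
      ell2_ip (words k) w (rep_apply fun_scale (wop k) u w)) < 1 / (2 * (nm b + 1)) / 2" using small by linarith
  then have "0 < Re (ell2_ip (words (Suc k)) (tensor f w) (rep_apply fun_scale (wop (Suc k)) u (tensor f w)))"
    using w(3) abs_Re_le_cmod[of "ell2_ip (words (Suc k)) (tensor f w) (rep_apply fun_scale (wop (Suc k)) u (tensor f w)) -
      ell2_ip (words k) w (rep_apply fun_scale (wop k) u w)"] by simp
  then show ?case using t by blast
qed

end

lemma (in group) cosine_distance_ge_1:
  assumes nil: "locally_nilpotent G" and g: "g \<in> carrier G" and ord: "ord g = 0"
    and u: "u \<in> carrier CG" "adjCG u = u" and b: "b \<in> carrier CG"
    and inv: "nm (\<lambda>x. (b \<star> u) x - oneCG x) \<le> 1/2"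
  shows "1 \<le> nm (\<lambda>x. cosine g x - u x)"
proof (rule ccontr)
  assume "\<not> 1 \<le> nm (\<lambda>x. cosine g x - u x)"
  then have less: "nm (\<lambda>x. cosine g x - u x) < 1" by simp
  define F where "F = supp u"
  have F: "finite F" "F \<subseteq> carrier G" using u(1) by (auto simp: F_def CG_carrier)
  \<comment> \<open>Local nilpotence speaks of finitely generated subgroups; this one contains
    \<open>g\<close> and every group element that the form of \<open>u\<close> involves.\<close>
  define K where "K = generate G (insert g F)"
  have S: "insert g F \<subseteq> carrier G" "finite (insert g F)" using F g by auto
  have K: "subgroup K G" unfolding K_def by (rule generate_is_subgroup[OF S(1)])
  have nilK: "nilpotent_group (G\<lparr>carrier := K\<rparr>)"
    using nil S by (simp add: locally_nilpotent_def K_def)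
  have gK: "g \<in> K" and FK: "F \<subseteq> K" unfolding K_def by (auto intro: generate.incl)
  define C where "C = (\<Sum>h | u h \<noteq> 0. cmod (u h))"
  have C0: "0 \<le> C" by (simp add: C_def sum_nonneg)
  define \<kappa> where "\<kappa> = 1 / (2 * (nm b + 1)) / 2"
  have \<kappa>: "0 < \<kappa>" using full_norm_nonneg[OF b] by (simp add: \<kappa>_def)
  \<comment> \<open>Dividing by \<open>C + 1\<close> rather than \<open>C\<close> keeps the divisor
    positive and the inequality \<open>\<delta> * C < \<kappa>\<close> strict.\<close>
  define \<delta> where "\<delta> = \<kappa> / (C + 1)"
  have \<delta>: "0 < \<delta>" "\<delta> * C < \<kappa>" using \<kappa> C0 by (auto simp: \<delta>_def field_simps)
  obtain T Z :: "'a set" and act ph and n :: nat and A where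
    rep: "monomial_rep G T act ph" and Z: "Z \<subseteq> T" "\<And>h x. \<lbrakk>h \<in> K; x \<in> Z\<rbrakk> \<Longrightarrow> act h x \<in> Z" and n: "0 < n"
    and gZ: "\<And>x. x \<in> Z \<Longrightarrow> act g x = x \<and> ph g x = cis (pi / n)"
    and A: "finite A" "A \<noteq> {}" "A \<subseteq> Z"
    and A_inv: "\<And>h. h \<in> F \<Longrightarrow> cmod ((\<Sum>x\<in>A. if act h x \<in> A then ph h x else 0) - card A) \<le> \<delta> * card A"
    by (rule exists_almost_invariant_monomial_rep[OF is_group K nilK gK ord F(1) FK \<delta>(1)]) (rule that)
  interpret monomial_rep G T act ph by (rule rep)
  have Zu: "act h x \<in> Z" if "u h \<noteq> 0" "x \<in> Z" for h x using Z(2) FK that by (auto simp: F_def)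
  have A_inv': "cmod ((\<Sum>x\<in>A. if act h x \<in> A then ph h x else 0) - card A) \<le> \<delta> * card A" if "u h \<noteq> 0" for h
    using A_inv that by (simp add: F_def)
  obtain w where w: "w \<in> fin_supp {ys. length ys = n \<and> set ys \<subseteq> Z}"
    "0 < Re (ell2_ip (words n) w (rep_apply fun_scale (wop n) u w))"
    using positivity_tensor_powers[OF u b inv Z(1) Zu g less A A_inv' \<delta>(2)[unfolded C_def \<kappa>_def], of n] by blast
  interpret R: unitary_rep fun_scale "ell2 (words n)" "ell2_ip (words n)" G "wop n"
    by (rule monomial_rep.mop_unitary_rep[OF words_rep])
  have Zw: "{ys. length ys = n \<and> set ys \<subseteq> Z} \<subseteq> words n" using Z(1) by (auto simp: words_def)
  have wH: "w \<in> ell2 (words n)" by (rule fin_supp_ell2[OF w(1) Zw])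
  \<comment> \<open>On words over \<open>Z\<close>, \<open>g\<close> fixes each of the
    \<open>n\<close> letters and gives each the phase \<open>cis (pi / n)\<close>, whose
    \<open>n\<close>-th power is -1. Words with a letter outside \<open>Z\<close> carry no mass of
    \<open>w\<close>, before or after \<open>g\<close> acts.\<close>
  have "wop n g w = fun_scale (of_real (-1)) w"
  proof
    fix ys
    show "wop n g w ys = of_real (-1) * w ys"
    proof (cases "ys \<in> words n")
      case ys: True
      have ig: "inv g \<in> carrier G" using g by simp
      define zs where "zs = map (act (inv g)) ys"
      have zs: "zs \<in> words n" "map (act g) zs = ys"
        using ys act_closed[OF ig] act_inv(1)[OF g] by (auto simp: zs_def words_def subset_iff intro!: map_idI)
      have e: "wop n g w ys = wph g zs * w zs"
        using ys by (simp add: wop_apply zs_def)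
      show ?thesis
      proof (cases "set zs \<subseteq> Z")
        case True
        then have "map (act g) zs = zs" using gZ by (auto intro!: map_idI)
        then have zy: "zs = ys" using zs(2) by simp
        have "map (ph g) zs = replicate (length zs) (cis (pi / n))"
          using True gZ by (auto simp: map_replicate_const[symmetric] subset_iff)
        then have "wph g zs = cis (pi / n) ^ n" using zs(1) by (simp add: words_def)
        also have "\<dots> = -1" using n by (simp add: Complex.DeMoivre)
        finally show ?thesis using e zy by simp
      next
        case False
        \<comment> \<open>As \<open>g\<close> fixes every word over \<open>Z\<close>, the preimage
          of such a word is the word itself; so \<open>ys\<close> is outside along with
          \<open>zs\<close>.\<close>
        have "\<not> set ys \<subseteq> Z"
        proof
          assume "set ys \<subseteq> Z"
          then have "map (act g) ys = ys" using gZ by (auto intro!: map_idI)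
          then have "zs = map (act (inv g)) (map (act g) ys)" by (simp add: zs_def)
          also have "\<dots> = ys" using ys act_inv(2)[OF g] by (auto simp: words_def subset_iff intro!: map_idI)
          finally show False using False \<open>set ys \<subseteq> Z\<close> by simp
        qed
        then have "w ys = 0" "w zs = 0" using w(1) False by (auto simp: fin_supp_def)
        then show ?thesis using e by simp
      qed
    next
      case False
      then have "w ys = 0" using wH by (simp add: ell2_def)
      then show ?thesis using False by (simp add: wop_apply)
    qed
  qed
  \<comment> \<open>The form at \<open>w\<close> differs from minus the squared norm by at most the
    squared norm, so it cannot be positive.\<close>
  from R.cosine_diff_bound[OF g wH this _ u(1)]
  have "\<bar>- (R.hnorm w)\<^sup>2 - Re (ell2_ip (words n) w (rep_apply fun_scale (wop n) u w))\<bar> \<le>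
      nm (\<lambda>x. cosine g x - u x) * (R.hnorm w)\<^sup>2" by simp
  also have "\<dots> \<le> (R.hnorm w)\<^sup>2" using less by (intro mult_left_le_one_le full_norm_nonneg CG_closed cosine_closed g u) auto
  finally show False using w(2) by linarith
qed

theorem proposition7p5:
  fixes G :: "('a, 'b) monoid_scheme"
  assumes "group G"
    and "locally_nilpotent G"
    and "\<not> locally_finite G"
  shows "strongly_not_FS G \<and> \<not> real_rank_zero (full_group_cstar G)"
proof -
  interpret group G by fact
  have np: "\<not> periodic_group G" by (rule locally_nilpotent_not_periodic[OF assms])
  have core: "1 \<le> nm (\<lambda>x. cosine g x - u x)"
    if "g \<in> carrier G" "ord g = 0" "u \<in> carrier CG" "b \<in> carrier CG" "adjCG u = u"
      "nm (\<lambda>x. (b \<star> u) x - oneCG x) \<le> 1/2" for g u b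
    using cosine_distance_ge_1[OF assms(2) that(1,2,3,5,4,6)] .
  have "strongly_not_FS G"
    unfolding strongly_not_FS_def
  proof (intro conjI np ballI impI)
    fix g assume g: "g \<in> carrier G" "ord g = 0"
    show "dist_fin_spec FC ((1/2) \<odot>\<^bsub>FC\<^esub> (group_unitary G g \<oplus>\<^bsub>FC\<^esub> group_unitary G (inv\<^bsub>G\<^esub> g))) = 1"
      unfolding FC_cosine[OF g(1)] using g(1) core[OF g] by (rule dist_fin_spec_cosine(1))
  qed
  moreover obtain g where g: "g \<in> carrier G" "ord g = 0" using np by (auto simp: periodic_group_def)
  have "\<not> real_rank_zero FC" using g(1) core[OF g] by (rule dist_fin_spec_cosine(2))
  ultimately show ?thesis by blast
qed

end
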